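(* There is an absolute constant $A>0$ such that, for every $C>0$ and $0\le\rho<1$, with $H=C/(1-\rho)$, one has $$e^{-A(1+H)}\le\epsilon_*(C,\rho).$$ If $H>3$, then $$\epsilon_*(C,\rho)\le\exp\!\left[\frac\pi2(3-H)\right].$$ The latter upper bound (for $H>3$) also holds for the supremum obtained by allowing $y\in[-1,1]^n$ instead of requiring $y\in\{-1,1\}^n$ in the definition of admissibility.
   Context: $\mathbb N=\{1,2,\ldots\}$. For a polynomial $P$ put $\|P\|_{[-1,1]}=\max_{-1\le t\le1}|P(t)|$. Node vectors may have repeated entries; counts refer to indices. For $x,y\in[-1,1]^n$ and $\rho\ge0$, $E_\rho(P;x,y):=\#\{i\in\{1,\dots,n\}:|P(x_i)-y_i|>\rho\}$. For real $D\ge0$ and $C>0$, $\mathcal P_D(C):=\{P\in\mathbb C[X]:\deg P\le D,\ \|P\|_{[-1,1]}\le C\}$, with $\deg0=-\infty$. Fix $C>0$ and $0\le\rho<1$. A number $\epsilon\in(0,1)$ is admissible if there exists $n_0\in\mathbb N$ such that for all $n\in\mathbb N$ with $n\ge n_0$ and all $x\in[-1,1]^n$ there exists $y\in\{-1,1\}^n$ such that $E_\rho(P;x,y)>\epsilon n$ for all $P\in\mathcal P_{(1+\epsilon)n}(C)$. Define $$\epsilon_*(C,\rho):=\sup\{\epsilon\in(0,1):\epsilon\text{ is admissible}\}.$$ A constant is absolute if it is independent of all nodes and all displayed parameters. *)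

theory Defs
  imports Complex_Main "HOL-Library.FuncSet" "HOL-Computational_Algebra.Polynomial"
begin

definition poly_norm :: "complex poly \<Rightarrow> real" where
  "poly_norm P = (SUP t\<in>{-1..1::real}. cmod (poly P (complex_of_real t)))"

text \<open>The supremum is attained, so it is the maximum of \<open>cmod P\<close> on the interval.\<close>

lemma poly_norm_attained:
  "\<exists>t\<in>{-1..1::real}. poly_norm P = cmod (poly P (complex_of_real t))
     \<and> (\<forall>s\<in>{-1..1::real}. cmod (poly P (complex_of_real s)) \<le> cmod (poly P (complex_of_real t)))"
proof -
  let ?f = "\<lambda>t::real. cmod (poly P (complex_of_real t))"
  have "continuous_on {-1..1::real} ?f"
    by (intro continuous_intros)
  then obtain t where t: "t \<in> {-1..1::real}" "\<forall>s\<in>{-1..1}. ?f s \<le> ?f t"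
    using continuous_attains_sup[of "{-1..1::real}" ?f] by auto
  then have "poly_norm P = ?f t"
    unfolding poly_norm_def by (intro cSup_eq_maximum) auto
  with t show ?thesis by blast
qed

text \<open>The library's \<open>degree 0\<close> is \<open>0\<close> rather than \<open>-\<infinity>\<close>; for \<open>D \<ge> 0\<close>, the only case used,
  the zero polynomial belongs to the class under either convention.\<close>

definition poly_class :: "real \<Rightarrow> real \<Rightarrow> complex poly set" where
  "poly_class D C = {P. real (degree P) \<le> D \<and> poly_norm P \<le> C}"

text \<open>A vector of length \<open>n\<close> is a function on \<open>nat\<close> of which only the values at the indices
  \<open>1, \<dots>, n\<close> matter.\<close>

definition err_count :: "nat \<Rightarrow> real \<Rightarrow> complex poly \<Rightarrow> (nat \<Rightarrow> real) \<Rightarrow> (nat \<Rightarrow> real) \<Rightarrow> nat" where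
  "err_count n \<rho> P x y =
     card {i \<in> {1..n}. cmod (poly P (complex_of_real (x i)) - complex_of_real (y i)) > \<rho>}"

text \<open>\<open>Y\<close> is the set of allowed target values: \<open>{-1, 1}\<close> or, for the relaxed version,
  \<open>{-1..1}\<close>.\<close>

definition admissible :: "real set \<Rightarrow> real \<Rightarrow> real \<Rightarrow> real \<Rightarrow> bool" where
  "admissible Y C \<rho> \<epsilon> \<longleftrightarrow> 0 < \<epsilon> \<and> \<epsilon> < 1 \<and>
     (\<exists>n0\<ge>1. \<forall>n\<ge>n0. \<forall>x \<in> {1..n} \<rightarrow> {-1..1}. \<exists>y \<in> {1..n} \<rightarrow> Y.
        \<forall>P \<in> poly_class ((1 + \<epsilon>) * real n) C. real (err_count n \<rho> P x y) > \<epsilon> * real n)"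

text \<open>The supremum is taken in \<open>[0, 1]\<close>, so it is \<open>0\<close> if no number is admissible
  (\<open>Sup {}\<close> is unspecified on \<open>real\<close>).\<close>

definition eps_star_on :: "real set \<Rightarrow> real \<Rightarrow> real \<Rightarrow> real" where
  "eps_star_on Y C \<rho> =
     (if \<exists>\<epsilon>. admissible Y C \<rho> \<epsilon> then Sup {\<epsilon>. admissible Y C \<rho> \<epsilon>} else 0)"

abbreviation eps_star :: "real \<Rightarrow> real \<Rightarrow> real" where
  "eps_star \<equiv> eps_star_on {-1, 1}"

end

theory Submission
  imports Defs "HOL-Complex_Analysis.Complex_Analysis"
begin

text \<open>
  Upper bound: at the \<open>n\<close> Chebyshev nodes, interpolate \<open>(1 - \<rho>) * y\<close> with the de la Vallee-Poussin
  kernel of degree \<open>n + s - 1\<close>, \<open>s\<close> the integer part of \<open>\<epsilon> * n\<close>. The Lebesgue constant is at most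
  \<open>3 + 2 / pi * ln (1 / \<epsilon>)\<close>, so for larger \<open>C / (1 - \<rho>)\<close> there is no error at all.

  Lower bound: put \<open>h = 1 + C / (1 - \<rho>)\<close> and call a set of indices shattered if every sign pattern
  on it is realised, with margin \<open>1\<close>, by a real polynomial of degree at most \<open>(1 + \<epsilon>) * n\<close> bounded by \<open>h\<close>.
  If \<open>\<epsilon>\<close> were not admissible, then after removal of few indices every set of at most \<open>B\<close> indices would be
  shattered. Bernstein's inequality separates the nodes of shattered pairs, so short windows contain at
  most \<open>B\<close> nodes, and averaging local solutions against a Jackson kernel yields interpolation of all
  bounded data at nearly \<open>2 * n\<close> points of the circle by trigonometric polynomials of degree only
  slightly above \<open>n\<close> and of norm \<open>O(h)\<close>. The kernel of the evaluation map then has dimension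
  \<open>O(d)\<close> with \<open>n / d = exp (O(h))\<close>, and a trace argument in the spirit of the
  Lozinski-Kharshiladze theorem, localised to scale \<open>1 / d\<close>, shows that the norm is at least a
  constant times \<open>ln (n / d)\<close>.
\<close>

section \<open>De la Vallee-Poussin interpolation at Chebyshev nodes\<close>

text \<open>If \<epsilon> is not admissible, every sign vector is fitted with few errors, but their
  location varies with the vector, so no fixed set of nodes is fitted for all vectors. Shattering
  survives this: a vector that is bad on each of many disjoint sets forces as many errors, so at
  most \<open>\<epsilon> * n\<close> disjoint sets are unshattered. Discarding such a family costs
  up to \<open>\<epsilon> * n * B\<close> indices. Hence only sets of bounded size \<open>B\<close>
  are within reach, and global interpolation has to be assembled from windows. The surplus of
  degrees of freedom over nodes really helps interpolation: it is what lowers the norm to order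
  \<open>ln (n / d)\<close> in the upper bound. The lower bound can therefore use only frequencies
  that are multiples of the surplus scale \<open>d\<close>; there are \<open>J\<close> of them, of
  order \<open>n / d\<close>, and they contribute about \<open>ln J\<close>. As the norm is O(h),
  \<open>J = exp (150 * h)\<close> up to rounding is already contradictory. The lost indices must
  stay below \<open>n / J\<close>, so \<epsilon> must be below \<open>1 / (B * J)\<close> with
  \<open>B\<close> of order \<open>h^2 * J\<close>; this is roughly \<open>J^-2\<close> and explains
  the constant \<open>320\<close>.\<close>

lemma Chebyshev_poly_exists:
  "\<exists>T::complex poly. degree T \<le> k \<and> (\<forall>t. poly T (complex_of_real (cos t)) = of_real (cos (real k * t)))"
proof (induction k rule: less_induct)
  case (less k)
  consider "k = 0" | "k = 1" | j where "k = Suc (Suc j)"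
    by (cases k; cases "k - 1") auto
  then show ?case
  proof cases
    case 1 then show ?thesis by (intro exI[of _ 1]) auto
  next
    case 2 then show ?thesis by (intro exI[of _ "[:0,1:]"]) auto
  next
    case 3
    obtain T1 T2 :: "complex poly" where
      T1: "degree T1 \<le> Suc j" "\<And>t. poly T1 (complex_of_real (cos t)) = of_real (cos (real (Suc j) * t))" and
      T2: "degree T2 \<le> j" "\<And>t. poly T2 (complex_of_real (cos t)) = of_real (cos (real j * t))"
      using less.IH[of "Suc j"] less.IH[of j] 3 by auto
    have "degree ([:0,2:] * T1 - T2) \<le> k"
    proof (rule degree_diff_le)
      show "degree ([:0,2:] * T1) \<le> k"
        using degree_mult_le[of "[:0,2:]" T1] T1 3 by simp
    qed (use T2 3 in auto)
    moreover have "poly ([:0,2:] * T1 - T2) (complex_of_real (cos t)) = of_real (cos (real k * t))" for t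
    proof -
      have "cos (real k * t) + cos (real j * t) = 2 * cos t * cos (real (Suc j) * t)"
        using cos_plus_cos[of "real k * t" "real j * t"] 3 by (simp add: algebra_simps add_divide_distrib)
      then have "cos (real k * t) = 2 * cos t * cos (real (Suc j) * t) - cos (real j * t)"
        by simp
      then show ?thesis
        using T1(2)[of t] T2(2)[of t] by (simp only: poly_diff poly_mult of_real_diff of_real_mult) simp
    qed
    ultimately show ?thesis by blast
  qed
qed

text \<open>The de la Vallee-Poussin kernel as the average of the Dirichlet kernels of orders
  \<open>n - s, \<dots>, n + s - 1\<close>. It agrees with the interpolation kernel of \<open>2 * n\<close> equidistant nodes, but
  its closed form has the additional decaying factor \<open>sin (s * x) / (s * sin (x / 2))\<close>, which
  lowers the Lebesgue constant from order \<open>ln n\<close> to order \<open>ln (n / s)\<close>.\<close>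

definition dlvp :: "nat \<Rightarrow> nat \<Rightarrow> real \<Rightarrow> real" where
  "dlvp n s x = (\<Sum>i\<in>{n-s..<n+s}. 1 + 2 * (\<Sum>k=1..i. cos (real k * x))) / (2 * real s)"

lemma Dirichlet_kernel: "sin (x/2) * (1 + 2 * (\<Sum>k=1..i. cos (real k * x))) = sin ((real i + 1/2) * x)"
proof (induction i)
  case (Suc i)
  have "2 * sin (x/2) * cos (real (Suc i) * x) = sin ((real (Suc i) + 1/2) * x) - sin ((real i + 1/2) * x)"
    using sin_diff_sin[of "(real (Suc i) + 1/2) * x" "(real i + 1/2) * x"]
    by (simp add: algebra_simps add_divide_distrib)
  with Suc show ?case by (simp add: algebra_simps)
qed simp

text \<open>One factor \<open>sin (x/2)\<close> turns each Dirichlet kernel into a sine, the second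
  makes the sum of these sines telescope. The denominator stays on the left so that the identity
  also holds at multiples of \<open>2 * pi\<close>.\<close>

lemma dlvp_closed_form:
  assumes "0 < s" "s \<le> n"
  shows "dlvp n s x * (2 * real s * (sin (x/2))\<^sup>2) = sin (real n * x) * sin (real s * x)"
proof -
  have telescope: "(\<Sum>i\<in>{a..<b}. 2 * (sin (x/2) * sin ((real i + 1/2) * x))) = cos (real a * x) - cos (real b * x)"
    if "a \<le> b" for a b
    using that
  proof (induction b rule: dec_induct)
    case (step b)
    have "2 * (sin (x/2) * sin ((real b + 1/2) * x)) = cos (real b * x) - cos (real (Suc b) * x)"
      using cos_diff_cos[of "real b * x" "real (Suc b) * x"]
      by (simp add: algebra_simps add_divide_distrib)
    then show ?case using step by simp
  qed simp
  have "dlvp n s x * (2 * real s * (sin (x/2))\<^sup>2) =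
      (\<Sum>i\<in>{n-s..<n+s}. sin (x/2) * (sin (x/2) * (1 + 2 * (\<Sum>k=1..i. cos (real k * x)))))"
  proof -
    have "dlvp n s x * (2 * real s * (sin (x/2))\<^sup>2) =
        (\<Sum>i\<in>{n-s..<n+s}. 1 + 2 * (\<Sum>k=1..i. cos (real k * x))) * (sin (x/2))\<^sup>2"
      using assms by (simp add: dlvp_def)
    then show ?thesis
      by (simp add: sum_distrib_left[symmetric] power2_eq_square mult_ac)
  qed
  also have "\<dots> = (\<Sum>i\<in>{n-s..<n+s}. sin (x/2) * sin ((real i + 1/2) * x))"
    by (simp only: Dirichlet_kernel)
  also have "2 * \<dots> = cos (real (n-s) * x) - cos (real (n+s) * x)"
    using telescope[of "n-s" "n+s"] by (simp add: sum_distrib_left)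
  also have "\<dots> = 2 * (sin (real n * x) * sin (real s * x))"
    using assms cos_diff_cos[of "real (n-s) * x" "real (n+s) * x"]
    by (simp add: of_nat_diff algebra_simps add_divide_distrib)
  finally show ?thesis by (simp add: mult_ac)
qed

text \<open>\<open>1 + 2 * i\<close> is the value at \<open>0\<close>, and the maximum, of the
  Dirichlet kernel of order \<open>i\<close>; the sum therefore yields both the bound for
  \<open>dlvp\<close> and its value at \<open>0\<close>.\<close>

lemma sum_odd_numbers_ivl:
  assumes "s \<le> n"
  shows "(\<Sum>i\<in>{n-s..<n+s}. 1 + 2 * real i) = 4 * real n * real s"
proof -
  have odd_sum: "(\<Sum>i<m. 1 + 2 * real i) = real m ^ 2" for m
    by (induction m) (auto simp: power2_eq_square algebra_simps)
  have "(\<Sum>i\<in>{n-s..<n+s}. 1 + 2 * real i) = (\<Sum>i<n+s. 1 + 2 * real i) - (\<Sum>i<n-s. 1 + 2 * real i)"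
    using sum_diff_nat_ivl[of 0 "n-s" "n+s" "\<lambda>i. 1 + 2 * real i"] by (simp add: lessThan_atLeast0)
  also have "\<dots> = 4 * real n * real s"
    unfolding odd_sum using assms by (simp add: of_nat_diff power2_eq_square algebra_simps)
  finally show ?thesis .
qed

lemma dlvp_abs_le:
  assumes "0 < s" "s \<le> n"
  shows "\<bar>dlvp n s x\<bar> \<le> 2 * real n"
proof -
  have "\<bar>\<Sum>i\<in>{n-s..<n+s}. 1 + 2 * (\<Sum>k=1..i. cos (real k * x))\<bar> \<le> (\<Sum>i\<in>{n-s..<n+s}. 1 + 2 * real i)"
  proof (rule order_trans[OF sum_abs sum_mono])
    fix i
    have "\<bar>\<Sum>k=1..i. cos (real k * x)\<bar> \<le> (\<Sum>k=1..i. 1)"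
      by (rule order_trans[OF sum_abs sum_mono]) auto
    then show "\<bar>1 + 2 * (\<Sum>k=1..i. cos (real k * x))\<bar> \<le> 1 + 2 * real i" by simp
  qed
  also have "\<dots> = 4 * real n * real s" by (rule sum_odd_numbers_ivl[OF assms(2)])
  finally show ?thesis
    using assms by (simp add: dlvp_def field_simps)
qed

lemma dlvp_zero:
  assumes "0 < s" "s \<le> n"
  shows "dlvp n s 0 = 2 * real n"
proof -
  show ?thesis
    using assms sum_odd_numbers_ivl[OF assms(2)] by (simp add: dlvp_def)
qed

lemma dlvp_minus: "dlvp n s (-x) = dlvp n s x"
  by (simp add: dlvp_def)

lemma dlvp_plus_2pi: "dlvp n s (x + 2 * pi) = dlvp n s x"
proof -
  have "cos (real k * (x + 2*pi)) = cos (real k * x)" for k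
    using cos.plus_of_nat[of "real k * x" k] by (simp add: algebra_simps)
  then show ?thesis by (simp add: dlvp_def)
qed

text \<open>The nodes are zeros of \<open>sin (n * x)\<close>, and the range of \<open>p\<close>
  keeps \<open>sin (x/2)\<close> positive, so the closed form can be divided by it.\<close>

lemma dlvp_node_eq_0:
  assumes "0 < s" "s \<le> n" "0 < p" "p < 2 * n"
  shows "dlvp n s (real p * pi / real n) = 0"
proof -
  have "sin (real p * pi / real n / 2) > 0"
    using assms by (intro sin_gt_zero) (auto simp: field_simps)
  moreover have "sin (real n * (real p * pi / real n)) = 0"
    using assms by simp
  ultimately show ?thesis
    using dlvp_closed_form[OF assms(1,2), of "real p * pi / real n"] assms by simp
qed

section \<open>Size of the kernel and its Lebesgue constant\<close>

lemma abs_sin_mult_le: "\<bar>sin (real s * x)\<bar> \<le> real s * \<bar>sin x\<bar>"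
proof (induction s)
  case (Suc s)
  have "sin (real (Suc s) * x) = sin (real s * x) * cos x + cos (real s * x) * sin x"
    by (simp add: distrib_right sin_add algebra_simps)
  also have "\<bar>\<dots>\<bar> \<le> \<bar>sin (real s * x)\<bar> * 1 + 1 * \<bar>sin x\<bar>"
    by (intro order_trans[OF abs_triangle_ineq] add_mono) (auto simp: abs_mult intro!: mult_mono mult_left_le mult_left_le_one_le)
  finally show ?case using Suc by (simp add: algebra_simps)
qed simp

text \<open>Jordan's inequality: sine is concave and lies above its chord from \<open>0\<close> to
  \<open>pi / 2\<close>.\<close>

lemma sin_ge_linear:
  assumes "0 \<le> x" "x \<le> pi / 2"
  shows "sin x \<ge> 2 * x / pi"
proof -
  have "concave_on {0..pi} sin"
    unfolding concave_on_def
  proof (rule f''_ge0_imp_convex)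
    fix x :: real assume "x \<in> {0..pi}"
    show "((\<lambda>x. - sin x) has_real_derivative - cos x) (at x)"
      by (auto intro!: derivative_eq_intros)
    show "((\<lambda>x. - cos x) has_real_derivative sin x) (at x)"
      by (auto intro!: derivative_eq_intros)
    show "sin x \<ge> 0" using \<open>x \<in> {0..pi}\<close> by (simp add: sin_ge_zero)
  qed auto
  from concave_onD[OF this, of "2*x/pi" 0 "pi/2"] assms
  show ?thesis by (simp add: field_simps)
qed

text \<open>Bounding \<open>sin (s * x)\<close> by \<open>s * sin x\<close> cancels \<open>s\<close>
  and leaves at most \<open>cot (x/2)\<close>, which is at most \<open>2 / x\<close>. The factor
  \<open>2 / pi\<close> of the logarithm, hence the \<open>pi / 2\<close> in the exponent of the
  theorem, originates here.\<close>

lemma dlvp_bound_near: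
  assumes "0 < s" "s \<le> n" "0 < x" "x \<le> pi"
  shows "\<bar>dlvp n s x\<bar> / (2 * real n) \<le> 1 / (real n * x)"
proof -
  have pos: "sin (x/2) > 0" using assms by (intro sin_gt_zero) auto
  have "\<bar>dlvp n s x\<bar> * (2 * real s * (sin (x/2))\<^sup>2) = \<bar>sin (real n * x)\<bar> * \<bar>sin (real s * x)\<bar>"
    using arg_cong[OF dlvp_closed_form[OF assms(1,2), of x], of abs] assms by (simp add: abs_mult)
  also have "\<dots> \<le> 1 * (real s * \<bar>sin x\<bar>)"
    by (intro mult_mono abs_sin_mult_le) auto
  also have "\<dots> = 2 * real s * sin (x/2) * cos (x/2)"
    using assms sin_double[of "x/2"] sin_ge_zero[of x] by simp
  finally have "\<bar>dlvp n s x\<bar> * sin (x/2) \<le> cos (x/2)"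
    using assms pos by (simp add: power2_eq_square mult_ac)
  moreover have "cos (x/2) * (x/2) \<le> sin (x/2)"
  proof (cases "x < pi")
    case True
    then have "cos (x/2) > 0" using assms by (intro cos_gt_zero) auto
    moreover have "x/2 \<le> tan (x/2)"
      using abs_tan_ge[of "x/2"] tan_gt_zero[of "x/2"] True assms by simp
    ultimately show ?thesis by (simp add: tan_def field_simps)
  next
    case False then have "x = pi" using assms by simp
    then show ?thesis by simp
  qed
  ultimately have "\<bar>dlvp n s x\<bar> * sin (x/2) * (x/2) \<le> sin (x/2)"
    using assms by (smt (verit) mult_right_mono divide_nonneg_nonneg)
  then have "\<bar>dlvp n s x\<bar> * (x/2) \<le> 1"
    using pos by (simp add: mult_ac)
  then show ?thesis using assms by (simp add: field_simps)
qed

text \<open>Both sines of the closed form are bounded by \<open>1\<close>. The decay is now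
  quadratic, hence summable over the distant nodes, at the price of a factor that grows when
  \<open>s\<close> is small.\<close>

lemma dlvp_bound_far:
  assumes "0 < s" "s \<le> n" "0 < x" "x \<le> pi"
  shows "\<bar>dlvp n s x\<bar> / (2 * real n) \<le> pi\<^sup>2 / (4 * real n * real s * x\<^sup>2)"
proof -
  have "x / pi \<le> sin (x/2)" using sin_ge_linear[of "x/2"] assms by simp
  then have sq: "(x/pi)\<^sup>2 \<le> (sin (x/2))\<^sup>2" using assms by (intro power_mono) auto
  have "\<bar>dlvp n s x\<bar> * (2 * real s * (x/pi)\<^sup>2) \<le> \<bar>dlvp n s x\<bar> * (2 * real s * (sin (x/2))\<^sup>2)"
    using sq by (intro mult_left_mono) auto
  also have "\<dots> = \<bar>sin (real n * x)\<bar> * \<bar>sin (real s * x)\<bar>"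
    using arg_cong[OF dlvp_closed_form[OF assms(1,2), of x], of abs] assms by (simp add: abs_mult)
  also have "\<dots> \<le> 1 * 1" by (intro mult_mono) auto
  finally show ?thesis using assms by (simp add: field_simps)
qed

text \<open>The first bound is summed up to \<open>K\<close> and gives the logarithm, the second one
  beyond \<open>K\<close>.\<close>

lemma sum_bound_harmonic_quadratic:
  fixes g :: "nat \<Rightarrow> real"
  assumes "K \<ge> 1" "A \<ge> 0" "B \<ge> 0"
    and near: "\<And>j. 1 \<le> j \<Longrightarrow> j < n \<Longrightarrow> g j \<le> A / real j"
    and far: "\<And>j. 1 \<le> j \<Longrightarrow> j < n \<Longrightarrow> g j \<le> B / (real j)\<^sup>2"
  shows "(\<Sum>j\<in>{1..<n}. g j) \<le> A * (1 + ln (real K)) + B / (real K + 1/2)"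
proof -
  have tele: "(\<Sum>j\<in>{K+1..<m}. 1 / (real j)\<^sup>2) \<le> 1 / (real K + 1/2) - 1 / (real m - 1/2)" if "K + 1 \<le> m" for m
    using that
  proof (induction m rule: dec_induct)
    case (step m)
    \<comment> \<open>\<open>m^2\<close> exceeds \<open>(m - 1/2) * (m + 1/2)\<close>, whose
      reciprocal telescopes. The half shift is sharper than a comparison with
      \<open>m * (m - 1)\<close> and helps to keep the final constant below
      \<open>3\<close>.\<close>
    have "1 / (real m)\<^sup>2 \<le> 1 / (real m - 1/2) - 1 / (real (Suc m) - 1/2)"
    proof -
      have "1 / (real m - 1/2) - 1 / (real (Suc m) - 1/2) = 1 / ((real m - 1/2) * (real m + 1/2))"
        using step by (simp add: field_simps)
      moreover have "0 < (real m - 1/2) * (real m + 1/2)"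
        using step by (intro mult_pos_pos) auto
      moreover have "(real m - 1/2) * (real m + 1/2) \<le> (real m)\<^sup>2"
        by (simp add: power2_eq_square algebra_simps)
      ultimately show ?thesis by (simp add: frac_le)
    qed
    then show ?case using step by simp
  qed (simp add: add.commute)
  have "(\<Sum>j\<in>{1..<n}. g j) = (\<Sum>j\<in>{1..<n} \<inter> {1..K}. g j) + (\<Sum>j\<in>{1..<n} \<inter> {K+1..<n}. g j)"
    by (subst sum.union_disjoint[symmetric]) (auto intro!: sum.cong)
  also have "(\<Sum>j\<in>{1..<n} \<inter> {1..K}. g j) \<le> (\<Sum>j\<in>{1..<n} \<inter> {1..K}. A / real j)"
    using near by (intro sum_mono) auto
  also have "\<dots> \<le> (\<Sum>j\<in>{1..K}. A / real j)"
    using assms by (intro sum_mono2) auto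
  also have "\<dots> = A * harm K"
    by (simp add: harm_def sum_distrib_left divide_inverse)
  also have "harm K \<le> 1 + ln (real K)"
    using decseqD[OF decseq_harm_diff_ln, of 0 "K - 1"] assms(1) by (simp add: harm_expand)
  also have "(\<Sum>j\<in>{1..<n} \<inter> {K+1..<n}. g j) \<le> (\<Sum>j\<in>{1..<n} \<inter> {K+1..<n}. B / (real j)\<^sup>2)"
    using far by (intro sum_mono) auto
  also have "\<dots> \<le> (\<Sum>j\<in>{K+1..<K+1+n}. B / (real j)\<^sup>2)"
    using assms by (intro sum_mono2) auto
  also have "\<dots> = B * (\<Sum>j\<in>{K+1..<K+1+n}. 1 / (real j)\<^sup>2)"
    by (subst sum_distrib_left) simp
  also have "\<dots> \<le> B * (1 / (real K + 1/2))"
  proof (rule mult_left_mono[OF order_trans[OF tele]])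
    show "1 / (real K + 1 / 2) - 1 / (real (K + 1 + n) - 1 / 2) \<le> 1 / (real K + 1 / 2)"
      by (simp del: of_nat_add)
  qed (use assms in auto)
  finally show ?thesis using assms by (simp add: mult_left_mono)
qed

text \<open>As the kernel is even and periodic, the second half of the nodes, read backwards, is the
  first half for \<open>u' = pi / n - u\<close>. What remains are two terms with
  \<open>j = 0\<close> and two tails inside \<open>(0, pi]\<close>.\<close>

lemma dlvp_Lebesgue_aux:
  assumes "0 < s" "s \<le> n" "1 \<le> K" "0 \<le> u" "u \<le> pi / real n"
  shows "(\<Sum>j<2*n. \<bar>dlvp n s (u + real j * pi / real n)\<bar> / (2 * real n))
    \<le> 1 + 4 / pi + 2 / pi * ln (real K) + real n / (2 * real s * (real K + 1/2))"
proof -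
  have n: "n \<ge> 1" using assms by simp
  define g where "g v j = \<bar>dlvp n s (v + real j * pi / real n)\<bar> / (2 * real n)" for v j
  define u' where "u' = pi / real n - u"
  have tail: "(\<Sum>j\<in>{1..<n}. g v j) \<le> 1 / pi * (1 + ln (real K)) + real n / (4 * real s) / (real K + 1/2)"
    if v: "0 \<le> v" "v \<le> pi / real n" for v
  proof (rule sum_bound_harmonic_quadratic)
    fix j :: nat assume j: "1 \<le> j" "j < n"
    define x where "x = v + real j * pi / real n"
    have lower: "real j * pi / real n \<le> x" using v by (simp add: x_def)
    have pos: "0 < real j * pi / real n" using j by simp
    have "x \<le> (real j + 1) * pi / real n"
      using v by (simp add: x_def distrib_right add_divide_distrib)
    also have "\<dots> \<le> real n * pi / real n"
      using j by (intro divide_right_mono mult_right_mono) auto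
    also have "\<dots> = pi" using n by simp
    finally have "x \<le> pi" .
    have "0 < x" using lower pos by simp
    have "g v j \<le> 1 / (real n * x)"
      using dlvp_bound_near[OF assms(1,2) \<open>0 < x\<close> \<open>x \<le> pi\<close>] by (simp add: g_def x_def)
    also have "\<dots> \<le> 1 / (real n * (real j * pi / real n))"
      using lower pos n by (intro divide_left_mono mult_left_mono mult_pos_pos) (auto simp: \<open>0 < x\<close>)
    finally show "g v j \<le> 1 / pi / real j" using n by (simp add: field_simps)
    have "g v j \<le> pi\<^sup>2 / (4 * real n * real s * x\<^sup>2)"
      using dlvp_bound_far[OF assms(1,2) \<open>0 < x\<close> \<open>x \<le> pi\<close>] by (simp add: g_def x_def)
    also have "\<dots> \<le> pi\<^sup>2 / (4 * real n * real s * (real j * pi / real n)\<^sup>2)"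
      using lower pos n assms \<open>0 < x\<close>
      by (intro divide_left_mono mult_left_mono mult_pos_pos power_mono zero_less_power) auto
    finally show "g v j \<le> real n / (4 * real s) / (real j)\<^sup>2"
      using n assms j by (simp add: field_simps power2_eq_square)
  qed (use assms in auto)
  have refl: "g u (2 * n - 1 - j) = g u' j" if "j < n" for j
  proof -
    have "u + real (2 * n - 1 - j) * pi / real n = - (u' + real j * pi / real n) + 2 * pi"
      using that n by (simp add: u'_def of_nat_diff field_simps)
    then show ?thesis unfolding g_def by (metis dlvp_plus_2pi dlvp_minus)
  qed
  have "(\<Sum>j<2*n. g u j) = (\<Sum>j<n. g u j) + (\<Sum>j\<in>{n..<2*n}. g u j)"
    by (simp add: lessThan_atLeast0 sum.atLeastLessThan_concat)
  also have "(\<Sum>j\<in>{n..<2*n}. g u j) = (\<Sum>j<n. g u' j)"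
  proof (rule sum.reindex_bij_witness[of _ "\<lambda>j. 2*n-1-j" "\<lambda>j. 2*n-1-j"])
    fix j assume "j \<in> {n..<2*n}"
    then have "2 * n - 1 - j < n" "2 * n - 1 - (2 * n - 1 - j) = j" by auto
    then show "g u' (2 * n - 1 - j) = g u j"
      using refl[of "2 * n - 1 - j"] by simp
  qed auto
  finally have "(\<Sum>j<2*n. g u j) = (g u 0 + g u' 0) + ((\<Sum>j\<in>{1..<n}. g u j) + (\<Sum>j\<in>{1..<n}. g u' j))"
    using n by (simp add: lessThan_atLeast0 sum.atLeast_Suc_lessThan)
  \<comment> \<open>The two nodes around the peak cannot both be close to it: one of
    \<open>u\<close>, \<open>u'\<close> is at least half a mesh, where the near bound gives
    \<open>2 / pi\<close> instead of the trivial \<open>1\<close>.\<close>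
  moreover have "g u 0 + g u' 0 \<le> 1 + 2 / pi"
  proof -
    have one: "g v 0 \<le> 1" for v
      using dlvp_abs_le[OF assms(1,2)] n by (simp add: g_def field_simps)
    have two: "g v 0 \<le> 2 / pi" if "pi / (2 * real n) \<le> v" "v \<le> pi / real n" for v
    proof -
      have pos: "0 < pi / (2 * real n)" using n by simp
      have "v \<le> pi" using that n by (smt (verit) divide_le_eq_1 frac_le of_nat_1 of_nat_mono pi_gt_zero div_by_1)
      then have "g v 0 \<le> 1 / (real n * v)"
        using dlvp_bound_near[OF assms(1,2), of v] order.strict_trans2[OF pos that(1)]
        by (simp add: g_def)
      also have "\<dots> \<le> 1 / (real n * (pi / (2 * real n)))"
        using that pos n order.strict_trans2[OF pos that(1)]
        by (intro divide_left_mono mult_left_mono mult_pos_pos) auto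
      finally show ?thesis using n by simp
    qed
    show ?thesis
    proof (cases "pi / (2 * real n) \<le> u")
      case True then show ?thesis using one[of u'] two[of u] assms by simp
    next
      case False
      then have "pi / (2 * real n) \<le> u'" by (simp add: u'_def field_simps)
      then show ?thesis using one[of u] two[of u'] assms by (simp add: u'_def)
    qed
  qed
  moreover have "(\<Sum>j\<in>{1..<n}. g u j) \<le> 1 / pi * (1 + ln (real K)) + real n / (4 * real s) / (real K + 1/2)"
    "(\<Sum>j\<in>{1..<n}. g u' j) \<le> 1 / pi * (1 + ln (real K)) + real n / (4 * real s) / (real K + 1/2)"
    using tail[OF assms(4,5)] tail[of u'] assms by (simp_all add: u'_def)
  moreover have "x \<le> 1 + 2/pi + 2 * T"
    if "x = (a + b) + (c + d)" "a + b \<le> 1 + 2/pi" "c \<le> T" "d \<le> T" for x a b c d T :: real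
    using that by linarith
  ultimately have "(\<Sum>j<2*n. g u j) \<le> 1 + 2/pi + 2 * (1 / pi * (1 + ln (real K)) + real n / (4 * real s) / (real K + 1/2))"
    by blast
  also have "\<dots> = 1 + 4 / pi + 2 / pi * ln (real K) + real n / (2 * real s * (real K + 1/2))"
    by (simp add: field_simps)
  finally show ?thesis by (simp add: g_def)
qed

text \<open>A shift by the mesh \<open>pi / n\<close> permutes the \<open>2 * n\<close> nodes modulo
  \<open>2 * pi\<close>, which reduces \<open>t\<close> to one mesh cell.\<close>

lemma dlvp_Lebesgue:
  assumes "0 < s" "s \<le> n" "1 \<le> K"
  shows "(\<Sum>j<2*n. \<bar>dlvp n s (t + real j * pi / real n)\<bar> / (2 * real n))
    \<le> 1 + 4 / pi + 2 / pi * ln (real K) + real n / (2 * real s * (real K + 1/2))"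
proof -
  have n: "n \<ge> 1" using assms by simp
  define S where "S t = (\<Sum>j<2*n. \<bar>dlvp n s (t + real j * pi / real n)\<bar> / (2 * real n))" for t
  have step: "S (t + pi / real n) = S t" for t
  proof -
    define F where "F j = \<bar>dlvp n s (t + real j * pi / real n)\<bar> / (2 * real n)" for j
    have "S (t + pi / real n) = (\<Sum>j<2*n. F (Suc j))"
      unfolding S_def F_def by (intro sum.cong) (auto simp: add_divide_distrib distrib_right add_ac)
    moreover have "F (2*n) = F 0"
      using n dlvp_plus_2pi[of n s t] by (simp add: F_def)
    ultimately show ?thesis
      using sum.lessThan_Suc_shift[of F "2*n"] sum.lessThan_Suc[of F "2*n"] by (simp add: S_def F_def[symmetric])
  qed
  have shift: "S (t + real_of_int k * pi / real n) = S t" for k t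
  proof (induction k rule: int_induct[where k = 0])
    case (step1 i)
    then show ?case using step[of "t + real_of_int i * pi / real n"] by (simp add: algebra_simps add_divide_distrib)
  next
    case (step2 i)
    then show ?case using step[of "t + real_of_int (i - 1) * pi / real n"] by (simp add: algebra_simps diff_divide_distrib)
  qed simp
  define k where "k = \<lfloor>t * real n / pi\<rfloor>"
  define u where "u = t - real_of_int k * pi / real n"
  have "real_of_int k \<le> t * real n / pi" "t * real n / pi < real_of_int k + 1"
    by (simp_all add: k_def)
  then have "real_of_int k * pi / real n \<le> t" "t < (real_of_int k + 1) * pi / real n"
    using n by (simp_all add: pos_divide_le_eq pos_le_divide_eq pos_less_divide_eq pos_divide_less_eq)
  then have "0 \<le> u" "u \<le> pi / real n"
    by (simp_all add: u_def distrib_right add_divide_distrib)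
  then have "S u \<le> 1 + 4 / pi + 2 / pi * ln (real K) + real n / (2 * real s * (real K + 1/2))"
    using dlvp_Lebesgue_aux[OF assms] by (simp add: S_def)
  moreover have "S t = S u"
    using shift[of u k] by (simp add: u_def)
  ultimately show ?thesis by (simp add: S_def)
qed

text \<open>Adding the translates by \<open>a\<close> and \<open>- a\<close> cancels the sine terms.
  The rest is a combination of \<open>cos (k * t)\<close>, hence polynomial in \<open>cos t\<close>,
  and the largest Dirichlet order is \<open>n + s - 1\<close>.\<close>

lemma dlvp_even_translate_poly:
  assumes "0 < s"
  shows "\<exists>l::complex poly. degree l \<le> n + s - 1 \<and>
    (\<forall>t. poly l (complex_of_real (cos t)) = of_real ((dlvp n s (t - a) + dlvp n s (t + a)) / c))"
proof -
  obtain T :: "nat \<Rightarrow> complex poly" where T: "\<And>k. degree (T k) \<le> k"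
      "\<And>k t. poly (T k) (complex_of_real (cos t)) = of_real (cos (real k * t))"
    using Chebyshev_poly_exists by metis
  define l where "l = smult (of_real (1 / (c * real s)))
    (\<Sum>i\<in>{n-s..<n+s}. 1 + (\<Sum>k=1..i. smult (of_real (2 * cos (real k * a))) (T k)))"
  have "degree l \<le> n + s - 1"
    unfolding l_def
  proof (intro order_trans[OF degree_smult_le] degree_sum_le)
    fix i assume i: "i \<in> {n-s..<n+s}"
    have "degree (\<Sum>k=1..i. smult (of_real (2 * cos (real k * a))) (T k)) \<le> n + s - 1"
    proof (intro degree_sum_le order_trans[OF degree_smult_le])
      fix k assume "k \<in> {1..i}"
      then show "degree (T k) \<le> n + s - 1"
        using T(1)[of k] i by auto
    qed simp
    then show "degree (1 + (\<Sum>k=1..i. smult (of_real (2 * cos (real k * a))) (T k))) \<le> n + s - 1"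
      by (intro degree_add_le) auto
  qed simp
  moreover have "poly l (complex_of_real (cos t)) = of_real ((dlvp n s (t - a) + dlvp n s (t + a)) / c)" for t
  proof -
    have "cos (real k * (t - a)) + cos (real k * (t + a)) = 2 * cos (real k * a) * cos (real k * t)" for k
      by (simp add: algebra_simps cos_add cos_diff)
    then have "dlvp n s (t - a) + dlvp n s (t + a) =
        (\<Sum>i\<in>{n-s..<n+s}. 2 + 2 * (\<Sum>k=1..i. 2 * cos (real k * a) * cos (real k * t))) / (2 * real s)"
      unfolding dlvp_def add_divide_distrib[symmetric] sum.distrib[symmetric]
      by (simp add: sum.distrib[symmetric] distrib_left[symmetric] del: distrib_left_numeral)
    also have "\<dots> = (\<Sum>i\<in>{n-s..<n+s}. 1 + (\<Sum>k=1..i. 2 * cos (real k * a) * cos (real k * t))) / real s"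
    proof -
      have "(\<Sum>i\<in>{n-s..<n+s}. 2 + 2 * (\<Sum>k=1..i. 2 * cos (real k * a) * cos (real k * t)))
          = 2 * (\<Sum>i\<in>{n-s..<n+s}. 1 + (\<Sum>k=1..i. 2 * cos (real k * a) * cos (real k * t)))"
        by (subst sum_distrib_left) (intro sum.cong refl, simp)
      then show ?thesis by simp
    qed
    finally show ?thesis
      using T(2) by (simp add: l_def poly_sum)
  qed
  ultimately show ?thesis by blast
qed

text \<open>The angles of the Chebyshev nodes and their negatives form \<open>2 * n\<close>
  equidistant points. Their sums and differences are therefore multiples of the mesh
  \<open>pi / n\<close>, at which the kernel vanishes unless the difference is
  \<open>0\<close>.\<close>

lemma Chebyshev_nodes_interpolation:
  assumes "0 < s" "s \<le> n" "1 \<le> K"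
    and y: "\<And>j. 1 \<le> j \<Longrightarrow> j \<le> n \<Longrightarrow> \<bar>y j\<bar> \<le> (R::real)"
  shows "\<exists>P::complex poly. degree P \<le> n + s - 1 \<and>
    (\<forall>j\<in>{1..n}. poly P (complex_of_real (cos ((2 * real j - 1) * pi / (2 * real n)))) = of_real (y j)) \<and>
    (\<forall>t\<in>{-1..1}. cmod (poly P (complex_of_real t)) \<le>
      R * (1 + 4 / pi + 2 / pi * ln (real K) + real n / (2 * real s * (real K + 1/2))))"
proof -
  have n: "n \<ge> 1" using assms by simp
  have R: "0 \<le> R" using y[of 1] n by simp
  define \<theta> where "\<theta> j = (2 * real j - 1) * pi / (2 * real n)" for j
  obtain l :: "nat \<Rightarrow> complex poly" where l: "\<And>j. degree (l j) \<le> n + s - 1"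
      "\<And>j t. poly (l j) (complex_of_real (cos t)) = of_real ((dlvp n s (t - \<theta> j) + dlvp n s (t + \<theta> j)) / (2 * real n))"
    using dlvp_even_translate_poly[OF assms(1), of n "\<theta> _" "2 * real n"] by metis
  define P where "P = (\<Sum>j=1..n. smult (of_real (y j)) (l j))"
  have deg: "degree P \<le> n + s - 1"
    unfolding P_def using l(1) by (intro degree_sum_le order_trans[OF degree_smult_le]) auto
  have val: "poly P (complex_of_real (cos t)) =
      of_real (\<Sum>j=1..n. y j * ((dlvp n s (t - \<theta> j) + dlvp n s (t + \<theta> j)) / (2 * real n)))" for t
    using l(2) by (simp add: P_def poly_sum)
  have node: "dlvp n s (\<theta> i - \<theta> j) + dlvp n s (\<theta> i + \<theta> j) = (if i = j then 2 * real n else 0)"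
    if "i \<in> {1..n}" "j \<in> {1..n}" for i j
  proof -
    have "\<theta> i + \<theta> j = real (i + j - 1) * pi / real n"
      using that n by (simp add: \<theta>_def of_nat_diff field_simps)
    then have plus: "dlvp n s (\<theta> i + \<theta> j) = 0"
      using dlvp_node_eq_0[OF assms(1,2), of "i + j - 1"] that by (auto simp del: of_nat_diff)
    have less: "dlvp n s (\<theta> i - \<theta> j) = 0" if "j < i" "i \<le> n" for i j
    proof -
      have "\<theta> i - \<theta> j = real (i - j) * pi / real n"
        using that n by (simp add: \<theta>_def of_nat_diff field_simps)
      then show ?thesis using dlvp_node_eq_0[OF assms(1,2), of "i - j"] that by simp
    qed
    consider "i = j" | "j < i" | "i < j" by linarith
    then show ?thesis
    proof cases
      case 1 then show ?thesis using plus dlvp_zero[OF assms(1,2)] by simp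
    next
      case 2 then show ?thesis using plus less[of j i] that by simp
    next
      case 3 then show ?thesis
        using plus less[of i j] that dlvp_minus[of n s "\<theta> i - \<theta> j"] by simp
    qed
  qed
  have interp: "poly P (complex_of_real (cos (\<theta> i))) = of_real (y i)" if i: "i \<in> {1..n}" for i
  proof -
    have "(\<Sum>j=1..n. y j * ((dlvp n s (\<theta> i - \<theta> j) + dlvp n s (\<theta> i + \<theta> j)) / (2 * real n)))
        = (\<Sum>j=1..n. if i = j then y j else 0)"
      using node[OF i] n by (intro sum.cong) auto
    then show ?thesis using i by (simp add: val)
  qed
  have bound: "cmod (poly P (complex_of_real t)) \<le>
      R * (1 + 4 / pi + 2 / pi * ln (real K) + real n / (2 * real s * (real K + 1/2)))"
    if "t \<in> {-1..1}" for t
  proof -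
    define x where "x = arccos t"
    have "cos x = t" using that by (simp add: x_def)
    define g where "g z = \<bar>dlvp n s z\<bar> / (2 * real n)" for z
    \<comment> \<open>The angles \<open>\<theta> j\<close> are odd multiples of half a mesh; after
      this shift all \<open>x + \<theta> j\<close> and \<open>x - \<theta> j\<close> are, modulo
      \<open>2 * pi\<close>, the points \<open>v + j * pi / n\<close> with
      \<open>j < 2 * n\<close>.\<close>
    define v where "v = x + pi / (2 * real n)"
    have "cmod (poly P (complex_of_real t)) =
        \<bar>\<Sum>j=1..n. y j * ((dlvp n s (x - \<theta> j) + dlvp n s (x + \<theta> j)) / (2 * real n))\<bar>"
      using val[of x] \<open>cos x = t\<close> by (simp only: norm_of_real)
    also have "\<dots> \<le> (\<Sum>j=1..n. R * (g (x - \<theta> j) + g (x + \<theta> j)))"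
    proof (rule order_trans[OF sum_abs sum_mono])
      fix j assume j: "j \<in> {1..n}"
      have "\<bar>(dlvp n s (x - \<theta> j) + dlvp n s (x + \<theta> j)) / (2 * real n)\<bar> \<le> g (x - \<theta> j) + g (x + \<theta> j)"
        unfolding g_def add_divide_distrib[symmetric] abs_divide
        by (intro divide_mono abs_triangle_ineq) (use n in auto)
      then show "\<bar>y j * ((dlvp n s (x - \<theta> j) + dlvp n s (x + \<theta> j)) / (2 * real n))\<bar>
          \<le> R * (g (x - \<theta> j) + g (x + \<theta> j))"
        unfolding abs_mult using y[of j] j R by (intro mult_mono) auto
    qed
    also have "\<dots> = R * ((\<Sum>j=1..n. g (x - \<theta> j)) + (\<Sum>j=1..n. g (x + \<theta> j)))"
      by (simp add: sum_distrib_left sum.distrib distrib_left)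
    also have "(\<Sum>j=1..n. g (x + \<theta> j)) = (\<Sum>j\<in>{0..<n}. g (v + real j * pi / real n))"
    proof (rule sum.reindex_bij_witness[of _ "\<lambda>j. j + 1" "\<lambda>j. j - 1"])
      fix j assume "j \<in> {1..n}"
      then show "g (v + real (j - 1) * pi / real n) = g (x + \<theta> j)"
        using n by (intro arg_cong[where f = g]) (simp add: v_def \<theta>_def of_nat_diff field_simps)
    qed auto
    also have "(\<Sum>j=1..n. g (x - \<theta> j)) = (\<Sum>j\<in>{n..<2*n}. g (v + real j * pi / real n))"
    proof (rule sum.reindex_bij_witness[of _ "\<lambda>j. 2 * n - j" "\<lambda>j. 2 * n - j"])
      fix j assume "j \<in> {1..n}"
      then have "v + real (2 * n - j) * pi / real n = x - \<theta> j + 2 * pi"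
        using n by (simp add: v_def \<theta>_def of_nat_diff field_simps)
      then show "g (v + real (2 * n - j) * pi / real n) = g (x - \<theta> j)"
        by (simp only: g_def dlvp_plus_2pi)
    qed (use n in auto)
    also have "(\<Sum>j\<in>{n..<2*n}. g (v + real j * pi / real n)) + (\<Sum>j\<in>{0..<n}. g (v + real j * pi / real n))
        = (\<Sum>j<2*n. g (v + real j * pi / real n))"
      by (simp add: lessThan_atLeast0 sum.atLeastLessThan_concat add.commute)
    also have "\<dots> \<le> 1 + 4 / pi + 2 / pi * ln (real K) + real n / (2 * real s * (real K + 1/2))"
      unfolding g_def by (rule dlvp_Lebesgue[OF assms(1-3)])
    finally show ?thesis using R by (simp add: mult_left_mono)
  qed
  show ?thesis
    using deg interp bound unfolding \<theta>_def by blast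
qed

section \<open>Numerical constants and the upper bound\<close>

lemma Lebesgue_constant_numeric:
  assumes \<epsilon>: "0 < \<epsilon>" "\<epsilon> < 1" and n: "real n * \<epsilon> \<ge> 20" and s: "s = nat \<lfloor>\<epsilon> * real n\<rfloor>" and K: "K = nat \<lfloor>real n / real s\<rfloor>"
  shows "1 + 4 / pi + 2 / pi * ln (real K) + real n / (2 * real s * (real K + 1/2)) \<le> 3 + 2 / pi * ln (1 / \<epsilon>)"
    "0 < s" "s \<le> n" "1 \<le> K"
proof -
  have n0: "0 < n" using n by (cases n) auto
  have s1: "real s \<le> \<epsilon> * real n" "\<epsilon> * real n - 1 < real s"
    using \<epsilon> by (auto simp: s)
  show s0: "0 < s" using s1 n by (simp add: mult.commute)
  have "\<epsilon> * real n \<le> real n" using \<epsilon> by (simp add: mult_left_le_one_le)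
  then show "s \<le> n" using s1 by linarith
  then have q1: "1 \<le> real n / real s" using s0 by simp
  then show K1: "1 \<le> K" by (simp add: K le_nat_iff)
  have Kle: "real K \<le> real n / real s" "real n / real s < real K + 1"
    using q1 by (auto simp: K)
  \<comment> \<open>\<open>K\<close> is the integer part of \<open>n / s\<close>, roughly where the
    two kernel bounds cross. The far part is then at most \<open>(K + 1) / (2 * K + 1)\<close>,
    which is largest at \<open>K = 1\<close>.\<close>
  have "real n / (2 * real s * (real K + 1/2)) = (real n / real s) / (2 * real K + 1)"
  proof -
    have "2 * real s * (real K + 1/2) = real s * (2 * real K + 1)" by (simp add: algebra_simps)
    then show ?thesis by simp
  qed
  also have "\<dots> \<le> (real K + 1) / (2 * real K + 1)"
    using Kle by (intro divide_right_mono) auto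
  also have "\<dots> \<le> 2 / 3" using K1 by (simp add: field_simps)
  finally have far: "real n / (2 * real s * (real K + 1/2)) \<le> 2 / 3" .
  \<comment> \<open>Because \<open>n * \<epsilon> \<ge> 20\<close>, rounding in \<open>s\<close>
    costs at most the factor \<open>20 / 19\<close>, whose logarithm still fits below
    \<open>3\<close>.\<close>
  have "real n / real s \<le> (1 / \<epsilon>) * (20 / 19)"
  proof -
    have "19 / 20 * (\<epsilon> * real n) \<le> real s" using s1 n by (simp add: mult.commute)
    then show ?thesis using s0 \<epsilon> by (simp add: field_simps)
  qed
  then have "ln (real K) \<le> ln ((1 / \<epsilon>) * (20 / 19))"
    using K1 Kle \<epsilon> by (subst ln_le_cancel_iff) auto
  also have "\<dots> = ln (1 / \<epsilon>) + ln (20 / 19)"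
    using \<epsilon> by (intro ln_mult_pos) auto
  also have "ln (20 / 19 :: real) \<le> 1 / 19"
    using ln_add_one_self_le_self[of "1/19::real"] by simp
  finally have lnK: "2 / pi * ln (real K) \<le> 2 / pi * (ln (1 / \<epsilon>) + 1 / 19)"
    by (intro mult_left_mono) auto
  have "pi > 3.14159" using pi_approx by simp
  then have "1 / pi \<le> 1 / 3.14159" by (intro divide_left_mono) auto
  then have "1 + 4 / pi + 2 / pi * (1 / 19) + 2 / 3 \<le> 3" by simp
  then show "1 + 4 / pi + 2 / pi * ln (real K) + real n / (2 * real s * (real K + 1/2)) \<le> 3 + 2 / pi * ln (1 / \<epsilon>)"
    using far lnK by (simp add: distrib_left)
qed

text \<open>The interpolant of \<open>(1 - \<rho>) * y\<close> misses \<open>y\<close> by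
  \<open>\<rho> * \<bar>y\<bar>\<close> at each node, which the strict inequality in the error count
  tolerates. Only \<open>\<bar>y\<bar> \<le> 1\<close> enters, so both target sets are
  covered.\<close>

lemma eps_star_on_upper:
  assumes C: "C > 0" and \<rho>: "0 \<le> \<rho>" "\<rho> < 1" and H: "C / (1 - \<rho>) > 3" and Y: "Y \<subseteq> {-1..1}"
  shows "eps_star_on Y C \<rho> \<le> exp (pi / 2 * (3 - C / (1 - \<rho>)))"
proof -
  have "\<epsilon> \<le> exp (pi / 2 * (3 - C / (1 - \<rho>)))" if adm: "admissible Y C \<rho> \<epsilon>" for \<epsilon>
  proof (rule ccontr)
    assume "\<not> \<epsilon> \<le> exp (pi / 2 * (3 - C / (1 - \<rho>)))"
    then have "exp (pi / 2 * (3 - C / (1 - \<rho>))) < \<epsilon>" by simp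
    moreover have \<epsilon>: "0 < \<epsilon>" "\<epsilon> < 1" using adm by (auto simp: admissible_def)
    ultimately have "pi / 2 * (3 - C / (1 - \<rho>)) < ln \<epsilon>"
      by (metis exp_less_cancel_iff exp_ln)
    then have "3 + 2 / pi * ln (1 / \<epsilon>) < C / (1 - \<rho>)"
      using \<epsilon> by (simp add: ln_div field_simps)
    then have "(1 - \<rho>) * (3 + 2 / pi * ln (1 / \<epsilon>)) \<le> C"
      using \<rho> by (simp add: field_simps)
    obtain n0 where n0: "\<And>n x. n \<ge> n0 \<Longrightarrow> x \<in> {1..n} \<rightarrow> {-1..1} \<Longrightarrow> \<exists>y \<in> {1..n} \<rightarrow> Y.
        \<forall>P \<in> poly_class ((1 + \<epsilon>) * real n) C. real (err_count n \<rho> P x y) > \<epsilon> * real n"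
      using adm unfolding admissible_def by blast
    define n where "n = max n0 (nat \<lceil>20 / \<epsilon>\<rceil>)"
    have "20 / \<epsilon> \<le> real n" by (simp add: n_def) linarith
    then have n20: "real n * \<epsilon> \<ge> 20" using \<epsilon> by (simp add: field_simps)
    define s where "s = nat \<lfloor>\<epsilon> * real n\<rfloor>"
    define K where "K = nat \<lfloor>real n / real s\<rfloor>"
    define x where "x j = cos ((2 * real j - 1) * pi / (2 * real n))" for j
    note num = Lebesgue_constant_numeric[OF \<epsilon> n20 s_def K_def]
    obtain y where y: "y \<in> {1..n} \<rightarrow> Y"
      and bad: "\<And>P. P \<in> poly_class ((1 + \<epsilon>) * real n) C \<Longrightarrow> real (err_count n \<rho> P x y) > \<epsilon> * real n"
      using n0[of n x] by (auto simp: n_def x_def)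
    have y1: "\<bar>y j\<bar> \<le> 1" if "j \<in> {1..n}" for j
      using funcset_mem[OF y that] Y by (fastforce simp: abs_le_iff)
    have "\<bar>(1 - \<rho>) * y j\<bar> \<le> 1 - \<rho>" if "1 \<le> j" "j \<le> n" for j
      using y1[of j] that \<rho> by (simp add: abs_mult mult_left_le)
    from Chebyshev_nodes_interpolation[OF num(2-4), of "\<lambda>j. (1 - \<rho>) * y j" "1 - \<rho>", OF this]
    obtain P :: "complex poly" where P: "degree P \<le> n + s - 1"
      "\<And>j. j \<in> {1..n} \<Longrightarrow> poly P (complex_of_real (x j)) = of_real ((1 - \<rho>) * y j)"
      "\<And>t. t \<in> {-1..1} \<Longrightarrow> cmod (poly P (complex_of_real t)) \<le>
        (1 - \<rho>) * (1 + 4 / pi + 2 / pi * ln (real K) + real n / (2 * real s * (real K + 1/2)))"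
      unfolding x_def by blast
    have "(1 - \<rho>) * (1 + 4 / pi + 2 / pi * ln (real K) + real n / (2 * real s * (real K + 1/2))) \<le>
        (1 - \<rho>) * (3 + 2 / pi * ln (1 / \<epsilon>))"
      using num(1) \<rho> by (intro mult_left_mono) auto
    with P(3) \<open>(1 - \<rho>) * (3 + 2 / pi * ln (1 / \<epsilon>)) \<le> C\<close>
    have norm: "cmod (poly P (complex_of_real t)) \<le> C" if "t \<in> {-1..1}" for t
      using that by fastforce
    have "real (degree P) \<le> real n + real s"
      using P(1) by linarith
    also have "\<dots> \<le> (1 + \<epsilon>) * real n"
      using \<epsilon> by (simp add: s_def distrib_right)
    finally have "P \<in> poly_class ((1 + \<epsilon>) * real n) C"
      using norm poly_norm_attained[of P] by (auto simp: poly_class_def)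
    moreover have "err_count n \<rho> P x y = 0"
    proof -
      have "cmod (poly P (complex_of_real (x i)) - complex_of_real (y i)) \<le> \<rho>" if "i \<in> {1..n}" for i
      proof -
        have "poly P (complex_of_real (x i)) - complex_of_real (y i) = of_real (- \<rho> * y i)"
          using P(2)[OF that] by (simp add: algebra_simps)
        also have "cmod \<dots> = \<rho> * \<bar>y i\<bar>" using \<rho> by (simp only: norm_of_real) (simp add: abs_mult)
        also have "\<dots> \<le> \<rho>" using y1[OF that] \<rho> by (simp add: mult_left_le)
        finally show ?thesis .
      qed
      then have "{i \<in> {1..n}. cmod (poly P (complex_of_real (x i)) - complex_of_real (y i)) > \<rho>} = {}"
        by fastforce
      then show ?thesis by (simp add: err_count_def)
    qed
    ultimately show False using bad[of P] \<epsilon> by (simp add: mult_less_0_iff)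
  qed
  then show ?thesis
    by (auto simp: eps_star_on_def intro!: cSup_least)
qed

section \<open>A trace inequality for interpolation on the circle\<close>

text \<open>The coefficients are \<open>r ^ j / j\<close> with \<open>r = 1 - 1 / J\<close>: the full sine series is the imaginary part
  of \<open>- Ln (1 - r * cis x)\<close>, bounded by \<open>pi / 2\<close>, and the tail beyond \<open>J\<close> is at most \<open>1\<close>.\<close>

lemma sin_series_bounded:
  assumes J: "J \<ge> 2"
  shows "\<exists>b::nat \<Rightarrow> real. (\<forall>j. 0 \<le> b j \<and> b j \<le> 1 / real j) \<and>
    ln (real J) - 1 \<le> (\<Sum>j=1..J. b j) \<and> (\<forall>x. \<bar>\<Sum>j=1..J. b j * sin (real j * x)\<bar> \<le> 3)"
proof -
  define r where "r = 1 - 1 / real J"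
  have r: "0 \<le> r" "r < 1" using J by (auto simp: r_def)
  define b where "b j = r ^ j / real j" for j
  have b: "0 \<le> b j" "b j \<le> 1 / real j" for j
    using r by (auto simp: b_def power_le_one intro!: divide_right_mono)
  \<comment> \<open>By the convention \<open>x / 0 = 0\<close>; thus the series may start at
    \<open>0\<close>, as those of the library do.\<close>
  have b0: "b 0 = 0" by (simp add: b_def)
  have head: "(\<Sum>j<Suc J. f j) = (\<Sum>j=1..J. f j)" if "f 0 = 0" for f :: "nat \<Rightarrow> 'a::comm_monoid_add"
    using that by (simp add: lessThan_Suc_atMost atMost_atLeast0 sum.atLeast_Suc_atMost)
  have geom: "(\<lambda>j. r ^ (j + Suc J) / real J) sums (r ^ Suc J / real J / (1 - r))"
  proof -
    have "(\<lambda>j. r ^ j * (r ^ Suc J / real J)) sums (1 / (1 - r) * (r ^ Suc J / real J))"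
      by (intro sums_mult2 geometric_sums) (use r in auto)
    then show ?thesis by (simp add: power_add mult_ac)
  qed
  \<comment> \<open>\<open>1 - r\<close> is \<open>1 / J\<close> and cancels the division by
    \<open>J\<close>; damping at the scale \<open>J\<close> is what bounds the tail.\<close>
  have "r ^ Suc J / real J / (1 - r) \<le> 1"
    using J power_le_one[of r "Suc J"] r by (simp add: r_def)
  have tailsum: "summable (\<lambda>j. b (j + Suc J))" and tail: "(\<Sum>j. b (j + Suc J)) \<le> 1"
  proof -
    have le: "b (j + Suc J) \<le> r ^ (j + Suc J) / real J" for j
      unfolding b_def using r J by (intro divide_left_mono) auto
    show s: "summable (\<lambda>j. b (j + Suc J))"
      by (rule summable_comparison_test'[OF sums_summable[OF geom], of 0]) (use le b in auto)
    have "(\<Sum>j. b (j + Suc J)) \<le> r ^ Suc J / real J / (1 - r)"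
      using suminf_le[OF le s sums_summable[OF geom]] sums_unique[OF geom] by simp
    then show "(\<Sum>j. b (j + Suc J)) \<le> 1" using \<open>r ^ Suc J / real J / (1 - r) \<le> 1\<close> by simp
  qed
  have "(\<lambda>j. - b j) sums ln (1 - r)"
    using ln_series'[of "-r"] r by (simp add: b_def)
  then have "(\<lambda>j. b j) sums (- ln (1 - r))"
    using sums_minus by fastforce
  then have "(\<Sum>j. b (j + Suc J)) = - ln (1 - r) - (\<Sum>j<Suc J. b j)"
    using suminf_minus_initial_segment[of b "Suc J"] by (simp add: sums_iff)
  moreover have "- ln (1 - r) = ln (real J)"
    using J by (simp add: r_def ln_div)
  ultimately have lower: "ln (real J) - 1 \<le> (\<Sum>j=1..J. b j)"
    using tail head[of b] b0 by simp
  have bounded: "\<bar>\<Sum>j=1..J. b j * sin (real j * x)\<bar> \<le> 3" for x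
  proof -
    define z where "z = of_real r * cis x"
    have nz: "cmod z < 1" using r by (simp add: z_def norm_mult)
    have "(\<lambda>j. - (z ^ j) / of_nat j) sums ln (1 - z)"
      using Ln_series'[of "-z"] nz by simp
    then have "(\<lambda>j. Im (- (z ^ j) / of_nat j)) sums Im (ln (1 - z))"
      by (rule sums_Im)
    moreover have "Im (- (z ^ j) / of_nat j) = - (b j * sin (real j * x))" for j
      by (simp add: z_def b_def power_mult_distrib Complex.DeMoivre Im_divide_of_nat flip: of_real_power)
    ultimately have "(\<lambda>j. - (b j * sin (real j * x))) sums Im (ln (1 - z))" by simp
    then have sums: "(\<lambda>j. b j * sin (real j * x)) sums (- Im (ln (1 - z)))"
      using sums_minus by fastforce
    then have eq: "(\<Sum>j. b (j + Suc J) * sin (real (j + Suc J) * x)) = - Im (ln (1 - z)) - (\<Sum>j<Suc J. b j * sin (real j * x))"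
      using suminf_minus_initial_segment[of "\<lambda>j. b j * sin (real j * x)" "Suc J"] by (simp add: sums_iff)
    have abs_le: "norm (b j * sin (real j * x)) \<le> b j" for j
      using b[of j] by (simp add: abs_mult mult_left_le)
    have "norm (\<Sum>j. b (j + Suc J) * sin (real (j + Suc J) * x)) \<le> (\<Sum>j. b (j + Suc J))"
      by (intro norm_suminf_le abs_le tailsum)
    moreover have "\<bar>Im (ln (1 - z))\<bar> < pi / 2"
    proof (rule Re_Ln_pos_lt_imp)
      have "Re z < 1" using nz complex_Re_le_cmod[of z] by linarith
      then show "0 < Re (1 - z)" by simp
    qed
    moreover have "pi / 2 < 2" using pi_less_4 by simp
    ultimately show ?thesis
      using eq tail head[of "\<lambda>j. b j * sin (real j * x)"] b0 by simp
  qed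
  show ?thesis using b lower bounded by blast
qed

lemma sum_inverse_squares_le: "(\<Sum>j=1..J. 1 / (real j)\<^sup>2) \<le> 2"
proof -
  have "(\<Sum>j=1..Suc J. 1 / (real j)\<^sup>2) \<le> 2 - 1 / real (Suc J)" for J
  proof (induction J)
    case (Suc J)
    have "1 / (real (Suc (Suc J)))\<^sup>2 \<le> 1 / (real (Suc J) * real (Suc (Suc J)))"
      by (intro divide_left_mono) (auto simp: power2_eq_square)
    also have "\<dots> = 1 / real (Suc J) - 1 / real (Suc (Suc J))"
      by (simp add: field_simps)
    finally show ?case using Suc by simp
  qed simp
  from this[of "J - 1"] show ?thesis by (cases J) (auto intro: order_trans)
qed

section \<open>Discrete Fourier analysis on rotated roots of unity\<close>

lemma sum_roots_of_unity_powers: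
  assumes "j < L" "k < L" "cmod z = 1"
  shows "(\<Sum>l<L. (z * cis (- (2 * pi * real l / real L))) ^ j * cnj ((z * cis (- (2 * pi * real l / real L))) ^ k))
    = (if j = k then of_nat L else 0)"
proof -
  define \<omega> where "\<omega> = cis (2 * pi * (real k - real j) / real L)"
  have L: "L > 0" using assms by simp
  have "cis (- (2 * pi * real l / real L)) ^ j * cnj (cis (- (2 * pi * real l / real L)) ^ k) = \<omega> ^ l" for l
    by (simp add: \<omega>_def Complex.DeMoivre cis_cnj cis_mult algebra_simps diff_divide_distrib)
  then have "(z * cis (- (2 * pi * real l / real L))) ^ j * cnj ((z * cis (- (2 * pi * real l / real L))) ^ k)
      = z ^ j * cnj (z ^ k) * \<omega> ^ l" for l
    by (simp add: power_mult_distrib mult_ac)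
  then have "(\<Sum>l<L. (z * cis (- (2 * pi * real l / real L))) ^ j * cnj ((z * cis (- (2 * pi * real l / real L))) ^ k))
      = (\<Sum>l<L. z ^ j * cnj (z ^ k) * \<omega> ^ l)"
    by (intro sum.cong refl)
  also have "\<dots> = z ^ j * cnj (z ^ k) * (\<Sum>l<L. \<omega> ^ l)"
    by (simp add: sum_distrib_left)
  also have "\<dots> = (if j = k then of_nat L else 0)"
  proof (cases "j = k")
    case True
    have "\<omega> = 1" using True by (simp add: \<omega>_def)
    moreover have "z ^ k * cnj (z ^ k) = 1"
      using assms(3) complex_norm_square[of "z ^ k"] by (simp add: norm_power)
    ultimately show ?thesis using True by simp
  next
    case False
    have "\<omega> ^ L = cis (2 * pi * (of_int (int k - int j)))"
      using L by (simp add: \<omega>_def Complex.DeMoivre)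
    also have "\<dots> = 1" by (rule cis_multiple_2pi) simp
    finally have "\<omega> ^ L = 1" .
    moreover have "\<omega> \<noteq> 1"
    proof
      assume "\<omega> = 1"
      then have "cos (2 * pi * (real k - real j) / real L) = 1"
        by (simp add: \<omega>_def complex_eq_iff)
      then obtain m :: int where "2 * pi * (real k - real j) / real L = of_int m * 2 * pi"
        by (auto simp: cos_one_2pi_int)
      then have "2 * pi * (real k - real j) = 2 * pi * (of_int m * real L)"
        using L by (simp add: field_simps)
      then have "real k - real j = of_int m * real L"
        by (simp only: mult_cancel_left) simp
      then have "int k - int j = m * int L"
        by (metis of_int_diff of_int_eq_iff of_int_mult of_int_of_nat_eq)
      then have "int L dvd int k - int j" by simp
      moreover have "\<bar>int k - int j\<bar> < int L" using assms by linarith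
      ultimately show False using False zdvd_imp_le[of "int L" "\<bar>int k - int j\<bar>"] by auto
    qed
    ultimately have "(\<Sum>l<L. \<omega> ^ l) = 0" by (simp add: geometric_sum)
    then show ?thesis using False by simp
  qed
  finally show ?thesis .
qed

text \<open>Powers below \<open>L\<close> are orthogonal on \<open>L\<close> grid points, so nothing
  is aliased. The rotation by \<open>z\<close> will serve translates of a kernel by an arbitrary
  angle.\<close>

lemma discrete_Parseval_bilinear:
  fixes p q :: "complex poly"
  assumes "degree p < L" "degree q < L" "cmod z = 1"
  shows "(\<Sum>l<L. poly p (z * cis (- (2 * pi * real l / real L))) * cnj (poly q (z * cis (- (2 * pi * real l / real L)))))
    = of_nat L * (\<Sum>k<L. coeff p k * cnj (coeff q k))"
proof -
  define u where "u l = z * cis (- (2 * pi * real l / real L))" for l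
  have ev: "poly p x = (\<Sum>k<L. coeff p k * x ^ k)" if "degree p < L" for p :: "complex poly" and x
    using that by (simp add: poly_altdef) (intro sum.mono_neutral_left, auto simp: coeff_eq_0)
  have "(\<Sum>l<L. poly p (u l) * cnj (poly q (u l))) =
      (\<Sum>l<L. \<Sum>j<L. \<Sum>k<L. coeff p j * cnj (coeff q k) * (u l ^ j * cnj (u l ^ k)))"
    unfolding ev[OF assms(1)] ev[OF assms(2)] cnj_sum sum_product complex_cnj_mult
    by (simp only: mult_ac)
  also have "\<dots> = (\<Sum>j<L. \<Sum>l<L. \<Sum>k<L. coeff p j * cnj (coeff q k) * (u l ^ j * cnj (u l ^ k)))"
    by (rule sum.swap)
  also have "\<dots> = (\<Sum>j<L. \<Sum>k<L. \<Sum>l<L. coeff p j * cnj (coeff q k) * (u l ^ j * cnj (u l ^ k)))"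
    by (rule sum.cong[OF refl], rule sum.swap)
  also have "\<dots> = (\<Sum>j<L. \<Sum>k<L. coeff p j * cnj (coeff q k) * (if j = k then of_nat L else 0))"
    using sum_roots_of_unity_powers[OF _ _ assms(3)] unfolding u_def
    by (intro sum.cong refl) (simp only: sum_distrib_left[symmetric] lessThan_iff)
  also have "\<dots> = (\<Sum>j<L. coeff p j * cnj (coeff q j) * of_nat L)"
    by (simp add: if_distrib cong: if_cong)
  finally show ?thesis by (simp add: u_def sum_distrib_left mult_ac)
qed

lemma discrete_Parseval:
  fixes p :: "complex poly"
  assumes "degree p < L" "cmod z = 1"
  shows "(\<Sum>l<L. (cmod (poly p (z * cis (- (2 * pi * real l / real L)))))\<^sup>2)
    = real L * (\<Sum>k<L. (cmod (coeff p k))\<^sup>2)"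
proof -
  have "complex_of_real (\<Sum>l<L. (cmod (poly p (z * cis (- (2 * pi * real l / real L)))))\<^sup>2)
      = complex_of_real (real L * (\<Sum>k<L. (cmod (coeff p k))\<^sup>2))"
    using discrete_Parseval_bilinear[OF assms(1) assms(1) assms(2)]
    by (simp add: complex_norm_square del: of_real_power)
  then show ?thesis by (simp only: of_real_eq_iff)
qed

text \<open>With distinct exponents no coefficients merge; this computes the norms of kernels and of
  their products.\<close>

lemma coeff_sum_monom_inj:
  assumes "finite I" "inj_on e I" "\<And>i. i \<in> I \<Longrightarrow> e i < L"
  shows "(\<Sum>k<L. (cmod (coeff (\<Sum>i\<in>I. monom (a i) (e i)) k))\<^sup>2) = (\<Sum>i\<in>I. (cmod (a i))\<^sup>2)"
proof -
  have on: "coeff (\<Sum>i\<in>I. monom (a i) (e i)) (e j) = a j" if "j \<in> I" for j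
  proof -
    have "coeff (\<Sum>i\<in>I. monom (a i) (e i)) (e j) = (\<Sum>i\<in>I. if i = j then a j else 0)"
      unfolding coeff_sum using assms(2) that by (intro sum.cong) (auto simp: inj_on_def)
    then show ?thesis using that assms(1) by simp
  qed
  have off: "coeff (\<Sum>i\<in>I. monom (a i) (e i)) k = 0" if "k \<notin> e ` I" for k
    using that by (auto simp: coeff_sum intro!: sum.neutral)
  have "(\<Sum>k<L. (cmod (coeff (\<Sum>i\<in>I. monom (a i) (e i)) k))\<^sup>2)
      = (\<Sum>k\<in>e ` I. (cmod (coeff (\<Sum>i\<in>I. monom (a i) (e i)) k))\<^sup>2)"
    using assms off by (intro sum.mono_neutral_right) auto
  also have "\<dots> = (\<Sum>i\<in>I. (cmod (a i))\<^sup>2)"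
    using assms(2) on by (simp add: sum.reindex)
  finally show ?thesis .
qed

section \<open>The coefficient inner product and polynomials vanishing on a finite set\<close>

definition ip :: "nat \<Rightarrow> complex poly \<Rightarrow> complex poly \<Rightarrow> complex" where
  "ip m p q = (\<Sum>k<m. coeff p k * cnj (coeff q k))"

lemma ip_linear:
  "ip m (p + p') q = ip m p q + ip m p' q"
  "ip m (p - p') q = ip m p q - ip m p' q"
  "ip m (smult c p) q = c * ip m p q"
  "ip m 0 q = 0"
  "ip m (\<Sum>i\<in>I. P i) q = (\<Sum>i\<in>I. ip m (P i) q)"
  unfolding ip_def
  by (simp_all add: algebra_simps sum.distrib sum_subtractf sum_distrib_left coeff_sum sum_distrib_right sum.swap[of _ _ I])

lemma ip_cnj: "cnj (ip m p q) = ip m q p"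
  by (simp add: ip_def mult.commute)

lemma ip_self: "ip m p p = of_real (\<Sum>k<m. (cmod (coeff p k))\<^sup>2)"
  by (simp add: ip_def complex_norm_square del: of_real_power)

lemma ip_self_eq_0:
  assumes "ip m p p = 0" "degree p < m"
  shows "p = 0"
proof -
  have "(\<Sum>k<m. (cmod (coeff p k))\<^sup>2) = 0"
    using assms(1) by (simp only: ip_self of_real_eq_0_iff)
  then have "\<forall>k<m. coeff p k = 0"
    by (subst (asm) sum_nonneg_eq_0_iff) auto
  moreover have "\<forall>k\<ge>m. coeff p k = 0"
    using assms(2) by (auto intro: coeff_eq_0)
  ultimately show ?thesis by (metis leading_coeff_0_iff not_le)
qed

definition orthonormal :: "nat \<Rightarrow> complex poly set \<Rightarrow> bool" where
  "orthonormal m F \<longleftrightarrow> (\<forall>p\<in>F. \<forall>q\<in>F. ip m p q = (if p = q then 1 else 0))"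

lemma Bessel:
  assumes "finite F" "orthonormal m F"
  shows "(\<Sum>p\<in>F. (cmod (ip m f p))\<^sup>2) \<le> (\<Sum>k<m. (cmod (coeff f k))\<^sup>2)"
proof -
  define g where "g = f - (\<Sum>p\<in>F. smult (ip m f p) p)"
  have orth: "ip m g q = 0" if "q \<in> F" for q
  proof -
    have "(\<Sum>p\<in>F. ip m f p * ip m p q) = (\<Sum>p\<in>F. if p = q then ip m f q else 0)"
      using assms(2) that by (intro sum.cong) (auto simp: orthonormal_def)
    then show ?thesis using assms(1) that by (simp add: g_def ip_linear)
  qed
  have "ip m g g = ip m f g - (\<Sum>p\<in>F. ip m f p * ip m p g)"
    by (subst (1) g_def) (simp add: ip_linear)
  also have "(\<Sum>p\<in>F. ip m f p * ip m p g) = 0"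
    using orth ip_cnj[of m g] by (intro sum.neutral) (metis complex_cnj_zero mult_zero_right)
  also have "ip m f g = cnj (ip m g f)" by (simp add: ip_cnj)
  also have "ip m g f = ip m f f - (\<Sum>p\<in>F. ip m f p * ip m p f)"
    by (simp add: g_def ip_linear)
  also have "(\<Sum>p\<in>F. ip m f p * ip m p f) = of_real (\<Sum>p\<in>F. (cmod (ip m f p))\<^sup>2)"
    by (simp add: complex_norm_square ip_cnj del: of_real_power)
  finally have "complex_of_real (\<Sum>k<m. (cmod (coeff g k))\<^sup>2) =
      of_real ((\<Sum>k<m. (cmod (coeff f k))\<^sup>2) - (\<Sum>p\<in>F. (cmod (ip m f p))\<^sup>2))"
    unfolding ip_self by simp
  then have "(\<Sum>k<m. (cmod (coeff g k))\<^sup>2) = (\<Sum>k<m. (cmod (coeff f k))\<^sup>2) - (\<Sum>p\<in>F. (cmod (ip m f p))\<^sup>2)"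
    by (simp only: of_real_eq_iff)
  moreover have "(\<Sum>k<m. (cmod (coeff g k))\<^sup>2) \<ge> 0" by (intro sum_nonneg) auto
  ultimately show ?thesis by simp
qed

interpretation poly_vs: vector_space "smult :: complex \<Rightarrow> complex poly \<Rightarrow> complex poly"
  by unfold_locales (auto simp: smult_add_right smult_add_left)

text \<open>A dimension count. In a vanishing linear combination, evaluation at \<open>z\<close>
  isolates the coefficient of \<open>G z\<close>, since \<open>F\<close> vanishes on
  \<open>Z\<close>; the inner product with a member of \<open>F\<close> then isolates its
  coefficient.\<close>

lemma card_orthonormal_vanishing:
  assumes Z: "finite Z" and F: "finite F" "orthonormal m F"
    and vanish: "\<And>p z. p \<in> F \<Longrightarrow> z \<in> Z \<Longrightarrow> poly p z = 0" and degF: "\<And>p. p \<in> F \<Longrightarrow> degree p < m"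
    and degG: "\<And>z. z \<in> Z \<Longrightarrow> degree (G z) < m"
    and G: "\<And>z x. z \<in> Z \<Longrightarrow> x \<in> Z \<Longrightarrow> poly (G z) x = (if x = z then 1 else 0)"
  shows "card F + card Z \<le> m"
proof -
  have injG: "inj_on G Z"
    using G by (intro inj_onI) (metis zero_neq_one)
  have disj: "F \<inter> G ` Z = {}"
    using vanish G by fastforce
  have indep: "poly_vs.independent (F \<union> G ` Z)"
  proof (subst poly_vs.independent_explicit_finite_subsets, intro allI impI ballI)
    fix S u p
    assume S: "S \<subseteq> F \<union> G ` Z" "finite S" and zero: "(\<Sum>v\<in>S. smult (u v) v) = 0" and p: "p \<in> S"
    have uG: "u (G z) = 0" if "z \<in> Z" "G z \<in> S" for z
    proof -
      have "0 = poly (\<Sum>v\<in>S. smult (u v) v) z" using zero by simp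
      also have "\<dots> = (\<Sum>v\<in>S. if v = G z then u (G z) else 0)"
        unfolding poly_sum
      proof (intro sum.cong refl)
        fix v assume "v \<in> S"
        then consider "v \<in> F" | x where "x \<in> Z" "v = G x" using S by auto
        then show "poly (smult (u v) v) z = (if v = G z then u (G z) else 0)"
        proof cases
          case 1
          then have "v \<noteq> G z" using disj that by auto
          then show ?thesis using 1 vanish that by simp
        next
          case 2
          then have "v = G z \<longleftrightarrow> z = x" using injG that by (auto simp: inj_on_eq_iff)
          then show ?thesis using 2 G[of x z] that by auto
        qed
      qed
      also have "\<dots> = u (G z)" using that S by simp
      finally show ?thesis by simp
    qed
    show "u p = 0"
    proof (cases "p \<in> G ` Z")
      case True then show ?thesis using uG p by auto
    next
      case False
      then have "p \<in> F" using S p by auto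
      have "0 = ip m (\<Sum>v\<in>S. smult (u v) v) p" using zero by (simp add: ip_linear)
      also have "\<dots> = (\<Sum>v\<in>S. if v = p then u p else 0)"
        unfolding ip_linear
      proof (intro sum.cong refl)
        fix v assume "v \<in> S"
        then consider "v \<in> F" | "v \<in> G ` Z" using S by auto
        then show "u v * ip m v p = (if v = p then u p else 0)"
        proof cases
          case 1 then show ?thesis using F(2) \<open>p \<in> F\<close> by (auto simp: orthonormal_def)
        next
          case 2 then show ?thesis using uG \<open>v \<in> S\<close> False by auto
        qed
      qed
      also have "\<dots> = u p" using p S by simp
      finally show ?thesis by simp
    qed
  qed
  have span: "F \<union> G ` Z \<subseteq> poly_vs.span ((\<lambda>k. monom 1 k) ` {..<m})"
  proof
    fix p assume "p \<in> F \<union> G ` Z"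
    then have "degree p < m" using degF degG by auto
    have "p = (\<Sum>k\<le>degree p. monom (coeff p k) k)"
      by (simp add: poly_as_sum_of_monoms)
    also have "\<dots> = (\<Sum>k\<le>degree p. smult (coeff p k) (monom 1 k))"
      by (simp add: smult_monom)
    also have "\<dots> \<in> poly_vs.span ((\<lambda>k. monom 1 k) ` {..<m})"
      using \<open>degree p < m\<close> by (intro poly_vs.span_sum poly_vs.span_scale poly_vs.span_base) auto
    finally show "p \<in> poly_vs.span ((\<lambda>k. monom 1 k) ` {..<m})" .
  qed
  have "card (F \<union> G ` Z) \<le> card ((\<lambda>k. monom (1::complex) k) ` {..<m})"
    using poly_vs.independent_span_bound[OF _ indep span] by simp
  also have "\<dots> \<le> m" using card_image_le[of "{..<m}" "\<lambda>k. monom (1::complex) k"] by simp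
  finally show ?thesis
    using card_Un_disjoint[OF F(1) _ disj] Z card_image[OF injG] by simp
qed

text \<open>The dimension count bounds the size of orthonormal sets of vanishing polynomials, so a
  largest one exists. It spans, because the normalised remainder of a polynomial outside its span
  would enlarge it.\<close>

lemma orthonormal_basis_vanishing:
  assumes Z: "finite Z" and degG: "\<And>z. z \<in> Z \<Longrightarrow> degree (G z) < m"
    and G: "\<And>z x. z \<in> Z \<Longrightarrow> x \<in> Z \<Longrightarrow> poly (G z) x = (if x = z then 1 else 0)"
  obtains F where "finite F" "orthonormal m F" "card F + card Z \<le> m"
    "\<And>p z. p \<in> F \<Longrightarrow> z \<in> Z \<Longrightarrow> poly p z = 0" "\<And>p. p \<in> F \<Longrightarrow> degree p < m"
    "\<And>w. degree w < m \<Longrightarrow> \<forall>z\<in>Z. poly w z = 0 \<Longrightarrow> w = (\<Sum>p\<in>F. smult (ip m w p) p)"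
proof -
  define ok where "ok F \<longleftrightarrow> finite F \<and> orthonormal m F \<and> (\<forall>p\<in>F. degree p < m \<and> (\<forall>z\<in>Z. poly p z = 0))" for F
  have bound: "card F + card Z \<le> m" if "ok F" for F
    using card_orthonormal_vanishing[OF Z, of F m G] that degG G by (auto simp: ok_def)
  have "ok {}" by (simp add: ok_def orthonormal_def)
  then obtain F where F: "ok F" and max: "\<And>F'. ok F' \<Longrightarrow> card F' \<le> card F"
    using ex_has_greatest_nat[of ok "{}" card m] bound by fastforce
  have "w = (\<Sum>p\<in>F. smult (ip m w p) p)" if w: "degree w < m" "\<forall>z\<in>Z. poly w z = 0" for w
  proof (rule ccontr)
    assume neq: "w \<noteq> (\<Sum>p\<in>F. smult (ip m w p) p)"
    define g where "g = w - (\<Sum>p\<in>F. smult (ip m w p) p)"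
    have orth: "ip m g q = 0" if "q \<in> F" for q
    proof -
      have "(\<Sum>p\<in>F. ip m w p * ip m p q) = (\<Sum>p\<in>F. if p = q then ip m w q else 0)"
        using F that by (intro sum.cong) (auto simp: ok_def orthonormal_def)
      then show ?thesis using F that by (simp add: g_def ip_linear ok_def)
    qed
    have "degree (\<Sum>p\<in>F. smult (ip m w p) p) \<le> m - 1"
      using F by (intro degree_sum_le order_trans[OF degree_smult_le]) (auto simp: ok_def)
    then have "degree g \<le> m - 1"
      unfolding g_def using w(1) by (intro degree_diff_le) auto
    then have degg: "degree g < m" using w(1) by linarith
    have vang: "poly g z = 0" if "z \<in> Z" for z
      using w(2) that F by (simp add: g_def poly_sum ok_def)
    have "ip m g g \<noteq> 0" using ip_self_eq_0[OF _ degg] neq by (auto simp: g_def)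
    define s where "s = (\<Sum>k<m. (cmod (coeff g k))\<^sup>2)"
    have s: "ip m g g = of_real s" by (simp add: s_def ip_self)
    have "s \<ge> 0" unfolding s_def by (intro sum_nonneg) auto
    then have "s > 0" using s \<open>ip m g g \<noteq> 0\<close> by auto
    define h where "h = smult (of_real (1 / sqrt s)) g"
    have hq: "ip m h q = 0" "ip m q h = 0" if "q \<in> F" for q
    proof -
      show "ip m h q = 0" using orth[OF that] by (simp add: h_def ip_linear)
      then show "ip m q h = 0" by (metis complex_cnj_zero ip_cnj)
    qed
    have hh: "ip m h h = 1"
    proof -
      have "ip m h h = of_real (1 / sqrt s) * cnj (of_real (1 / sqrt s) * ip m g g)"
        unfolding h_def by (simp only: ip_linear) (metis ip_cnj ip_linear(3))
      also have "\<dots> = of_real ((1 / sqrt s) * ((1 / sqrt s) * s))"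
        unfolding s by (simp only: complex_cnj_mult complex_cnj_complex_of_real of_real_mult)
      also have "(1 / sqrt s) * ((1 / sqrt s) * s) = 1"
        using \<open>s > 0\<close> by (simp add: field_simps)
      finally show ?thesis by simp
    qed
    have "h \<notin> F" using hq hh by fastforce
    have "ok (insert h F)"
      unfolding ok_def
    proof (intro conjI ballI)
      show "orthonormal m (insert h F)"
        using F hq hh \<open>h \<notin> F\<close> by (auto simp: orthonormal_def ok_def)
    qed (use F degg vang in \<open>auto simp: ok_def h_def\<close>)
    then have "card (insert h F) \<le> card F" by (rule max)
    then show False using F \<open>h \<notin> F\<close> by (simp add: ok_def)
  qed
  then show thesis using that[of F] F bound[OF F] by (auto simp: ok_def)
qed

lemma sum_coeff_extend:
  assumes "degree p < m" "m \<le> L"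
  shows "(\<Sum>k<L. (cmod (coeff p k))\<^sup>2) = (\<Sum>k<m. (cmod (coeff p k))\<^sup>2)"
  using assms by (intro sum.mono_neutral_right) (auto simp: coeff_eq_0)

text \<open>Let \<open>W\<close> be the space of polynomials of degree below \<open>m\<close> that vanish on \<open>Z\<close>; its dimension is at
  most \<open>4 * d\<close>. For each grid point \<open>\<sigma>\<close> the function \<open>\<phi>1 - \<phi>2\<close> of \<open>z / \<sigma>\<close> is bounded by \<open>6\<close>, although
  \<open>\<phi>1\<close> alone takes the value \<open>\<beta>\<close> at \<open>1\<close>. With an interpolant \<open>h\<close> of \<open>\<phi>1 - \<phi>2\<close> and a localising factor \<open>K\<close>,
  the polynomial \<open>f = K * (h - \<phi>1)\<close> agrees on \<open>Z\<close> with \<open>- K * \<phi>2\<close>, whose frequencies in \<open>\<sigma>\<close> are too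
  high to survive averaging over \<open>\<sigma>\<close>. Hence on average \<open>f (\<sigma>)\<close> equals the value at \<open>\<sigma>\<close> of the
  projection of \<open>f\<close> to \<open>W\<close>, and the Hilbert-Schmidt norm of that projection is at most \<open>sqrt (4 * d)\<close>,
  while the \<open>L2\<close> norm of \<open>f\<close> is of order \<open>1 / sqrt d\<close>.\<close>

lemma trace_bound:
  fixes Z :: "complex set" and b :: "nat \<Rightarrow> real"
  assumes Z: "finite Z" "\<And>z. z \<in> Z \<Longrightarrow> cmod z = 1"
    and d: "1 \<le> d" and Jd: "J * d \<le> m" and m: "m \<le> card Z + 4 * d" and H: "0 \<le> H"
    and interp: "\<And>a. (\<And>z. z \<in> Z \<Longrightarrow> cmod (a z) \<le> 1) \<Longrightarrow> \<exists>h. degree h \<le> m - d \<and>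
      (\<forall>u. cmod u = 1 \<longrightarrow> cmod (poly h u) \<le> H) \<and> (\<forall>z\<in>Z. poly h z = a z)"
    and b: "\<And>j. 0 \<le> b j" "\<And>j. b j \<le> 1 / real j"
    and sinb: "\<And>x. \<bar>\<Sum>j=1..J. b j * sin (real j * x)\<bar> \<le> 3"
  shows "(\<Sum>j=1..J. b j) \<le> 30 * H + 4"
proof (cases "J = 0")
  case True then show ?thesis using H by simp
next
  case False
  then have dm: "d \<le> m" using Jd by (metis dual_order.trans mult_le_mono1 less_one linorder_not_less nat_mult_1)
  have m1: "1 \<le> m" using d dm by simp
  have jd: "j * d \<le> m" if "j \<in> {1..J}" for j
    using that Jd by (meson atLeastAtMost_iff dual_order.trans mult_le_mono1)
  \<comment> \<open>All frequencies below stay under \<open>2 * m + d \<le> 3 * m\<close>, so sums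
    over the grid are free of aliasing.\<close>
  define L where "L = 3 * m + 1"
  have L: "0 < L" "m < L" "0 < real L" by (auto simp: L_def)
  define \<sigma> where "\<sigma> l = cis (- (2 * pi * real l / real L))" for l
  have \<sigma>: "cmod (\<sigma> l) = 1" "\<sigma> l * cnj (\<sigma> l) = 1" for l
    by (simp_all add: \<sigma>_def cis_cnj cis_mult)
  have Parseval: "(\<Sum>l<L. (cmod (poly p (\<sigma> l)))\<^sup>2) = real L * (\<Sum>k<L. (cmod (coeff p k))\<^sup>2)"
    if "degree p < L" for p
    using discrete_Parseval[OF that, of 1] by (simp add: \<sigma>_def)
  \<comment> \<open>The sine series in \<open>d * x\<close>, shifted by the frequency
    \<open>m\<close>: negative frequencies become the powers in \<open>\<phi>1\<close>, at most
    \<open>m - d\<close>, positive ones the powers in \<open>\<phi>2\<close>, at least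
    \<open>m + d\<close>.\<close>
  define \<phi>1 \<phi>2 :: "complex \<Rightarrow> complex" where
    "\<phi>1 u = (\<Sum>j=1..J. of_real (b j) * u ^ (m - j * d))" and
    "\<phi>2 u = (\<Sum>j=1..J. of_real (b j) * u ^ (m + j * d))" for u
  have \<phi>_bound: "cmod (\<phi>1 u - \<phi>2 u) \<le> 6" if u1: "cmod u = 1" for u
  proof -
    obtain x where u: "u = cis x"
    proof
      show "u = cis (Arg u)" using u1 rcis_cmod_Arg[of u] by (simp add: rcis_def)
    qed
    have "\<phi>1 u - \<phi>2 u = - 2 * \<i> * cis (real m * x) * of_real (\<Sum>j=1..J. b j * sin (real j * (real d * x)))"
      unfolding \<phi>1_def \<phi>2_def sum_subtractf[symmetric] of_real_sum sum_distrib_left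
    proof (intro sum.cong refl)
      fix j assume j: "j \<in> {1..J}"
      have "cis ((real m - real j * real d) * x) - cis ((real m + real j * real d) * x)
          = cis (real m * x) * (cis (- (real j * real d * x)) - cis (real j * real d * x))"
        by (simp add: right_diff_distrib cis_mult algebra_simps)
      also have "cis (- (real j * real d * x)) - cis (real j * real d * x) = - 2 * \<i> * of_real (sin (real j * (real d * x)))"
        by (simp add: complex_eq_iff mult_ac)
      finally have diff: "cis ((real m - real j * real d) * x) - cis ((real m + real j * real d) * x)
          = cis (real m * x) * (- 2 * \<i> * of_real (sin (real j * (real d * x))))" .
      have "u ^ (m - j * d) = cis ((real m - real j * real d) * x)" "u ^ (m + j * d) = cis ((real m + real j * real d) * x)"
        using jd[OF j] by (simp_all add: u Complex.DeMoivre of_nat_diff)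
      then have "of_real (b j) * u ^ (m - j * d) - of_real (b j) * u ^ (m + j * d) =
          of_real (b j) * (cis (real m * x) * (- 2 * \<i> * of_real (sin (real j * (real d * x)))))"
        by (simp only: right_diff_distrib[symmetric] diff)
      then show "of_real (b j) * u ^ (m - j * d) - of_real (b j) * u ^ (m + j * d) =
          - 2 * \<i> * cis (real m * x) * of_real (b j * sin (real j * (real d * x)))"
        by (simp add: mult_ac)
    qed
    then have "cmod (\<phi>1 u - \<phi>2 u) = 2 * \<bar>\<Sum>j=1..J. b j * sin (real j * (real d * x))\<bar>"
      by (simp add: norm_mult del: of_real_sum)
    then show ?thesis using sinb[of "real d * x"] by simp
  qed
  have "\<exists>h. degree h \<le> m - d \<and> (\<forall>u. cmod u = 1 \<longrightarrow> cmod (poly h u) \<le> 6 * H) \<and>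
      (\<forall>z\<in>Z. poly h z = \<phi>1 (z * cnj (\<sigma> l)) - \<phi>2 (z * cnj (\<sigma> l)))" for l
  proof -
    have "cmod ((\<phi>1 (z * cnj (\<sigma> l)) - \<phi>2 (z * cnj (\<sigma> l))) / 6) \<le> 1" if "z \<in> Z" for z
      using \<phi>_bound[of "z * cnj (\<sigma> l)"] Z(2)[OF that] \<sigma> by (simp add: norm_mult norm_divide)
    from interp[of "\<lambda>z. (\<phi>1 (z * cnj (\<sigma> l)) - \<phi>2 (z * cnj (\<sigma> l))) / 6", OF this]
    obtain h where "degree h \<le> m - d" "\<And>u. cmod u = 1 \<Longrightarrow> cmod (poly h u) \<le> H"
      "\<And>z. z \<in> Z \<Longrightarrow> poly h z = (\<phi>1 (z * cnj (\<sigma> l)) - \<phi>2 (z * cnj (\<sigma> l))) / 6" by blast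
    then show ?thesis by (intro exI[of _ "smult 6 h"]) (auto simp: norm_mult mult.commute)
  qed
  then obtain h where h: "\<And>l. degree (h l) \<le> m - d" "\<And>l u. cmod u = 1 \<Longrightarrow> cmod (poly (h l) u) \<le> 6 * H"
    "\<And>l z. z \<in> Z \<Longrightarrow> poly (h l) z = \<phi>1 (z * cnj (\<sigma> l)) - \<phi>2 (z * cnj (\<sigma> l))"
    by metis
  \<comment> \<open>A one-sided Dirichlet kernel, equal to \<open>1\<close> at
    \<open>\<sigma> l\<close>. Its degree \<open>d - 1\<close> fits into the gap between
    \<open>m - d\<close> and \<open>m\<close>, and its squared norm is only
    \<open>1 / d\<close>.\<close>
  define K where "K l = (\<Sum>k<d. monom (cnj (\<sigma> l) ^ k / of_nat d) k)" for l
  define \<Phi> where "\<Phi> l = (\<Sum>j=1..J. monom (of_real (b j) * cnj (\<sigma> l) ^ (m - j * d)) (m - j * d))" for l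
  define f where "f l = K l * (h l - \<Phi> l)" for l
  have degK: "degree (K l) \<le> d - 1" for l
    unfolding K_def by (intro degree_sum_le order_trans[OF degree_monom_le]) auto
  have deg\<Phi>: "degree (\<Phi> l) \<le> m - d" for l
    unfolding \<Phi>_def
  proof (intro degree_sum_le order_trans[OF degree_monom_le])
    fix j assume "j \<in> {1..J}"
    then show "m - j * d \<le> m - d" by (intro diff_le_mono2) simp
  qed simp
  have degKp: "degree (K l * p) < m" if "degree p \<le> m - d" for l p
    using degree_mult_le[of "K l" p] degK[of l] that d dm by linarith
  have degf: "degree (f l) < m" for l
    unfolding f_def by (intro degKp degree_diff_le h deg\<Phi>)
  have polyK: "poly (K l) z = (\<Sum>k<d. (z * cnj (\<sigma> l)) ^ k) / of_nat d" for l z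
    by (simp add: K_def poly_sum poly_monom power_mult_distrib sum_divide_distrib mult_ac)
  have poly\<Phi>: "poly (\<Phi> l) z = \<phi>1 (z * cnj (\<sigma> l))" for l z
    by (simp add: \<Phi>_def \<phi>1_def poly_sum poly_monom power_mult_distrib mult_ac)
  define \<beta> where "\<beta> = (\<Sum>j=1..J. b j)"
  have f_diag: "poly (f l) (\<sigma> l) = poly (h l) (\<sigma> l) - of_real \<beta>" for l
    using d by (simp add: f_def polyK poly\<Phi> \<sigma> \<phi>1_def \<beta>_def)
  have f_node: "poly (f l) z = - (\<Sum>k<d. \<Sum>j=1..J. of_real (b j) / of_nat d * z ^ (m + j * d + k) * cnj (\<sigma> l ^ (m + j * d + k)))"
    if "z \<in> Z" for l z
    unfolding f_def poly_mult poly_diff polyK poly\<Phi> h(3)[OF that] \<phi>2_def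
    by (simp add: sum_product sum_divide_distrib power_add power_mult_distrib mult_ac)

  have "\<exists>G. degree G \<le> m - d \<and> (\<forall>x\<in>Z. poly G x = (if x = z then 1 else 0))" for z
  proof -
    have "cmod (if x = z then 1 else 0) \<le> 1" for x by simp
    from interp[of "\<lambda>x. if x = z then 1 else 0", OF this] show ?thesis by blast
  qed
  then obtain G where G: "\<And>z. degree (G z) \<le> m - d" "\<And>z x. x \<in> Z \<Longrightarrow> poly (G z) x = (if x = z then 1 else 0)"
    by metis
  have degG: "degree (G z) < m" for z using G(1)[of z] d dm by linarith
  obtain F where F: "finite F" "orthonormal m F" "card F + card Z \<le> m"
    "\<And>p z. p \<in> F \<Longrightarrow> z \<in> Z \<Longrightarrow> poly p z = 0" "\<And>p. p \<in> F \<Longrightarrow> degree p < m"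
    and proj: "\<And>w. degree w < m \<Longrightarrow> \<forall>z\<in>Z. poly w z = 0 \<Longrightarrow> w = (\<Sum>p\<in>F. smult (ip m w p) p)"
  proof (rule orthonormal_basis_vanishing[OF Z(1), of G m])
    show "degree (G z) < m" for z by (rule degG)
    show "poly (G z) x = (if x = z then 1 else 0)" if "x \<in> Z" for z x by (rule G(2)[OF that])
  qed (rule that)
  define pr where "pr w = (\<Sum>p\<in>F. smult (ip m w p) p)" for w
  have degpr: "degree (pr w) < m" for w
  proof -
    have "degree (pr w) \<le> m - 1"
      unfolding pr_def using F(1,5) by (intro degree_sum_le order_trans[OF degree_smult_le]) fastforce+
    then show ?thesis using m1 by linarith
  qed
  \<comment> \<open>Subtracting the projection makes the fundamental functions orthogonal to the
    span of \<open>F\<close>. They do not depend on \<open>l\<close>, so in the average only the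
    values of \<open>f l\<close> on \<open>Z\<close> vary along with the evaluation point.\<close>
  define g where "g z = G z - pr (G z)" for z
  have degg: "degree (g z) < m" for z
    unfolding g_def by (intro degree_diff_less degG degpr)
  have decomp: "poly (f l) x = poly (pr (f l)) x + (\<Sum>z\<in>Z. poly (f l) z * poly (g z) x)" for l x
  proof -
    define w where "w = f l - (\<Sum>z\<in>Z. smult (poly (f l) z) (G z))"
    have "degree w \<le> m - 1"
      unfolding w_def
    proof (intro degree_diff_le degree_sum_le order_trans[OF degree_smult_le])
      show "degree (f l) \<le> m - 1" using degf[of l] by linarith
      show "degree (G z) \<le> m - 1" for z using degG[of z] by linarith
    qed (rule Z(1))
    then have "degree w < m" using m1 by linarith
    moreover have "poly w x = 0" if "x \<in> Z" for x
    proof -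
      have "(\<Sum>z\<in>Z. poly (f l) z * poly (G z) x) = (\<Sum>z\<in>Z. if z = x then poly (f l) x else 0)"
        using G(2)[OF that] by (intro sum.cong) auto
      then show ?thesis using that Z(1) by (simp add: w_def poly_sum)
    qed
    ultimately have "w = pr w" unfolding pr_def by (intro proj) auto
    moreover have "pr w = pr (f l) - (\<Sum>z\<in>Z. smult (poly (f l) z) (pr (G z)))"
    proof -
      have "pr w = pr (f l) - (\<Sum>p\<in>F. \<Sum>z\<in>Z. smult (poly (f l) z * ip m (G z) p) p)"
        by (simp add: pr_def w_def ip_linear smult_diff_left sum_subtractf poly_vs.scale_sum_left)
      also have "(\<Sum>p\<in>F. \<Sum>z\<in>Z. smult (poly (f l) z * ip m (G z) p) p) = (\<Sum>z\<in>Z. smult (poly (f l) z) (pr (G z)))"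
        by (subst sum.swap) (simp add: pr_def poly_vs.scale_sum_right)
      finally show ?thesis .
    qed
    ultimately have "f l = pr (f l) + (\<Sum>z\<in>Z. smult (poly (f l) z) (g z))"
      unfolding w_def g_def by (simp add: smult_diff_right sum_subtractf algebra_simps)
    from arg_cong[OF this, of "\<lambda>p. poly p x"] show ?thesis by (simp add: poly_sum)
  qed
  \<comment> \<open>On \<open>Z\<close>, the values of \<open>f l\<close> contain only conjugate
    powers of \<open>\<sigma> l\<close> with exponents above \<open>m\<close>, whereas
    \<open>g z\<close> has degree below \<open>m\<close>; orthogonality on the grid kills the
    product.\<close>
  have orth: "(\<Sum>l<L. poly (f l) z * poly (g z) (\<sigma> l)) = 0" if "z \<in> Z" for z
  proof -
    have zero: "(\<Sum>l<L. poly (g z) (\<sigma> l) * cnj (\<sigma> l ^ (m + j * d + k))) = 0" if "j \<in> {1..J}" "k < d" for j k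
    proof -
      have p: "m + j * d + k < L" using jd[OF that(1)] that(2) dm by (simp add: L_def)
      have "(\<Sum>l<L. poly (g z) (\<sigma> l) * cnj (poly (monom 1 (m + j * d + k)) (\<sigma> l)))
          = of_nat L * (\<Sum>i<L. coeff (g z) i * cnj (coeff (monom 1 (m + j * d + k)) i))"
        using discrete_Parseval_bilinear[of "g z" L "monom 1 (m + j * d + k)" 1] degg[of z] L p
        by (simp add: \<sigma>_def degree_monom_eq)
      also have "(\<Sum>i<L. coeff (g z) i * cnj (coeff (monom 1 (m + j * d + k)) i)) = 0"
        using degg[of z] by (intro sum.neutral) (auto simp: coeff_eq_0)
      finally show ?thesis by (simp add: poly_monom)
    qed
    have "(\<Sum>l<L. poly (f l) z * poly (g z) (\<sigma> l)) =
        - (\<Sum>l<L. \<Sum>k<d. \<Sum>j=1..J. of_real (b j) / of_nat d * z ^ (m + j * d + k) *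
            (poly (g z) (\<sigma> l) * cnj (\<sigma> l ^ (m + j * d + k))))"
      unfolding f_node[OF that] mult_minus_left sum_negf sum_distrib_right
      by (simp only: mult_ac)
    also have "(\<Sum>l<L. \<Sum>k<d. \<Sum>j=1..J. of_real (b j) / of_nat d * z ^ (m + j * d + k) *
            (poly (g z) (\<sigma> l) * cnj (\<sigma> l ^ (m + j * d + k)))) =
        (\<Sum>k<d. \<Sum>l<L. \<Sum>j=1..J. of_real (b j) / of_nat d * z ^ (m + j * d + k) *
            (poly (g z) (\<sigma> l) * cnj (\<sigma> l ^ (m + j * d + k))))"
      by (rule sum.swap)
    also have "\<dots> = (\<Sum>k<d. \<Sum>j=1..J. \<Sum>l<L. of_real (b j) / of_nat d * z ^ (m + j * d + k) *
            (poly (g z) (\<sigma> l) * cnj (\<sigma> l ^ (m + j * d + k))))"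
      by (rule sum.cong[OF refl], rule sum.swap)
    also have "\<dots> = 0"
    proof (rule sum.neutral, rule ballI, rule sum.neutral, rule ballI)
      fix k j assume "k \<in> {..<d}" "j \<in> {1..J}"
      then have "(\<Sum>l<L. poly (g z) (\<sigma> l) * cnj (\<sigma> l ^ (m + j * d + k))) = 0" by (intro zero) auto
      then show "(\<Sum>l<L. of_real (b j) / of_nat d * z ^ (m + j * d + k) *
            (poly (g z) (\<sigma> l) * cnj (\<sigma> l ^ (m + j * d + k)))) = 0"
        by (simp only: sum_distrib_left[symmetric] mult_zero_right)
    qed
    finally show ?thesis by simp
  qed
  have trace: "(\<Sum>l<L. poly (f l) (\<sigma> l)) = (\<Sum>l<L. poly (pr (f l)) (\<sigma> l))"
  proof -
    have "(\<Sum>l<L. poly (f l) (\<sigma> l)) = (\<Sum>l<L. poly (pr (f l)) (\<sigma> l)) + (\<Sum>l<L. \<Sum>z\<in>Z. poly (f l) z * poly (g z) (\<sigma> l))"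
      by (subst decomp) (simp add: sum.distrib)
    also have "(\<Sum>l<L. \<Sum>z\<in>Z. poly (f l) z * poly (g z) (\<sigma> l)) = 0"
      by (subst sum.swap) (simp add: orth)
    finally show ?thesis by simp
  qed

  have normK: "(\<Sum>k<L. (cmod (coeff (K l) k))\<^sup>2) = 1 / real d" for l
  proof -
    have "(\<Sum>k<L. (cmod (coeff (K l) k))\<^sup>2) = (\<Sum>k<d. (cmod (cnj (\<sigma> l) ^ k / of_nat d))\<^sup>2)"
      unfolding K_def by (rule coeff_sum_monom_inj) (use dm L in auto)
    also have "\<dots> = 1 / real d"
      using d \<sigma> by (simp add: norm_divide norm_power power2_eq_square)
    finally show ?thesis .
  qed
  have normKh: "(\<Sum>k<L. (cmod (coeff (K l * h l) k))\<^sup>2) \<le> (6 * H)\<^sup>2 / real d" for l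
  proof -
    have "real L * (\<Sum>k<L. (cmod (coeff (K l * h l) k))\<^sup>2) = (\<Sum>i<L. (cmod (poly (K l * h l) (\<sigma> i)))\<^sup>2)"
      using degKp[OF h(1), of l l] L by (intro Parseval[symmetric]) simp
    also have "\<dots> \<le> (\<Sum>i<L. (cmod (poly (K l) (\<sigma> i)))\<^sup>2 * (6 * H)\<^sup>2)"
    proof (rule sum_mono)
      fix i
      have "(cmod (poly (h l) (\<sigma> i)))\<^sup>2 \<le> (6 * H)\<^sup>2"
        using h(2)[OF \<sigma>(1)] by (intro power_mono) auto
      then have "(cmod (poly (K l) (\<sigma> i)))\<^sup>2 * (cmod (poly (h l) (\<sigma> i)))\<^sup>2 \<le> (cmod (poly (K l) (\<sigma> i)))\<^sup>2 * (6 * H)\<^sup>2"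
        by (intro mult_left_mono) auto
      then show "(cmod (poly (K l * h l) (\<sigma> i)))\<^sup>2 \<le> (cmod (poly (K l) (\<sigma> i)))\<^sup>2 * (6 * H)\<^sup>2"
        by (simp only: poly_mult norm_mult power_mult_distrib[of "cmod (poly (K l) (\<sigma> i))"])
    qed
    also have "\<dots> = real L * (1 / real d) * (6 * H)\<^sup>2"
      using Parseval[of "K l"] degK[of l] d dm L by (simp only: normK sum_distrib_right[symmetric])
    finally have "real L * (\<Sum>k<L. (cmod (coeff (K l * h l) k))\<^sup>2) \<le> real L * ((6 * H)\<^sup>2 / real d)" by simp
    then show ?thesis using L(3) by (simp only: mult_le_cancel_left_pos)
  qed
  have normK\<Phi>: "(\<Sum>k<L. (cmod (coeff (K l * \<Phi> l) k))\<^sup>2) \<le> 2 / real d" for l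
  proof -
    have prod: "K l * \<Phi> l = (\<Sum>(k,j)\<in>{..<d} \<times> {1..J}. monom (cnj (\<sigma> l) ^ k / of_nat d * (of_real (b j) * cnj (\<sigma> l) ^ (m - j * d))) (k + (m - j * d)))"
      unfolding K_def \<Phi>_def sum_product mult_monom by (rule sum.cartesian_product)
    have "(\<Sum>i<L. (cmod (coeff (K l * \<Phi> l) i))\<^sup>2) =
        (\<Sum>(k,j)\<in>{..<d} \<times> {1..J}. (cmod (cnj (\<sigma> l) ^ k / of_nat d * (of_real (b j) * cnj (\<sigma> l) ^ (m - j * d))))\<^sup>2)"
      unfolding prod case_prod_unfold
    proof (rule coeff_sum_monom_inj)
      \<comment> \<open>The exponents of \<open>\<Phi> l\<close> are \<open>d\<close> apart and
        \<open>K l\<close> has degree below \<open>d\<close>, so \<open>j\<close> and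
        \<open>k\<close> are recovered by division by \<open>d\<close>.\<close>
      show "inj_on (\<lambda>x. fst x + (m - snd x * d)) ({..<d} \<times> {1..J})"
      proof (rule inj_onI, clarify)
        fix k j k' j' assume *: "k < d" "k' < d" "j \<in> {1..J}" "j' \<in> {1..J}"
          and "fst (k, j) + (m - snd (k, j) * d) = fst (k', j') + (m - snd (k', j') * d)"
        then have "k' + j * d = k + j' * d" using jd[of j] jd[of j'] by simp
        then have "(k' + j * d) div d = (k + j' * d) div d" by simp
        then have "j = j'" using * by simp
        then show "k = k' \<and> j = j'" using \<open>k' + j * d = k + j' * d\<close> by simp
      qed
      fix x assume "x \<in> {..<d} \<times> {1..J}"
      then have "fst x < d" by auto
      moreover have "m - snd x * d \<le> m" by simp
      ultimately show "fst x + (m - snd x * d) < L" using dm unfolding L_def by linarith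
    qed simp
    also have "\<dots> = (\<Sum>(k,j)\<in>{..<d} \<times> {1..J}. (b j)\<^sup>2 / (real d)\<^sup>2)"
    proof (rule sum.cong[OF refl])
      fix x assume "x \<in> {..<d} \<times> {1..J}"
      obtain k j where x: "x = (k, j)" by (cases x)
      have "cmod (cnj (\<sigma> l) ^ i) = 1" for i using \<sigma>(1) by (simp add: norm_power)
      then have "cmod (cnj (\<sigma> l) ^ k / of_nat d * (of_real (b j) * cnj (\<sigma> l) ^ (m - j * d))) = b j / real d"
        using b(1)[of j] by (simp only: norm_mult norm_divide norm_of_real norm_of_nat) simp
      then show "(case x of (k, j) \<Rightarrow> (cmod (cnj (\<sigma> l) ^ k / of_nat d * (of_real (b j) * cnj (\<sigma> l) ^ (m - j * d))))\<^sup>2)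
          = (case x of (k, j) \<Rightarrow> (b j)\<^sup>2 / (real d)\<^sup>2)"
        by (simp only: x prod.case power_divide)
    qed
    also have "\<dots> = (\<Sum>j=1..J. (b j)\<^sup>2) / real d"
    proof -
      have "(\<Sum>(k,j)\<in>{..<d} \<times> {1..J}. (b j)\<^sup>2 / (real d)\<^sup>2) = (\<Sum>k<d. \<Sum>j=1..J. (b j)\<^sup>2 / (real d)\<^sup>2)"
        by (rule sum.cartesian_product[symmetric])
      also have "\<dots> = real d * ((\<Sum>j=1..J. (b j)\<^sup>2) / (real d)\<^sup>2)"
        by (simp add: sum_divide_distrib)
      also have "\<dots> = (\<Sum>j=1..J. (b j)\<^sup>2) / real d"
        using d by (simp add: power2_eq_square)
      finally show ?thesis .
    qed
    finally have eq: "(\<Sum>i<L. (cmod (coeff (K l * \<Phi> l) i))\<^sup>2) = (\<Sum>j=1..J. (b j)\<^sup>2) / real d" .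
    have "(\<Sum>j=1..J. (b j)\<^sup>2) \<le> (\<Sum>j=1..J. 1 / (real j)\<^sup>2)"
    proof (rule sum_mono)
      fix j show "(b j)\<^sup>2 \<le> 1 / (real j)\<^sup>2"
        using power_mono[OF b(2) b(1), of j 2] by (simp add: power_divide)
    qed
    also have "\<dots> \<le> 2" by (rule sum_inverse_squares_le)
    finally show ?thesis unfolding eq by (rule divide_right_mono) simp
  qed
  have normf: "(\<Sum>k<m. (cmod (coeff (f l) k))\<^sup>2) \<le> (2 * (6 * H)\<^sup>2 + 4) / real d" for l
  proof -
    have "(\<Sum>k<m. (cmod (coeff (f l) k))\<^sup>2) = (\<Sum>k<L. (cmod (coeff (f l) k))\<^sup>2)"
      by (rule sum_coeff_extend[OF degf, symmetric]) (use L in simp)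
    also have "\<dots> \<le> (\<Sum>k<L. 2 * (cmod (coeff (K l * h l) k))\<^sup>2 + 2 * (cmod (coeff (K l * \<Phi> l) k))\<^sup>2)"
    proof (rule sum_mono)
      fix k
      let ?a = "cmod (coeff (K l * h l) k)" and ?b = "cmod (coeff (K l * \<Phi> l) k)"
      have "cmod (coeff (f l) k) \<le> ?a + ?b"
        unfolding f_def right_diff_distrib coeff_diff by (rule norm_triangle_ineq4)
      then have "(cmod (coeff (f l) k))\<^sup>2 \<le> (?a + ?b)\<^sup>2" by (intro power_mono) auto
      also have "\<dots> \<le> 2 * ?a\<^sup>2 + 2 * ?b\<^sup>2"
        using sum_squares_bound[of ?a ?b] unfolding power2_sum by linarith
      finally show "(cmod (coeff (f l) k))\<^sup>2 \<le> 2 * ?a\<^sup>2 + 2 * ?b\<^sup>2" .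
    qed
    also have "\<dots> = 2 * (\<Sum>k<L. (cmod (coeff (K l * h l) k))\<^sup>2) + 2 * (\<Sum>k<L. (cmod (coeff (K l * \<Phi> l) k))\<^sup>2)"
      by (simp add: sum.distrib sum_distrib_left)
    also have "\<dots> \<le> 2 * ((6 * H)\<^sup>2 / real d) + 2 * (2 / real d)"
      by (intro add_mono mult_left_mono normKh normK\<Phi>) auto
    finally show ?thesis by (simp add: add_divide_distrib)
  qed
  define y where "y = 6 * H"
  have y: "0 \<le> y" using H by (simp add: y_def)
  \<comment> \<open>Hilbert-Schmidt estimate by Cauchy-Schwarz over all pairs: the at most
    \<open>4 * d\<close> unit vectors in \<open>F\<close> compensate the factor \<open>1 / d\<close>
    in the squared norm of \<open>f l\<close>.\<close>
  have HS: "(\<Sum>(l,p)\<in>{..<L} \<times> F. cmod (ip m (f l) p) * cmod (poly p (\<sigma> l))) \<le> real L * (4 * y + 4)"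
  proof (rule power2_le_imp_le)
    have CS: "(\<Sum>(l,p)\<in>{..<L} \<times> F. cmod (ip m (f l) p) * cmod (poly p (\<sigma> l)))\<^sup>2 \<le>
        (\<Sum>(l,p)\<in>{..<L} \<times> F. (cmod (ip m (f l) p))\<^sup>2) * (\<Sum>(l,p)\<in>{..<L} \<times> F. (cmod (poly p (\<sigma> l)))\<^sup>2)"
      using Cauchy_Schwarz_ineq_sum[of "\<lambda>(l,p). cmod (ip m (f l) p)" "\<lambda>(l,p). cmod (poly p (\<sigma> l))" "{..<L} \<times> F"]
      by (simp add: case_prod_unfold)
    have A1: "(\<Sum>(l,p)\<in>{..<L} \<times> F. (cmod (ip m (f l) p))\<^sup>2) \<le> real L * ((2 * y\<^sup>2 + 4) / real d)"
    proof -
      have "(\<Sum>(l,p)\<in>{..<L} \<times> F. (cmod (ip m (f l) p))\<^sup>2) = (\<Sum>l<L. \<Sum>p\<in>F. (cmod (ip m (f l) p))\<^sup>2)"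
        by (simp add: sum.cartesian_product)
      also have "\<dots> \<le> (\<Sum>l<L. (2 * y\<^sup>2 + 4) / real d)"
        unfolding y_def by (intro sum_mono order_trans[OF Bessel[OF F(1,2)] normf])
      finally show ?thesis by simp
    qed
    have A2: "(\<Sum>(l,p)\<in>{..<L} \<times> F. (cmod (poly p (\<sigma> l)))\<^sup>2) \<le> real L * (4 * real d)"
    proof -
      have "(\<Sum>(l,p)\<in>{..<L} \<times> F. (cmod (poly p (\<sigma> l)))\<^sup>2) = (\<Sum>p\<in>F. \<Sum>l<L. (cmod (poly p (\<sigma> l)))\<^sup>2)"
        by (subst sum.swap) (simp add: sum.cartesian_product)
      also have "\<dots> = (\<Sum>p\<in>F. real L * 1)"
      proof (intro sum.cong refl)
        fix p assume p: "p \<in> F"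
        have "complex_of_real (\<Sum>k<m. (cmod (coeff p k))\<^sup>2) = 1"
          using F(2) p ip_self[of m p] by (simp add: orthonormal_def)
        then have "(\<Sum>k<m. (cmod (coeff p k))\<^sup>2) = 1" by (simp only: of_real_eq_1_iff)
        then show "(\<Sum>l<L. (cmod (poly p (\<sigma> l)))\<^sup>2) = real L * 1"
          using Parseval[of p] sum_coeff_extend[OF F(5)[OF p], of L] F(5)[OF p] L by simp
      qed
      also have "\<dots> = real L * real (card F)" by simp
      also have "\<dots> \<le> real L * (4 * real d)"
        using F(3) m by (intro mult_left_mono) auto
      finally show ?thesis .
    qed
    have "(\<Sum>(l,p)\<in>{..<L} \<times> F. cmod (ip m (f l) p) * cmod (poly p (\<sigma> l)))\<^sup>2
        \<le> (real L * ((2 * y\<^sup>2 + 4) / real d)) * (real L * (4 * real d))"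
      by (rule order_trans[OF CS mult_mono[OF A1 A2]]) (auto intro!: sum_nonneg divide_nonneg_nonneg)
    also have "\<dots> = (real L)\<^sup>2 * (8 * y\<^sup>2 + 16)"
      using d by (simp add: field_simps power2_eq_square)
    also have "\<dots> \<le> (real L)\<^sup>2 * (4 * y + 4)\<^sup>2"
      using y by (intro mult_left_mono) (auto simp: power2_eq_square algebra_simps)
    finally show "(\<Sum>(l,p)\<in>{..<L} \<times> F. cmod (ip m (f l) p) * cmod (poly p (\<sigma> l)))\<^sup>2 \<le> (real L * (4 * y + 4))\<^sup>2"
      by (simp add: power_mult_distrib)
  qed (use y in simp)
  \<comment> \<open>At its own grid point \<open>f l\<close> is \<open>h l\<close> minus
    \<open>\<beta>\<close>. On average \<open>h l\<close> contributes at most \<open>y\<close> and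
    the projection at most \<open>4 * y + 4\<close>, with \<open>y = 6 * H\<close>.\<close>
  have "(\<Sum>l<L. complex_of_real \<beta>) = (\<Sum>l<L. poly (h l) (\<sigma> l)) - (\<Sum>l<L. poly (pr (f l)) (\<sigma> l))"
    unfolding trace[symmetric] f_diag by (simp add: sum_subtractf)
  also have "cmod \<dots> \<le> (\<Sum>l<L. y) + real L * (4 * y + 4)"
  proof (rule order_trans[OF norm_triangle_ineq4 add_mono])
    show "cmod (\<Sum>l<L. poly (h l) (\<sigma> l)) \<le> (\<Sum>l<L. y)"
      unfolding y_def using h(2) \<sigma> by (intro sum_norm_le) auto
    have "cmod (\<Sum>l<L. poly (pr (f l)) (\<sigma> l)) \<le> (\<Sum>l<L. \<Sum>p\<in>F. cmod (ip m (f l) p) * cmod (poly p (\<sigma> l)))"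
      unfolding pr_def poly_sum by (intro sum_norm_le) (simp add: norm_mult)
    then show "cmod (\<Sum>l<L. poly (pr (f l)) (\<sigma> l)) \<le> real L * (4 * y + 4)"
      using HS by (simp add: sum.cartesian_product)
  qed
  finally have "real L * \<bar>\<beta>\<bar> \<le> real L * (5 * y + 4)"
    by (simp add: norm_mult algebra_simps)
  then have "\<beta> \<le> 5 * y + 4" using L by simp
  then show ?thesis by (simp add: \<beta>_def y_def)
qed

section \<open>Bernstein's inequality\<close>

text \<open>Horner's scheme, using that \<open>exp (\<i> * z) * cos z\<close> is half of
  \<open>1 + exp (2 * \<i> * z)\<close>. Complex \<open>z\<close> is allowed because the growth
  estimate leaves the real line.\<close>

lemma cos_poly_as_circle_poly:
  fixes Q :: "complex poly"
  assumes "degree Q \<le> N"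
  shows "\<exists>q. degree q \<le> 2 * N \<and> (\<forall>z. poly q (exp (\<i> * z)) = exp (\<i> * (of_nat N * z)) * poly Q (cos z))"
  using assms
proof (induction N arbitrary: Q)
  case 0
  then obtain c where "Q = [:c:]" by (auto elim: degree_eq_zeroE)
  then show ?case by (intro exI[of _ "[:c:]"]) auto
next
  case (Suc N)
  obtain c R where Q: "Q = pCons c R" by (cases Q)
  have "degree R \<le> N" using Suc.prems by (cases "R = 0") (auto simp: Q)
  then obtain r where r: "degree r \<le> 2 * N"
    "\<And>z. poly r (exp (\<i> * z)) = exp (\<i> * (of_nat N * z)) * poly R (cos z)"
    using Suc.IH by blast
  define q where "q = monom c (Suc N) + [:1/2, 0, 1/2:] * r"
  have "degree q \<le> 2 * Suc N"
    unfolding q_def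
  proof (intro degree_add_le order_trans[OF degree_monom_le] order_trans[OF degree_mult_le])
    show "degree [:1/2, 0, 1/2::complex:] + degree r \<le> 2 * Suc N" using r by simp
  qed auto
  moreover have "poly q (exp (\<i> * z)) = exp (\<i> * (of_nat (Suc N) * z)) * poly Q (cos z)" for z
  proof -
    have pow: "exp (\<i> * z) ^ k = exp (\<i> * (of_nat k * z))" for k
      by (simp add: exp_of_nat_mult[symmetric] mult_ac)
    have "exp (\<i> * z) * cos z = (1 + exp (\<i> * z) * exp (\<i> * z)) / 2"
      by (simp add: cos_exp_eq field_simps flip: exp_add)
    moreover have "exp (\<i> * (of_nat (Suc N) * z)) = exp (\<i> * z) * exp (\<i> * (of_nat N * z))"
      by (simp add: algebra_simps flip: exp_add)
    moreover have "poly q (exp (\<i> * z)) = c * exp (\<i> * (of_nat (Suc N) * z))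
        + ((1 + exp (\<i> * z) * exp (\<i> * z)) / 2) * (exp (\<i> * (of_nat N * z)) * poly R (cos z))"
      by (simp only: q_def poly_add poly_mult poly_monom pow r(2)) (simp add: algebra_simps add_divide_distrib)
    ultimately have "poly q (exp (\<i> * z)) = c * (exp (\<i> * z) * exp (\<i> * (of_nat N * z)))
        + (exp (\<i> * z) * cos z) * (exp (\<i> * (of_nat N * z)) * poly R (cos z))"
      and "exp (\<i> * (of_nat (Suc N) * z)) = exp (\<i> * z) * exp (\<i> * (of_nat N * z))"
      by (simp_all only:)
    then show ?thesis
      by (simp only: Q poly_pCons) (simp only: distrib_left mult_ac)
  qed
  ultimately show ?case by blast
qed

text \<open>For \<open>Im z \<ge> 0\<close> the point \<open>exp (\<i> * z)\<close> lies in the unit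
  disc, where the maximum principle bounds the circle polynomial by \<open>h\<close>; only the
  factor \<open>exp (- \<i> * N * z)\<close> grows. The lower half-plane follows as cosine is
  even.\<close>

lemma cos_poly_growth:
  fixes Q :: "complex poly"
  assumes deg: "degree Q \<le> N" and bd: "\<And>t. t \<in> {-1..1} \<Longrightarrow> cmod (poly Q (complex_of_real t)) \<le> h"
  shows "cmod (poly Q (cos z)) \<le> h * exp (real N * \<bar>Im z\<bar>)"
proof -
  obtain q where q: "\<And>z. poly q (exp (\<i> * z)) = exp (\<i> * (of_nat N * z)) * poly Q (cos z)"
    using cos_poly_as_circle_poly[OF deg] by blast
  have circle: "cmod (poly q u) \<le> h" if "cmod u = 1" for u
  proof -
    have u: "u = exp (\<i> * of_real (Arg u))"
      using that rcis_cmod_Arg[of u] by (simp add: rcis_def cis_conv_exp)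
    have "cmod (poly q u) = cmod (poly Q (complex_of_real (cos (Arg u))))"
      by (subst u) (simp add: q norm_mult cos_of_real)
    then show ?thesis using bd[of "cos (Arg u)"] by simp
  qed
  have disc: "cmod (poly q u) \<le> h" if "cmod u \<le> 1" for u
    by (rule maximum_modulus_frontier[of "poly q" "cball 0 1"])
       (use that circle in \<open>auto intro!: holomorphic_intros continuous_intros simp: frontier_cball\<close>)
  have upper: "cmod (poly Q (cos z)) \<le> h * exp (real N * \<bar>Im z\<bar>)" if "Im z \<ge> 0" for z
  proof -
    have "poly Q (cos z) = exp (- (\<i> * (of_nat N * z))) * poly q (exp (\<i> * z))"
      by (simp add: q exp_minus)
    then have "cmod (poly Q (cos z)) = exp (real N * Im z) * cmod (poly q (exp (\<i> * z)))"
      by (simp add: norm_mult)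
    also have "\<dots> \<le> exp (real N * Im z) * h"
      using that by (intro mult_left_mono disc) auto
    finally show ?thesis using that by (simp add: mult.commute)
  qed
  show ?thesis
  proof (cases "Im z \<ge> 0")
    case False
    then show ?thesis using upper[of "-z"] by simp
  qed (rule upper)
qed

text \<open>Cauchy's estimate on circles of radius \<open>1 / N\<close> around real points, where
  the growth factor is at most \<open>exp 1\<close>; hence the constant \<open>3\<close>.\<close>

lemma cos_poly_Lipschitz:
  fixes Q :: "complex poly"
  assumes deg: "degree Q \<le> N" and bd: "\<And>t. t \<in> {-1..1} \<Longrightarrow> cmod (poly Q (complex_of_real t)) \<le> h"
  shows "cmod (poly Q (complex_of_real (cos x)) - poly Q (complex_of_real (cos y))) \<le> 3 * real N * h * \<bar>x - y\<bar>"
proof (cases "N = 0")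
  case True
  then obtain c where "Q = [:c:]" using deg by (auto elim: degree_eq_zeroE)
  then show ?thesis using True by simp
next
  case False
  have h: "0 \<le> h" using order_trans[OF norm_ge_zero bd[of 0]] by simp
  define F where "F z = poly Q (cos z)" for z
  have hol: "F holomorphic_on UNIV"
    unfolding F_def by (intro holomorphic_intros)
  have der: "cmod (deriv F w) \<le> 3 * real N * h" if "Im w = 0" for w
  proof -
    have "cmod ((deriv ^^ 1) F w) \<le> fact 1 * (h * exp 1) / (1 / real N) ^ 1"
    proof (rule Cauchy_inequality)
      fix x assume x: "cmod (w - x) = 1 / real N"
      have "\<bar>Im x\<bar> \<le> 1 / real N"
        using abs_Im_le_cmod[of "w - x"] x that by simp
      then have "real N * \<bar>Im x\<bar> \<le> 1" using False by (simp add: field_simps)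
      then have "h * exp (real N * \<bar>Im x\<bar>) \<le> h * exp 1"
        using h by (intro mult_left_mono) auto
      then show "cmod (F x) \<le> h * exp 1"
        unfolding F_def using cos_poly_growth[OF deg bd, of x] by linarith
    next
      show "F holomorphic_on ball w (1 / real N)" by (rule holomorphic_on_subset[OF hol]) simp
      show "continuous_on (cball w (1 / real N)) F"
        by (rule holomorphic_on_imp_continuous_on, rule holomorphic_on_subset[OF hol]) simp
    qed (use False in simp)
    also have "\<dots> = real N * h * exp 1" by simp
    also have "\<dots> \<le> real N * h * 3"
      using h exp_le by (intro mult_left_mono) auto
    finally show ?thesis by (simp add: mult_ac)
  qed
  have "cmod (F (of_real x) - F (of_real y)) \<le> 3 * real N * h * cmod (of_real x - of_real y)"
  proof (rule field_differentiable_bound[where f' = "deriv F"])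
    show "convex (closed_segment (complex_of_real x) (of_real y))" by (rule convex_closed_segment)
    fix w assume w: "w \<in> closed_segment (complex_of_real x) (of_real y)"
    show "(F has_field_derivative deriv F w) (at w within closed_segment (of_real x) (of_real y))"
      by (rule has_field_derivative_at_within, rule holomorphic_derivI[OF hol open_UNIV UNIV_I])
    have "Im w = 0" using w by (auto simp: in_segment)
    then show "cmod (deriv F w) \<le> 3 * real N * h" by (rule der)
  qed auto
  then show ?thesis by (simp add: F_def cos_of_real norm_of_real flip: of_real_diff)
qed

section \<open>From local to global interpolation\<close>

text \<open>Multiplication by \<open>cis (n * x)\<close> identifies trigonometric polynomials of degree at most \<open>n\<close>
  with algebraic polynomials of degree at most \<open>2 * n\<close> on the unit circle.\<close>

definition trig :: "nat \<Rightarrow> (real \<Rightarrow> complex) \<Rightarrow> bool" where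
  "trig n f \<longleftrightarrow> (\<exists>q. degree q \<le> 2 * n \<and> (\<forall>x. poly q (cis x) = cis (real n * x) * f x))"

lemma trig_add: "trig n f \<Longrightarrow> trig n g \<Longrightarrow> trig n (\<lambda>x. f x + g x)"
  unfolding trig_def
proof (elim exE conjE)
  fix p q assume "degree p \<le> 2 * n" "degree q \<le> 2 * n"
    "\<forall>x. poly p (cis x) = cis (real n * x) * f x" "\<forall>x. poly q (cis x) = cis (real n * x) * g x"
  then show "\<exists>q. degree q \<le> 2 * n \<and> (\<forall>x. poly q (cis x) = cis (real n * x) * (f x + g x))"
    by (intro exI[of _ "p + q"]) (auto intro: degree_add_le simp: distrib_left)
qed

lemma trig_scale: "trig n f \<Longrightarrow> trig n (\<lambda>x. c * f x)"
  unfolding trig_def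
proof (elim exE conjE)
  fix p assume "degree p \<le> 2 * n" "\<forall>x. poly p (cis x) = cis (real n * x) * f x"
  then show "\<exists>q. degree q \<le> 2 * n \<and> (\<forall>x. poly q (cis x) = cis (real n * x) * (c * f x))"
    by (intro exI[of _ "smult c p"]) (auto intro: order_trans[OF degree_smult_le])
qed

lemma trig_mult: "trig m f \<Longrightarrow> trig n g \<Longrightarrow> trig (m + n) (\<lambda>x. f x * g x)"
  unfolding trig_def
proof (elim exE conjE)
  fix p q assume "degree p \<le> 2 * m" "degree q \<le> 2 * n"
    "\<forall>x. poly p (cis x) = cis (real m * x) * f x" "\<forall>x. poly q (cis x) = cis (real n * x) * g x"
  then show "\<exists>q. degree q \<le> 2 * (m + n) \<and> (\<forall>x. poly q (cis x) = cis (real (m + n) * x) * (f x * g x))"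
    by (intro exI[of _ "p * q"])
       (auto intro: order_trans[OF degree_mult_le] simp: distrib_right cis_mult[symmetric])
qed

lemma trig_sum: "finite I \<Longrightarrow> (\<And>i. i \<in> I \<Longrightarrow> trig n (f i)) \<Longrightarrow> trig n (\<lambda>x. \<Sum>i\<in>I. f i x)"
proof (induction I rule: finite_induct)
  case empty
  then show ?case by (auto simp: trig_def intro: exI[of _ 0])
next
  case (insert i I)
  then show ?case by (simp add: trig_add)
qed

lemma trig_cos_poly: "degree Q \<le> N \<Longrightarrow> trig N (\<lambda>x. poly Q (complex_of_real (cos x)))"
proof -
  assume "degree Q \<le> N"
  then obtain q where "degree q \<le> 2 * N"
    and q: "\<And>z. poly q (exp (\<i> * z)) = exp (\<i> * (of_nat N * z)) * poly Q (cos z)"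
    using cos_poly_as_circle_poly by blast
  moreover have "poly q (cis x) = cis (real N * x) * poly Q (complex_of_real (cos x))" for x
    using q[of "complex_of_real x"] by (simp add: cis_conv_exp cos_of_real)
  ultimately show ?thesis by (auto simp: trig_def)
qed

text \<open>The unnormalised Jackson kernel \<open>(sin (a * x / 2) / sin (x / 2)) ^ 4\<close>. The
  fourth power, unlike the second, gives the mean of \<open>1 - cos\<close> the order
  \<open>1 / a^2\<close>.\<close>

definition jackson :: "nat \<Rightarrow> real \<Rightarrow> real" where
  "jackson a x = (cmod (\<Sum>k<a. cis x ^ k)) ^ 4"

lemma jackson_nonneg: "jackson a x \<ge> 0"
  by (simp add: jackson_def)

lemma trig_jackson: "trig (2 * a) (\<lambda>x. of_real (jackson a (x - s)))"
proof -
  define A where "A x = (\<Sum>k<a. cis (x - s) ^ k)" for x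
  have "trig a (\<lambda>x. A x * cnj (A x))"
    unfolding trig_def
  proof (intro exI conjI allI)
    let ?p = "\<Sum>k<a. monom (cis (- (real k * s))) k" and ?q = "\<Sum>k<a. monom (cis (real k * s)) (a - k)"
    have "degree ?p \<le> a" "degree ?q \<le> a"
      by (auto intro!: degree_sum_le order_trans[OF degree_monom_le])
    then show "degree (?p * ?q) \<le> 2 * a"
      using degree_mult_le[of ?p ?q] by simp
    fix x
    have "poly ?p (cis x) = A x"
      by (simp add: A_def poly_sum poly_monom Complex.DeMoivre cis_mult algebra_simps)
    moreover have "poly ?q (cis x) = cis (real a * x) * cnj (A x)"
      unfolding A_def cnj_sum sum_distrib_left poly_sum poly_monom
      by (intro sum.cong refl) (simp add: Complex.DeMoivre cis_mult cis_cnj of_nat_diff algebra_simps)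
    ultimately show "poly (?p * ?q) (cis x) = cis (real a * x) * (A x * cnj (A x))" by simp
  qed
  from trig_mult[OF this this] have "trig (2 * a) (\<lambda>x. (A x * cnj (A x)) * (A x * cnj (A x)))"
    by (simp add: mult_2)
  moreover have "(A x * cnj (A x)) * (A x * cnj (A x)) = of_real (jackson a (x - s))" for x
  proof -
    have "(A x * cnj (A x)) * (A x * cnj (A x)) = of_real ((cmod (A x))\<^sup>2 * (cmod (A x))\<^sup>2)"
      by (simp only: complex_norm_square of_real_mult)
    also have "(cmod (A x))\<^sup>2 * (cmod (A x))\<^sup>2 = jackson a (x - s)"
      by (simp add: jackson_def A_def power4_eq_xxxx power2_eq_square)
    finally show ?thesis .
  qed
  ultimately show ?thesis by simp
qed

text \<open>\<open>jackson\<close> is the squared modulus of \<open>D * D\<close>, whose degree is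
  below \<open>L\<close>; hence grid averages do not depend on \<open>x\<close>, and finitely many
  translates replace an integral. In the second moment, \<open>D (u) * (1 - u) = 1 - u^a\<close>
  removes one squared factor \<open>D\<close>, which leaves \<open>2 * L * a\<close> against
  \<open>\<kappa> \<ge> L * a^3 / 2\<close>.\<close>

lemma jackson_averages:
  assumes a: "1 \<le> a" and L: "L = 2 * a"
  obtains \<kappa> where "\<kappa> > 0" "\<And>x. (\<Sum>l<L. jackson a (x - 2 * pi * real l / real L)) = \<kappa>"
    "\<And>x. (\<Sum>l<L. jackson a (x - 2 * pi * real l / real L) * (1 - cos (x - 2 * pi * real l / real L))) \<le> 4 / (real a)\<^sup>2 * \<kappa>"
proof
  define D :: "complex poly" where "D = (\<Sum>k<a. monom 1 k)"
  define \<kappa> where "\<kappa> = real L * (\<Sum>k<L. (cmod (coeff (D * D) k))\<^sup>2)"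
  have polyD: "poly D u = (\<Sum>k<a. u ^ k)" for u by (simp add: D_def poly_sum poly_monom)
  have "degree D \<le> a - 1"
    unfolding D_def by (intro degree_sum_le order_trans[OF degree_monom_le]) auto
  then have degD: "degree D < L" "degree (D * D) < L"
    using degree_mult_le[of D D] a L by linarith+
  have jk: "jackson a (x - 2 * pi * real l / real L) = (cmod (poly (D * D) (cis x * cis (- (2 * pi * real l / real L)))))\<^sup>2"
    for x l
    by (simp add: jackson_def polyD cis_mult norm_mult power4_eq_xxxx power2_eq_square)
  show sum_eq: "(\<Sum>l<L. jackson a (x - 2 * pi * real l / real L)) = \<kappa>" for x
    unfolding jk \<kappa>_def by (rule discrete_Parseval[OF degD(2)]) simp
  have \<kappa>_ge: "real L * (real a ^ 3 / 2) \<le> \<kappa>"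
  proof -
    have "poly (D * D) 1 = (\<Sum>k<L. coeff (D * D) k)"
      unfolding poly_altdef using degD(2) by (simp, intro sum.mono_neutral_left) (auto simp: coeff_eq_0)
    then have "cmod (\<Sum>k<L. coeff (D * D) k) = cmod (of_nat (a * a))"
      by (simp add: polyD)
    then have "real a * real a = cmod (\<Sum>k<L. coeff (D * D) k)"
      by (simp add: norm_mult)
    also have "\<dots> \<le> (\<Sum>k<L. 1 * cmod (coeff (D * D) k))"
      by (simp add: norm_sum)
    finally have "(real a * real a)\<^sup>2 \<le> (\<Sum>k<L. 1 * cmod (coeff (D * D) k))\<^sup>2"
      by (intro power_mono) auto
    also have "\<dots> \<le> (\<Sum>k<L. 1\<^sup>2) * (\<Sum>k<L. (cmod (coeff (D * D) k))\<^sup>2)"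
      by (rule Cauchy_Schwarz_ineq_sum)
    also have "\<dots> = \<kappa>" by (simp add: \<kappa>_def)
    finally show ?thesis using L by (simp add: power2_eq_square power3_eq_cube)
  qed
  then show "\<kappa> > 0" using a L by (intro less_le_trans[OF _ \<kappa>_ge]) auto
  fix x
  define u where "u l = cis x * cis (- (2 * pi * real l / real L))" for l
  have u: "u l = cis (x - 2 * pi * real l / real L)" for l by (simp add: u_def cis_mult)
  have "(\<Sum>l<L. jackson a (x - 2 * pi * real l / real L) * (1 - cos (x - 2 * pi * real l / real L)))
      \<le> (\<Sum>l<L. 2 * (cmod (poly D (u l)))\<^sup>2)"
  proof (rule sum_mono)
    fix l
    let ?y = "x - 2 * pi * real l / real L"
    have "(cmod (1 - cis ?y))\<^sup>2 = (1 - cos ?y)\<^sup>2 + (sin ?y)\<^sup>2"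
      by (simp add: cmod_power2)
    also have "\<dots> = 2 * (1 - cos ?y)"
      using sin_cos_squared_add[of ?y] by (simp add: power2_diff)
    finally have "2 * (jackson a ?y * (1 - cos ?y)) = (cmod (poly D (u l)))\<^sup>2 * (cmod (poly D (u l) * (1 - u l)))\<^sup>2"
      unfolding jk by (simp add: u norm_mult power_mult_distrib cis_mult)
    also have "poly D (u l) * (1 - u l) = 1 - u l ^ a"
      by (simp add: polyD one_diff_power_eq mult.commute)
    also have "(cmod (1 - u l ^ a))\<^sup>2 \<le> 2\<^sup>2"
      using norm_triangle_ineq4[of 1 "u l ^ a"] by (intro power_mono) (auto simp: u norm_power)
    finally show "jackson a ?y * (1 - cos ?y) \<le> 2 * (cmod (poly D (u l)))\<^sup>2"
      by (simp add: mult_left_mono)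
  qed
  also have "\<dots> = 2 * (real L * (\<Sum>k<L. (cmod (coeff D k))\<^sup>2))"
    unfolding u_def by (subst discrete_Parseval[OF degD(1), symmetric, of "cis x"]) (simp_all add: sum_distrib_left)
  also have "(\<Sum>k<L. (cmod (coeff D k))\<^sup>2) = real a"
    unfolding D_def by (subst coeff_sum_monom_inj) (use a L in auto)
  also have "2 * (real L * real a) = 4 / (real a)\<^sup>2 * (real L * (real a ^ 3 / 2))"
    using a by (simp add: power2_eq_square power3_eq_cube)
  also have "\<dots> \<le> 4 / (real a)\<^sup>2 * \<kappa>"
    using \<kappa>_ge by (intro mult_left_mono) auto
  finally show "(\<Sum>l<L. jackson a (x - 2 * pi * real l / real L) * (1 - cos (x - 2 * pi * real l / real L)))
      \<le> 4 / (real a)\<^sup>2 * \<kappa>" .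
qed

text \<open>At a node \<open>x\<close> the interpolants \<open>Q l\<close> with \<open>s l\<close> close to \<open>x\<close> all have the right sign, and the
  remaining ones carry little weight in the average against the Jackson kernel. An even function
  cannot separate \<open>\<theta> i\<close> from \<open>- \<theta> i\<close>, but no window contains both, as \<open>\<theta> i\<close> stays away from \<open>0\<close> and \<open>pi\<close>.\<close>

lemma glue_signs:
  fixes \<theta> :: "nat \<Rightarrow> real" and S :: "nat set"
  assumes a: "1 \<le> a" and h: "0 \<le> h"
    and range: "\<And>i. i \<in> S \<Longrightarrow> w < \<theta> i \<and> \<theta> i < pi - w" and w: "0 < w" "w \<le> pi / 2"
    and tail: "(1 + h) * (4 / (real a)\<^sup>2) \<le> (1 - cos w) / 2"
    and solvable: "\<And>s y. (\<And>i. y i \<in> {-1, 1::real}) \<Longrightarrow> \<exists>Q. degree Q \<le> N \<and>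
      (\<forall>t\<in>{-1..1}. poly Q (complex_of_real t) \<in> \<real> \<and> cmod (poly Q (complex_of_real t)) \<le> h) \<and>
      (\<forall>i\<in>S. cos (\<theta> i - s) \<ge> cos w \<or> cos (\<theta> i + s) \<ge> cos w \<longrightarrow> y i * Re (poly Q (complex_of_real (cos (\<theta> i)))) \<ge> 1)"
    and y: "\<And>x. y x \<in> {-1, 1::real}"
  shows "\<exists>f. trig (N + 2 * a) (\<lambda>x. of_real (f x)) \<and> (\<forall>x. \<bar>f x\<bar> \<le> h) \<and>
    (\<forall>x \<in> \<theta> ` S \<union> (\<lambda>i. - \<theta> i) ` S. y x * f x \<ge> 1/2)"
proof -
  define L where "L = 2 * a"
  define s where "s l = 2 * pi * real l / real L" for l
  obtain \<kappa> where \<kappa>: "\<kappa> > 0" "\<And>x. (\<Sum>l<L. jackson a (x - s l)) = \<kappa>"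
    "\<And>x. (\<Sum>l<L. jackson a (x - s l) * (1 - cos (x - s l))) \<le> 4 / (real a)\<^sup>2 * \<kappa>"
    unfolding s_def using jackson_averages[OF a L_def] by blast
  have cw: "cos w < 1" "0 \<le> cos w"
    using cos_monotone_0_pi[of 0 w] cos_ge_zero[of w] w by auto
  \<comment> \<open>Each node has two lifts \<open>\<theta> i\<close> and
    \<open>- \<theta> i\<close> with independent signs; the window at \<open>s l\<close> asks for
    the sign of the lift that it contains.\<close>
  have "\<exists>Q. degree Q \<le> N \<and>
      (\<forall>t\<in>{-1..1}. poly Q (complex_of_real t) \<in> \<real> \<and> cmod (poly Q (complex_of_real t)) \<le> h) \<and>
      (\<forall>i\<in>S. cos (\<theta> i - s l) \<ge> cos w \<or> cos (\<theta> i + s l) \<ge> cos w \<longrightarrow>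
        (if cos (\<theta> i - s l) \<ge> cos w then y (\<theta> i) else y (- \<theta> i)) * Re (poly Q (complex_of_real (cos (\<theta> i)))) \<ge> 1)" for l
    using y by (intro solvable) auto
  then obtain Q where Q: "\<And>l. degree (Q l) \<le> N"
    "\<And>l t. t \<in> {-1..1} \<Longrightarrow> poly (Q l) (complex_of_real t) \<in> \<real> \<and> cmod (poly (Q l) (complex_of_real t)) \<le> h"
    "\<And>l i. i \<in> S \<Longrightarrow> cos (\<theta> i - s l) \<ge> cos w \<or> cos (\<theta> i + s l) \<ge> cos w \<Longrightarrow>
        (if cos (\<theta> i - s l) \<ge> cos w then y (\<theta> i) else y (- \<theta> i)) * Re (poly (Q l) (complex_of_real (cos (\<theta> i)))) \<ge> 1"
    by metis
  define g where "g l x = Re (poly (Q l) (complex_of_real (cos x)))" for l x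
  have g: "poly (Q l) (complex_of_real (cos x)) = of_real (g l x)" "\<bar>g l x\<bar> \<le> h" for l x
  proof -
    have c: "cos x \<in> {-1..1}" by simp
    show "poly (Q l) (complex_of_real (cos x)) = of_real (g l x)"
      using Q(2)[OF c, of l] by (simp add: g_def)
    then show "\<bar>g l x\<bar> \<le> h" using Q(2)[OF c, of l] by simp
  qed
  define f where "f x = (\<Sum>l<L. jackson a (x - s l) * g l x) / \<kappa>" for x
  have "trig (N + 2 * a) (\<lambda>x. of_real (f x))"
  proof -
    have "trig (N + 2 * a) (\<lambda>x. complex_of_real (1 / \<kappa>) * (\<Sum>l<L. poly (Q l) (complex_of_real (cos x)) * of_real (jackson a (x - s l))))"
      by (intro trig_scale trig_sum trig_mult trig_cos_poly trig_jackson Q) auto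
    then show ?thesis by (simp add: f_def g(1) mult.commute)
  qed
  moreover have "\<bar>f x\<bar> \<le> h" for x
  proof -
    have "\<bar>\<Sum>l<L. jackson a (x - s l) * g l x\<bar> \<le> (\<Sum>l<L. jackson a (x - s l) * h)"
      using g(2) jackson_nonneg by (intro order_trans[OF sum_abs sum_mono]) (auto simp: abs_mult intro!: mult_left_mono)
    also have "\<dots> = \<kappa> * h" by (simp add: \<kappa>(2) flip: sum_distrib_right)
    finally show ?thesis using \<kappa>(1) by (simp add: f_def field_simps)
  qed
  moreover have "y x * f x \<ge> 1/2" if x: "x \<in> \<theta> ` S \<union> (\<lambda>i. - \<theta> i) ` S" for x
  proof -
    have near: "y x * g l x \<ge> 1" if near: "cos (x - s l) \<ge> cos w" for l
    proof -
      from x obtain i where i: "i \<in> S" and "x = \<theta> i \<or> x = - \<theta> i" by auto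
      then consider "x = \<theta> i" | "x = - \<theta> i" by auto
      then show ?thesis
      proof cases
        case 1 then show ?thesis using Q(3)[OF i, of l] near by (simp add: g_def)
      next
        case 2
        have c2: "cos (\<theta> i + s l) \<ge> cos w"
          using near 2 cos_minus[of "\<theta> i + s l"] by simp
        have "\<not> cos (\<theta> i - s l) \<ge> cos w"
        proof
          assume "cos (\<theta> i - s l) \<ge> cos w"
          with c2 have "2 * cos w \<le> cos (\<theta> i - s l) + cos (\<theta> i + s l)" by simp
          also have "\<dots> = 2 * (cos (\<theta> i) * cos (s l))" by (simp add: cos_add cos_diff)
          finally have "cos w \<le> cos (\<theta> i) * cos (s l)" by simp
          also have "\<dots> \<le> \<bar>cos (\<theta> i)\<bar> * 1"
            by (rule order_trans[OF abs_ge_self]) (simp add: abs_mult mult_left_le)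
          finally have "cos w \<le> \<bar>cos (\<theta> i)\<bar>" by simp
          moreover have "cos (\<theta> i) < cos w"
            using range[OF i] w by (intro cos_monotone_0_pi) auto
          moreover have "cos (pi - w) < cos (\<theta> i)"
            using range[OF i] w by (intro cos_monotone_0_pi) auto
          ultimately show False by simp
        qed
        then show ?thesis using Q(3)[OF i, of l] c2 2 by (simp add: g_def)
      qed
    qed
    \<comment> \<open>Outside the window \<open>1 - cos\<close> is at least
      \<open>1 - cos w\<close>, so the left side is at most \<open>- h\<close>. Thus the second
      moment of the kernel controls the weight outside the window, and by \<open>tail\<close> it
      costs at most \<open>1/2\<close>.\<close>
    have pointwise: "1 - (1 + h) / (1 - cos w) * (1 - cos (x - s l)) \<le> y x * g l x" for l
    proof (cases "cos (x - s l) \<ge> cos w")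
      case True
      have "0 \<le> (1 + h) / (1 - cos w) * (1 - cos (x - s l))"
        using h cw by (intro mult_nonneg_nonneg divide_nonneg_pos) auto
      then show ?thesis using near[OF True] by linarith
    next
      case False
      have "(1 + h) / (1 - cos w) * (1 - cos w) \<le> (1 + h) / (1 - cos w) * (1 - cos (x - s l))"
        using h cw False by (intro mult_left_mono divide_nonneg_pos) auto
      then have "1 + h \<le> (1 + h) / (1 - cos w) * (1 - cos (x - s l))" using cw by simp
      moreover have "- h \<le> y x * g l x"
        using g(2)[of l x] y[of x] by auto
      ultimately show ?thesis by linarith
    qed
    have "\<kappa> * (1 / 2) \<le> \<kappa> - (1 + h) / (1 - cos w) * (4 / (real a)\<^sup>2 * \<kappa>)"
    proof -
      have "(1 + h) / (1 - cos w) * (4 / (real a)\<^sup>2) = (1 + h) * (4 / (real a)\<^sup>2) / (1 - cos w)" by simp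
      also have "\<dots> \<le> ((1 - cos w) / 2) / (1 - cos w)"
        using tail cw by (intro divide_right_mono) auto
      also have "\<dots> = 1 / 2" using cw by simp
      finally have "(1 + h) / (1 - cos w) * (4 / (real a)\<^sup>2) * \<kappa> \<le> 1 / 2 * \<kappa>"
        using \<kappa>(1) by (intro mult_right_mono) auto
      then show ?thesis by (simp add: mult_ac)
    qed
    also have "\<dots> \<le> \<kappa> - (1 + h) / (1 - cos w) * (\<Sum>l<L. jackson a (x - s l) * (1 - cos (x - s l)))"
      using \<kappa>(3)[of x] h cw by (intro diff_left_mono mult_left_mono divide_nonneg_pos) auto
    also have "\<dots> = (\<Sum>l<L. jackson a (x - s l) * (1 - (1 + h) / (1 - cos w) * (1 - cos (x - s l))))"
    proof -
      have "jackson a (x - s l) * (1 - (1 + h) / (1 - cos w) * (1 - cos (x - s l))) = jackson a (x - s l) -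
          (1 + h) / (1 - cos w) * (jackson a (x - s l) * (1 - cos (x - s l)))" for l
        by (simp add: right_diff_distrib mult.left_commute)
      then show ?thesis
        by (simp only: sum_subtractf sum_distrib_left[symmetric] \<kappa>(2))
    qed
    also have "\<dots> \<le> (\<Sum>l<L. jackson a (x - s l) * (y x * g l x))"
      by (intro sum_mono mult_left_mono pointwise jackson_nonneg)
    also have "\<dots> = \<kappa> * (y x * f x)"
    proof -
      have "(\<Sum>l<L. jackson a (x - s l) * (y x * g l x)) = y x * (\<Sum>l<L. jackson a (x - s l) * g l x)"
        by (simp add: sum_distrib_left mult.left_commute)
      then show ?thesis using \<kappa>(1) by (simp add: f_def)
    qed
    finally show ?thesis using \<kappa>(1) by (simp only: mult_le_cancel_left_pos)
  qed
  ultimately show ?thesis by blast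
qed

text \<open>Prescribed values are attained one point at a time, by convex combinations of two functions that
  have opposite signs at the new point and agree where values are already prescribed.\<close>

lemma convex_interpolation:
  fixes V :: "('a \<Rightarrow> real) set"
  assumes X: "finite X" and "c \<ge> 0"
    and convex: "\<And>f g t. f \<in> V \<Longrightarrow> g \<in> V \<Longrightarrow> 0 \<le> t \<Longrightarrow> t \<le> 1 \<Longrightarrow> (\<lambda>x. t * f x + (1 - t) * g x) \<in> V"
    and signs: "\<And>y. (\<And>x. y x \<in> {-1, 1}) \<Longrightarrow> \<exists>f\<in>V. \<forall>x\<in>X. y x * f x \<ge> c"
    and b: "\<And>x. x \<in> X \<Longrightarrow> \<bar>b x\<bar> \<le> c"
  shows "\<exists>f\<in>V. \<forall>x\<in>X. f x = b x"
proof -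
  have "\<exists>f\<in>V. (\<forall>x\<in>Y. f x = b x) \<and> (\<forall>x\<in>X - Y. y x * f x \<ge> c)"
    if "Y \<subseteq> X" "\<And>x. y x \<in> {-1, 1}" for Y y
    using finite_subset[OF that(1) X] that
  proof (induction Y arbitrary: y rule: finite_induct)
    case empty
    then show ?case using signs[of y] by auto
  next
    case (insert p Y)
    obtain f where f: "f \<in> V" "\<forall>x\<in>Y. f x = b x" "\<forall>x\<in>X - Y. (y(p := 1)) x * f x \<ge> c"
      using insert.IH[of "y(p := 1)"] insert.prems by (metis fun_upd_apply insert_iff insert_subset)
    obtain g where g: "g \<in> V" "\<forall>x\<in>Y. g x = b x" "\<forall>x\<in>X - Y. (y(p := -1)) x * g x \<ge> c"
      using insert.IH[of "y(p := -1)"] insert.prems by (metis fun_upd_apply insert_iff insert_subset)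
    have p: "p \<in> X - Y" using insert by auto
    have fp: "f p \<ge> b p" "g p \<le> b p" using f(3) g(3) p b[of p] by force+
    obtain t where t: "0 \<le> t" "t \<le> 1" "t * f p + (1 - t) * g p = b p"
    proof (cases "f p = g p")
      case True then show ?thesis using fp that[of 0] by simp
    next
      case False
      then have pos: "f p - g p > 0" using fp by simp
      show ?thesis
      proof (rule that[of "(b p - g p) / (f p - g p)"])
        have lin: "t * f p + (1 - t) * g p = t * (f p - g p) + g p" for t
          by (simp add: algebra_simps)
        show "(b p - g p) / (f p - g p) * f p + (1 - (b p - g p) / (f p - g p)) * g p = b p"
          unfolding lin using pos by simp
      qed (use pos fp in auto)
    qed
    have "(\<lambda>x. t * f x + (1 - t) * g x) \<in> V" using convex f g t by blast
    moreover have "\<forall>x\<in>insert p Y. t * f x + (1 - t) * g x = b x"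
      using t(3) f(2) g(2) by (auto simp: algebra_simps)
    moreover have "\<forall>x\<in>X - insert p Y. y x * (t * f x + (1 - t) * g x) \<ge> c"
    proof
      fix x assume x: "x \<in> X - insert p Y"
      then have "y x * f x \<ge> c" "y x * g x \<ge> c"
        using f(3)[rule_format, of x] g(3)[rule_format, of x] by auto
      then have "t * (y x * f x) + (1 - t) * (y x * g x) \<ge> t * c + (1 - t) * c"
        using t by (intro add_mono mult_left_mono) auto
      then show "y x * (t * f x + (1 - t) * g x) \<ge> c" by (simp add: algebra_simps)
    qed
    ultimately show ?case
      by (intro bexI[of _ "\<lambda>x. t * f x + (1 - t) * g x"] conjI)
  qed
  from this[of X "\<lambda>_. 1"] show ?thesis by auto
qed

text \<open>Signs are realised at height \<open>1/2\<close> only. The data are freed of the factor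
  \<open>cis (n * x)\<close>, split into real and imaginary parts and halved; doubling and adding
  the two real solutions gives the bound \<open>4 * h\<close>.\<close>

lemma circle_interpolation:
  fixes X :: "real set"
  assumes X: "finite X"
    and signs: "\<And>y. (\<And>x. y x \<in> {-1, 1::real}) \<Longrightarrow> \<exists>f. trig n (\<lambda>x. of_real (f x)) \<and> (\<forall>x. \<bar>f x\<bar> \<le> h) \<and>
      (\<forall>x\<in>X. y x * f x \<ge> 1/2)"
    and data: "\<And>x. x \<in> X \<Longrightarrow> cmod (d (cis x)) \<le> 1"
  shows "\<exists>q. degree q \<le> 2 * n \<and> (\<forall>u. cmod u = 1 \<longrightarrow> cmod (poly q u) \<le> 4 * h) \<and> (\<forall>z\<in>cis ` X. poly q z = d z)"
proof -
  define V where "V = {f. trig n (\<lambda>x. of_real (f x)) \<and> (\<forall>x. \<bar>f x\<bar> \<le> h)}"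
  have conv: "(\<lambda>x. t * f x + (1 - t) * g x) \<in> V" if f: "f \<in> V" and g: "g \<in> V" and t: "0 \<le> t" "t \<le> 1" for f g and t :: real
  proof -
    have "trig n (\<lambda>x. of_real t * of_real (f x) + of_real (1 - t) * of_real (g x))"
      using f g by (intro trig_add trig_scale) (auto simp: V_def)
    moreover have "\<bar>t * f x + (1 - t) * g x\<bar> \<le> h" for x
    proof -
      have "\<bar>t * f x + (1 - t) * g x\<bar> \<le> t * \<bar>f x\<bar> + (1 - t) * \<bar>g x\<bar>"
        using t by (intro order_trans[OF abs_triangle_ineq]) (simp add: abs_mult)
      also have "\<dots> \<le> t * h + (1 - t) * h"
        using f g t by (intro add_mono mult_left_mono) (auto simp: V_def)
      finally show ?thesis by (simp add: algebra_simps)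
    qed
    ultimately show ?thesis by (simp add: V_def)
  qed
  have interp: "\<exists>f\<in>V. \<forall>x\<in>X. f x = b x" if "\<And>x. x \<in> X \<Longrightarrow> \<bar>b x\<bar> \<le> 1/2" for b
  proof (rule convex_interpolation[OF X, of "1/2"])
    show "\<exists>f\<in>V. \<forall>x\<in>X. 1 / 2 \<le> y x * f x" if "\<And>x. y x \<in> {-1, 1}" for y
      using signs[OF that] by (auto simp: V_def)
  qed (use conv that in auto)
  define c where "c x = cis (- (real n * x)) * d (cis x)" for x
  have c: "cmod (c x) \<le> 1" if "x \<in> X" for x using data[OF that] by (simp add: c_def norm_mult)
  have "\<bar>Re (c x) / 2\<bar> \<le> 1/2" "\<bar>Im (c x) / 2\<bar> \<le> 1/2" if "x \<in> X" for x
    using c[OF that] abs_Re_le_cmod[of "c x"] abs_Im_le_cmod[of "c x"] by auto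
  then obtain f g where f: "f \<in> V" "\<And>x. x \<in> X \<Longrightarrow> f x = Re (c x) / 2"
    and g: "g \<in> V" "\<And>x. x \<in> X \<Longrightarrow> g x = Im (c x) / 2"
    using interp[of "\<lambda>x. Re (c x) / 2"] interp[of "\<lambda>x. Im (c x) / 2"] by blast
  have "trig n (\<lambda>x. 2 * of_real (f x) + 2 * \<i> * of_real (g x))"
    using f g by (intro trig_add trig_scale) (auto simp: V_def)
  then obtain q where q: "degree q \<le> 2 * n"
    "\<And>x. poly q (cis x) = cis (real n * x) * (2 * of_real (f x) + 2 * \<i> * of_real (g x))"
    by (auto simp: trig_def)
  have "cmod (poly q u) \<le> 4 * h" if "cmod u = 1" for u
  proof -
    have u: "u = cis (Arg u)" using that rcis_cmod_Arg[of u] by (simp add: rcis_def)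
    have "cmod (poly q u) = cmod (2 * of_real (f (Arg u)) + 2 * \<i> * of_real (g (Arg u)))"
      by (subst u) (simp only: q(2) norm_mult norm_cis mult_1)
    also have "\<dots> \<le> 2 * \<bar>f (Arg u)\<bar> + 2 * \<bar>g (Arg u)\<bar>"
      by (rule order_trans[OF norm_triangle_ineq]) (simp add: norm_mult)
    also have "\<dots> \<le> 4 * h" using f(1) g(1) by (simp add: V_def) (smt (verit))
    finally show ?thesis .
  qed
  moreover have "poly q (cis x) = d (cis x)" if "x \<in> X" for x
  proof -
    have "2 * of_real (f x) + 2 * \<i> * of_real (g x) = c x"
      using f(2)[OF that] g(2)[OF that] by (simp add: complex_eq_iff)
    then have "poly q (cis x) = cis (real n * x) * c x"
      by (simp only: q(2))
    also have "\<dots> = (cis (real n * x) * cis (- (real n * x))) * d (cis x)"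
      by (simp only: c_def mult.assoc)
    finally show ?thesis by (simp add: cis_mult)
  qed
  ultimately show ?thesis using q(1) by (intro exI[of _ q] conjI ballI) auto
qed

section \<open>Shattered sets and the lower bound\<close>

lemma separated_card_le:
  fixes x :: "'a \<Rightarrow> real"
  assumes A: "finite A" and sep: "sep > 0" "\<And>i j. i \<in> A \<Longrightarrow> j \<in> A \<Longrightarrow> i \<noteq> j \<Longrightarrow> sep \<le> \<bar>x i - x j\<bar>"
    and range: "\<And>i. i \<in> A \<Longrightarrow> u \<le> x i \<and> x i \<le> u + l" and l: "0 \<le> l"
  shows "real (card A) \<le> l / sep + 1"
proof -
  define f where "f i = nat \<lfloor>(x i - u) / sep\<rfloor>" for i
  have "inj_on f A"
  proof (rule inj_onI, rule ccontr)
    fix i j assume ij: "i \<in> A" "j \<in> A" "f i = f j" "i \<noteq> j"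
    have "0 \<le> (x i - u) / sep" "0 \<le> (x j - u) / sep"
      using range ij sep(1) by auto
    then have "\<lfloor>(x i - u) / sep\<rfloor> = \<lfloor>(x j - u) / sep\<rfloor>"
      using ij(3) by (simp add: f_def nat_eq_iff2 split: if_splits)
    then have "\<bar>(x i - u) / sep - (x j - u) / sep\<bar> < 1" by linarith
    moreover have "(x i - u) / sep - (x j - u) / sep = (x i - x j) / sep"
      by (simp add: diff_divide_distrib)
    ultimately have "\<bar>x i - x j\<bar> < sep" using sep(1) by (simp add: abs_divide)
    then show False using sep(2)[OF ij(1,2,4)] by simp
  qed
  moreover have "f ` A \<subseteq> {0..nat \<lfloor>l / sep\<rfloor>}"
  proof (clarsimp simp: f_def)
    fix i assume "i \<in> A"
    then have "(x i - u) / sep \<le> l / sep" using range sep(1) by (intro divide_right_mono) force+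
    then show "nat \<lfloor>(x i - u) / sep\<rfloor> \<le> nat \<lfloor>l / sep\<rfloor>" by (intro nat_mono floor_mono)
  qed
  ultimately have "card A \<le> card {0..nat \<lfloor>l / sep\<rfloor>}" by (intro card_inj_on_le[of f]) auto
  then have "real (card A) \<le> real (nat \<lfloor>l / sep\<rfloor>) + 1" by simp
  also have "real (nat \<lfloor>l / sep\<rfloor>) \<le> l / sep" using l sep(1) by simp
  finally show ?thesis by simp
qed

lemma real_part_poly_exists:
  fixes P :: "complex poly"
  shows "\<exists>R. degree R \<le> degree P \<and> (\<forall>t. poly R (complex_of_real t) = of_real (Re (poly P (complex_of_real t))))"
proof (intro exI conjI allI)
  define R where "R = (\<Sum>k\<le>degree P. monom (complex_of_real (Re (coeff P k))) k)"
  show "degree R \<le> degree P"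
    unfolding R_def by (intro degree_sum_le order_trans[OF degree_monom_le]) auto
  fix t
  have "Re (poly P (complex_of_real t)) = (\<Sum>k\<le>degree P. Re (coeff P k) * t ^ k)"
    unfolding poly_altdef Re_sum of_real_power[symmetric] by simp
  then show "poly R (complex_of_real t) = of_real (Re (poly P (complex_of_real t)))"
    by (simp add: R_def poly_sum poly_monom)
qed

text \<open>The margin \<open>1\<close> is the margin \<open>1 - \<rho>\<close> of values within
  \<open>\<rho>\<close> of a sign, after division by \<open>1 - \<rho>\<close>. Values are real
  because the convexity argument works with real functions.\<close>

definition shattered :: "nat \<Rightarrow> real \<Rightarrow> (nat \<Rightarrow> real) \<Rightarrow> nat set \<Rightarrow> bool" where
  "shattered N h x A \<longleftrightarrow> (\<forall>y. (\<forall>i. y i \<in> {-1, 1::real}) \<longrightarrow> (\<exists>Q. degree Q \<le> N \<and>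
    (\<forall>t\<in>{-1..1}. poly Q (complex_of_real t) \<in> \<real> \<and> cmod (poly Q (complex_of_real t)) \<le> h) \<and>
    (\<forall>i\<in>A. y i * Re (poly Q (complex_of_real (x i))) \<ge> 1)))"

lemma shattered_empty: "0 \<le> h \<Longrightarrow> shattered N h x {}"
  by (auto simp: shattered_def intro!: exI[of _ 0])

lemma shattered_pair_separated:
  assumes "shattered N h (\<lambda>i. cos (\<theta> i)) {i, j}" "i \<noteq> j"
  shows "2 \<le> 3 * real N * h * \<bar>\<theta> i - \<theta> j\<bar>"
proof -
  obtain Q where Q: "degree Q \<le> N" "\<And>t. t \<in> {-1..1} \<Longrightarrow> cmod (poly Q (complex_of_real t)) \<le> h"
    "1 \<le> Re (poly Q (complex_of_real (cos (\<theta> i))))" "1 \<le> - Re (poly Q (complex_of_real (cos (\<theta> j))))"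
  proof -
    have "(if k = i then 1 else -1) \<in> {-1, 1::real}" for k by simp
    from assms(1)[unfolded shattered_def, rule_format, of "\<lambda>k. if k = i then 1 else -1", OF this]
    show thesis using that assms(2) by auto
  qed
  have "2 \<le> Re (poly Q (complex_of_real (cos (\<theta> i))) - poly Q (complex_of_real (cos (\<theta> j))))"
    using Q by simp
  also have "\<dots> \<le> cmod (poly Q (complex_of_real (cos (\<theta> i))) - poly Q (complex_of_real (cos (\<theta> j))))"
    by (rule complex_Re_le_cmod)
  also have "\<dots> \<le> 3 * real N * h * \<bar>\<theta> i - \<theta> j\<bar>"
    by (rule cos_poly_Lipschitz[OF Q(1,2)])
  finally show ?thesis .
qed

text \<open>The centre \<open>s\<close> is folded into \<open>c\<close> in \<open>[0, pi]\<close>,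
  so that both alternatives place \<open>\<theta> i\<close> within \<open>w\<close> of
  \<open>c\<close>. An interval of length \<open>2 * w\<close> then holds nodes at mutual distance
  at least \<open>2 / (3 * N * h)\<close>.\<close>

lemma window_card_le:
  assumes A: "finite A" and pairs: "\<And>i j. i \<in> A \<Longrightarrow> j \<in> A \<Longrightarrow> i \<noteq> j \<Longrightarrow> shattered N h (\<lambda>i. cos (\<theta> i)) {i, j}"
    and \<theta>: "\<And>i. i \<in> A \<Longrightarrow> 0 \<le> \<theta> i \<and> \<theta> i \<le> pi" and w: "0 \<le> w" "w \<le> pi" and N: "1 \<le> N" "0 < h"
    and near: "\<And>i. i \<in> A \<Longrightarrow> cos (\<theta> i - s) \<ge> cos w \<or> cos (\<theta> i + s) \<ge> cos w"
  shows "real (card A) \<le> 3 * real N * h * w + 1"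
proof -
  define c where "c = arccos (cos s)"
  have c: "0 \<le> c" "c \<le> pi" "cos c = cos s"
    by (auto simp: c_def arccos_lbound arccos_ubound)
  have "sin c = \<bar>sin s\<bar>"
    using sin_ge_zero[OF c(1,2)] c(3) sin_cos_squared_add2[of c] sin_cos_squared_add2[of s]
    by (metis abs_of_nonneg add_left_cancel power2_eq_iff_nonneg abs_ge_zero power2_abs)
  have close: "\<bar>\<theta> i - c\<bar> \<le> w" if i: "i \<in> A" for i
  proof -
    have "sin (\<theta> i) \<ge> 0" using \<theta>[OF i] by (simp add: sin_ge_zero)
    then have "\<bar>sin (\<theta> i) * sin s\<bar> = sin (\<theta> i) * sin c"
      using \<open>sin c = \<bar>sin s\<bar>\<close> by (simp add: abs_mult)
    then have "cos w \<le> cos (\<theta> i - c)"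
      using near[OF i] c(3) by (auto simp: cos_add cos_diff)
    then have "cos w \<le> cos \<bar>\<theta> i - c\<bar>" by simp
    then show ?thesis using \<theta>[OF i] c w by (subst (asm) cos_mono_le_eq) auto
  qed
  have "real (card A) \<le> (2 * w) / (2 / (3 * real N * h)) + 1"
  proof (rule separated_card_le[OF A, of _ \<theta> "c - w"])
    show "2 / (3 * real N * h) \<le> \<bar>\<theta> i - \<theta> j\<bar>" if "i \<in> A" "j \<in> A" "i \<noteq> j" for i j
      using shattered_pair_separated[OF pairs[OF that] that(3)] N by (simp add: field_simps)
    show "c - w \<le> \<theta> i \<and> \<theta> i \<le> c - w + 2 * w" if "i \<in> A" for i
      using close[OF that] by linarith
  qed (use N w in auto)
  then show ?thesis by (simp add: mult_ac)
qed

text \<open>\<open>S\<close> is the complement of a disjoint family of bad sets of maximal cardinality.\<close>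

lemma exists_hereditary_subset:
  fixes good :: "'a set \<Rightarrow> bool"
  assumes I: "finite I" and empty: "good {}" and M: "0 \<le> M"
    and families: "\<And>F. F \<subseteq> Pow I \<Longrightarrow> disjoint F \<Longrightarrow> (\<And>A. A \<in> F \<Longrightarrow> \<not> good A \<and> card A \<le> B) \<Longrightarrow> real (card F) \<le> M"
  obtains S where "S \<subseteq> I" "real (card I) - M * real B \<le> real (card S)"
    "\<And>A. A \<subseteq> S \<Longrightarrow> card A \<le> B \<Longrightarrow> good A"
proof -
  define ok where "ok F \<longleftrightarrow> F \<subseteq> Pow I \<and> disjoint F \<and> (\<forall>A\<in>F. \<not> good A \<and> card A \<le> B)" for F
  have fin: "finite F" if "ok F" for F
    using that I by (auto simp: ok_def intro: finite_subset[of F "Pow I"])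
  have le: "real (card F) \<le> M" if "ok F" for F using that families[of F] by (auto simp: ok_def)
  have "ok {}" by (simp add: ok_def)
  moreover have "\<forall>F. ok F \<longrightarrow> card F < nat \<lceil>M\<rceil> + 1" using le M by (auto simp: ) (meson le_nat_iff less_Suc_eq_le nat_le_real_less of_nat_ceiling order_trans le_nat_floor real_nat_ceiling_ge of_nat_le_iff)
  ultimately obtain F where F: "ok F" and max: "\<And>F'. ok F' \<Longrightarrow> card F' \<le> card F"
    using ex_has_greatest_nat[of ok "{}" card "nat \<lceil>M\<rceil> + 1"] by fastforce
  define S where "S = I - \<Union>F"
  have sub: "\<Union>F \<subseteq> I" using F by (auto simp: ok_def)
  have "card (\<Union>F) \<le> (\<Sum>A\<in>F. card A)" by (rule card_Union_le_sum_card)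
  also have "\<dots> \<le> (\<Sum>A\<in>F. B)" using F by (intro sum_mono) (auto simp: ok_def)
  finally have "real (card (\<Union>F)) \<le> real (card F) * real B" by (simp flip: of_nat_mult)
  also have "\<dots> \<le> M * real B" using le[OF F] by (intro mult_right_mono) auto
  finally have "real (card I) - M * real B \<le> real (card S)"
    using I sub by (simp add: S_def card_Diff_subset finite_subset card_mono of_nat_diff)
  moreover have "good A" if A: "A \<subseteq> S" "card A \<le> B" for A
  proof (rule ccontr)
    assume bad: "\<not> good A"
    have "A \<inter> C = {}" if "C \<in> F" for C using A(1) that by (auto simp: S_def)
    then have "ok (insert A F)"
      using F A bad by (auto simp: ok_def S_def disjoint_def)
    then have "card (insert A F) \<le> card F" by (rule max)
    \<comment> \<open>\<open>A\<close> is disjoint from every member of \<open>F\<close>; being one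
      itself would make it empty, and the empty set is good.\<close>
    then have "A \<in> F" using fin[OF F] by (metis card_insert_disjoint not_less_eq_eq order_refl)
    then have "A = {}" using \<open>\<And>C. C \<in> F \<Longrightarrow> A \<inter> C = {}\<close> by blast
    then show False using bad empty by simp
  qed
  ultimately show thesis using that[of S] by (auto simp: S_def)
qed

text \<open>A polynomial fitting a pattern that is bad on every member of a disjoint family errs at least
  once on each member.\<close>

lemma card_unshattered_family_le:
  assumes \<rho>: "0 \<le> \<rho>" "\<rho> < 1" and h: "C / (1 - \<rho>) \<le> h" and N: "N = nat \<lfloor>D\<rfloor>" "0 \<le> D"
    and fit: "\<And>y. y \<in> {1..n} \<rightarrow> {-1, 1} \<Longrightarrow> \<exists>P\<in>poly_class D C. real (err_count n \<rho> P x y) \<le> M"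
    and F: "F \<subseteq> Pow {1..n}" "disjoint F" "\<And>A. A \<in> F \<Longrightarrow> \<not> shattered N h x A"
    and x: "x \<in> {1..n} \<rightarrow> {-1..1}"
  shows "real (card F) \<le> M"
proof -
  have "\<exists>y. (\<forall>i. y i \<in> {-1, 1::real}) \<and> \<not> (\<exists>Q. degree Q \<le> N \<and>
    (\<forall>t\<in>{-1..1}. poly Q (complex_of_real t) \<in> \<real> \<and> cmod (poly Q (complex_of_real t)) \<le> h) \<and>
    (\<forall>i\<in>A. y i * Re (poly Q (complex_of_real (x i))) \<ge> 1))" if "A \<in> F" for A
    using F(3)[OF that] by (auto simp: shattered_def)
  then obtain y where y: "\<And>A i. A \<in> F \<Longrightarrow> y A i \<in> {-1, 1::real}"
    "\<And>A Q. A \<in> F \<Longrightarrow> degree Q \<le> N \<Longrightarrow>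
      \<forall>t\<in>{-1..1}. poly Q (complex_of_real t) \<in> \<real> \<and> cmod (poly Q (complex_of_real t)) \<le> h \<Longrightarrow>
      \<exists>i\<in>A. y A i * Re (poly Q (complex_of_real (x i))) < 1"
    by (metis not_le)
  define z where "z i = (if \<exists>A\<in>F. i \<in> A then y (THE A. A \<in> F \<and> i \<in> A) i else 1)" for i
  have z: "z i = y A i" if "A \<in> F" "i \<in> A" for A i
  proof -
    have "(THE A. A \<in> F \<and> i \<in> A) = A"
      using that F(2) by (intro the_equality) (auto simp: disjoint_def)
    then show ?thesis using that by (auto simp: z_def)
  qed
  have z1: "z i \<in> {-1, 1}" for i
  proof (cases "\<exists>A\<in>F. i \<in> A")
    case True then show ?thesis using z y(1) by metis
  qed (simp add: z_def)
  then obtain P where P: "P \<in> poly_class D C" "real (err_count n \<rho> P x z) \<le> M"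
    using fit[of z] by auto
  obtain R where R: "degree R \<le> degree P"
    "\<And>t. poly R (complex_of_real t) = of_real (Re (poly P (complex_of_real t)))"
    using real_part_poly_exists by blast
  \<comment> \<open>Where \<open>P\<close> is within \<open>\<rho>\<close> of a sign,
    \<open>Q\<close> has this sign with margin \<open>1\<close>; so a missed margin exhibits an
    error of \<open>P\<close>.\<close>
  define Q where "Q = smult (of_real (1 / (1 - \<rho>))) R"
  have Qval: "poly Q (complex_of_real t) = of_real (Re (poly P (complex_of_real t)) / (1 - \<rho>))" for t
    by (simp add: Q_def R)
  have "real (degree P) \<le> D" using P(1) by (simp add: poly_class_def)
  then have "degree P \<le> N" by (simp add: N le_nat_iff le_floor_iff)
  then have degQ: "degree Q \<le> N"
    using R(1) degree_smult_le[of "of_real (1 / (1 - \<rho>))" R] unfolding Q_def by linarith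
  have Qbound: "\<forall>t\<in>{-1..1}. poly Q (complex_of_real t) \<in> \<real> \<and> cmod (poly Q (complex_of_real t)) \<le> h"
  proof
    fix t :: real assume t: "t \<in> {-1..1}"
    have "cmod (poly P (complex_of_real t)) \<le> C"
      using poly_norm_attained[of P] P(1) t by (force simp: poly_class_def)
    then have "\<bar>Re (poly P (complex_of_real t))\<bar> \<le> C"
      using abs_Re_le_cmod order_trans by blast
    then have "\<bar>Re (poly P (complex_of_real t))\<bar> / (1 - \<rho>) \<le> C / (1 - \<rho>)"
      using \<rho> by (intro divide_right_mono) auto
    then show "poly Q (complex_of_real t) \<in> \<real> \<and> cmod (poly Q (complex_of_real t)) \<le> h"
      unfolding Qval norm_of_real using h \<rho> by (simp add: abs_divide)
  qed
  define E where "E = {i \<in> {1..n}. cmod (poly P (complex_of_real (x i)) - complex_of_real (z i)) > \<rho>}"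
  have "\<exists>i\<in>A. i \<in> E" if A: "A \<in> F" for A
  proof -
    obtain i where i: "i \<in> A" "y A i * Re (poly Q (complex_of_real (x i))) < 1"
      using y(2)[OF A degQ Qbound] by blast
    let ?p = "poly P (complex_of_real (x i))"
    have "z i * Re ?p / (1 - \<rho>) < 1"
      using i z[OF A i(1)] by (simp add: Qval)
    then have "z i * Re ?p < 1 - \<rho>" using \<rho> by (simp add: field_simps)
    moreover have "\<bar>Re (?p - complex_of_real (z i))\<bar> \<le> cmod (?p - complex_of_real (z i))"
      by (rule abs_Re_le_cmod)
    ultimately have "\<rho> < cmod (?p - complex_of_real (z i))"
      using z1[of i] by auto
    moreover have "i \<in> {1..n}" using i(1) F(1) A by blast
    ultimately show ?thesis using i(1) by (auto simp: E_def)
  qed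
  then obtain e where e: "\<And>A. A \<in> F \<Longrightarrow> e A \<in> A \<and> e A \<in> E" by metis
  have "inj_on e F"
    using e F(2) by (intro inj_onI) (metis disjoint_def disjoint_iff)
  then have "card F \<le> card E"
    using e by (intro card_inj_on_le[of e]) (auto simp: E_def)
  then show ?thesis using P(2) by (simp add: err_count_def E_def)
qed

section \<open>Choice of parameters and the lower bound\<close>

lemma one_minus_cos_ge:
  assumes "0 \<le> w" "w \<le> pi / 2"
  shows "w\<^sup>2 / 8 \<le> 1 - cos w"
proof -
  have "w / pi \<le> sin (w / 2)" using sin_ge_linear[of "w/2"] assms by simp
  moreover have "w / 4 \<le> w / pi" using assms pi_less_4 by (intro divide_left_mono) auto
  ultimately have "w / 4 \<le> sin (w / 2)" by (rule order_trans[rotated])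
  then have "(w / 4)\<^sup>2 \<le> (sin (w / 2))\<^sup>2" using assms by (intro power_mono) auto
  moreover have "1 - cos w = 2 * (sin (w / 2))\<^sup>2" using cos_double_sin[of "w / 2"] by simp
  ultimately show ?thesis by (simp add: power_divide)
qed

lemma lower_admissible:
  assumes C: "C > 0" and \<rho>: "0 \<le> \<rho>" "\<rho> < 1" and h: "h = 1 + C / (1 - \<rho>)"
  shows "admissible {-1, 1} C \<rho> (exp (- 320 * h))"
proof -
  define \<epsilon> where "\<epsilon> = exp (- 320 * h)"
  have h1: "1 \<le> h" using C \<rho> by (simp add: h)
  have \<epsilon>: "0 < \<epsilon>" "\<epsilon> < 1" using h1 by (auto simp: \<epsilon>_def)
  \<comment> \<open>The trace inequality will give \<open>ln J - 1 \<le> 30 * (4 * h) + 4\<close>,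
    which \<open>ln J \<ge> 150 * h\<close> contradicts as \<open>h \<ge> 1\<close>.\<close>
  define J where "J = nat \<lceil>exp (150 * h)\<rceil>"
  \<comment> \<open>A window of half-width \<open>12 * h / a\<close> holds at most
    \<open>36 * h^2 * N / a + 1\<close> nodes, and \<open>N / a \<le> 8 * J\<close>.\<close>
  define B where "B = nat \<lceil>288 * h\<^sup>2 * real J\<rceil> + 1"
  have J: "exp (150 * h) \<le> real J" "real J \<le> 2 * exp (150 * h)"
  proof -
    show "exp (150 * h) \<le> real J" by (simp add: J_def real_nat_ceiling_ge)
    have "real J \<le> exp (150 * h) + 1" by (simp add: J_def)
    also have "1 \<le> exp (150 * h)" using h1 by simp
    finally show "real J \<le> 2 * exp (150 * h)" by simp
  qed
  have lnJ: "150 * h \<le> ln (real J)"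
    using J(1) by (metis exp_gt_zero ln_exp ln_le_cancel_iff order_less_le_trans)
  have J2: "2 \<le> J"
  proof -
    have "1 + 150 * h \<le> exp (150 * h)" by (rule exp_ge_add_one_self)
    then have "2 \<le> real J" using J h1 by linarith
    then show ?thesis by simp
  qed
  have hh: "1 \<le> h\<^sup>2" "h \<le> h\<^sup>2" using h1 mult_mono[of 1 h 1 h] by (simp_all add: power2_eq_square)
  have hJ: "1 \<le> h\<^sup>2 * real J" using hh J2 by (intro mult_ge1_I) auto
  have B: "288 * h\<^sup>2 * real J + 1 \<le> real B" "real B \<le> 288 * h\<^sup>2 * real J + 2"
    unfolding B_def using hJ by linarith+
  \<comment> \<open>The excess degree and the discarded indices, together
    \<open>\<epsilon> * n * (1 + B)\<close>, must not exceed \<open>n / J\<close>. The product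
    \<open>(1 + B) * J\<close> is at most \<open>1164 * exp (302 * h)\<close>, which
    \<open>exp (320 * h)\<close> absorbs.\<close>
  have \<epsilon>BJ: "\<epsilon> * (1 + real B) * real J \<le> 1"
  proof -
    have hexp: "h \<le> exp h" using exp_ge_add_one_self[of h] by linarith
    have "(1 + real B) * real J \<le> (291 * (h\<^sup>2 * real J)) * real J"
      using B hJ by (intro mult_right_mono) auto
    also have "\<dots> = 291 * (h * real J)\<^sup>2" by (simp add: power2_eq_square)
    also have "\<dots> \<le> 291 * (exp h * (2 * exp (150 * h)))\<^sup>2"
      using J h1 hexp by (intro mult_left_mono power_mono mult_mono) auto
    also have "\<dots> = 1164 * exp (302 * h)"
      by (simp add: power2_eq_square flip: exp_add)
    also have "\<dots> \<le> exp 11 * exp (302 * h)"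
    proof (rule mult_right_mono)
      have "(2::real) ^ 11 \<le> exp 1 ^ 11"
        using exp_ge_add_one_self[of 1] by (intro power_mono) auto
      then show "1164 \<le> exp (11::real)" by (simp flip: exp_of_nat_mult)
    qed simp
    also have "\<dots> \<le> exp (320 * h)" using h1 by (simp flip: exp_add)
    finally have "\<epsilon> * ((1 + real B) * real J) \<le> \<epsilon> * exp (320 * h)"
      using \<epsilon> by (intro mult_left_mono) auto
    also have "\<dots> = 1" by (simp add: \<epsilon>_def flip: exp_add)
    finally show ?thesis by (simp add: mult.assoc)
  qed
  \<comment> \<open>Ensures \<open>n / J \<ge> 2 * B + 4\<close>, which absorbs the rounding in
    \<open>a\<close> and the \<open>2 * B\<close> nodes lost near the endpoints.\<close>
  define n0 where "n0 = J * (2 * B + 4)"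
  have "\<exists>y \<in> {1..n} \<rightarrow> {-1, 1}. \<forall>P \<in> poly_class ((1 + \<epsilon>) * real n) C. real (err_count n \<rho> P x y) > \<epsilon> * real n"
    if n: "n \<ge> n0" and x: "x \<in> {1..n} \<rightarrow> {-1..1}" for n x
  proof (rule ccontr)
    assume "\<not> ?thesis"
    then have fit: "\<exists>P\<in>poly_class ((1 + \<epsilon>) * real n) C. real (err_count n \<rho> P x y) \<le> \<epsilon> * real n"
      if "y \<in> {1..n} \<rightarrow> {-1, 1}" for y
      using that by (auto simp: not_less)
    define N where "N = nat \<lfloor>(1 + \<epsilon>) * real n\<rfloor>"
    \<comment> \<open>With kernels of this order, \<open>J\<close> multiples of the scale
      \<open>d = 4 * a\<close> fit below \<open>2 * n\<close>, hence below \<open>m\<close>.\<close>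
    define a where "a = n div (2 * J)"
    have nJ: "real J * (2 * real B + 4) \<le> real n"
    proof -
      have "real n0 \<le> real n" using n by simp
      then show ?thesis by (simp add: n0_def)
    qed
    have nJ': "2 * real B + 4 \<le> real n / real J" using nJ J2 by (simp add: field_simps)
    have "1 * 4 \<le> real J * (2 * real B + 4)" using J2 by (intro mult_mono) auto
    then have n1: "1 \<le> real n" using nJ by linarith
    have a_upper: "2 * J * a \<le> n" by (simp add: a_def)
    have a_lower: "real n / (2 * real J) - 1 \<le> real a"
    proof -
      have "n < 2 * J * a + 2 * J" using dividend_less_times_div[of "2 * J" n] J2 by (simp add: a_def)
      then have "real n < real (2 * J * a + 2 * J)" by (simp only: of_nat_less_iff)
      then have "real n < 2 * real J * (real a + 1)" by (simp add: distrib_left)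
      then show ?thesis using J2 by (simp add: field_simps)
    qed
    have a_lower': "real n / (4 * real J) \<le> real a"
      using a_lower nJ' by simp
    have "real B + 1 \<le> real a" using a_lower nJ' by simp
    moreover have "288 * (h\<^sup>2 * 1) \<le> 288 * (h\<^sup>2 * real J)"
      using J2 by (intro mult_left_mono) auto
    ultimately have a8: "8 * h \<le> real a" using B hh h1 by linarith
    then have a1: "1 \<le> a" using h1 by linarith
    have N_le: "real N \<le> (1 + \<epsilon>) * real n" using \<epsilon> by (simp add: N_def)
    have "real n \<le> (1 + \<epsilon>) * real n" using \<epsilon> by (simp add: distrib_right)
    then have nN: "n \<le> N" by (simp add: N_def le_nat_iff le_floor_iff)
    have N2: "real N \<le> 2 * real n"
    proof -
      have "(1 + \<epsilon>) * real n \<le> 2 * real n" using \<epsilon> by (intro mult_right_mono) auto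
      then show ?thesis using N_le by linarith
    qed
    have N1: "1 \<le> N" using nN n1 by simp
    \<comment> \<open>Makes \<open>w^2 / 16\<close> equal to \<open>9 * h^2 / a^2\<close>, which
      dominates \<open>1 + h\<close> times the second moment of the Jackson kernel.\<close>
    define w where "w = 12 * h / real a"
    have w0: "0 < w" using h1 a1 by (simp add: w_def)
    have w1: "w \<le> pi / 2"
    proof -
      have "w \<le> 12 * h / (8 * h)" unfolding w_def using h1 a8 by (intro divide_left_mono) auto
      also have "\<dots> \<le> pi / 2" using h1 pi_gt3 by simp
      finally show ?thesis .
    qed
    have window: "3 * real N * h * w + 1 \<le> real B"
    proof -
      have "real N * (real n / (4 * real J)) \<le> 2 * real n * real a"
        using N2 a_lower' by (intro mult_mono) auto
      then have "real N / real a \<le> 8 * real J"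
        using a1 n1 J2 by (simp add: field_simps)
      then have "36 * h\<^sup>2 * (real N / real a) \<le> 36 * h\<^sup>2 * (8 * real J)"
        by (intro mult_left_mono) auto
      then show ?thesis using B(1) by (simp add: w_def power2_eq_square mult_ac)
    qed
    have tail: "(1 + h) * (4 / (real a)\<^sup>2) \<le> (1 - cos w) / 2"
    proof -
      have "4 * 1 + 4 * h \<le> 4 * h\<^sup>2 + 4 * h\<^sup>2"
        using hh by (intro add_mono mult_left_mono) auto
      then have "(1 + h) * 4 \<le> 9 * h\<^sup>2" using hh(1) by simp
      then have "(1 + h) * 4 / (real a)\<^sup>2 \<le> 9 * h\<^sup>2 / (real a)\<^sup>2" by (intro divide_right_mono) auto
      also have "\<dots> = w\<^sup>2 / 8 / 2" by (simp add: w_def power_divide power_mult_distrib)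
      also have "\<dots> \<le> (1 - cos w) / 2" using one_minus_cos_ge[of w] w0 w1 by simp
      finally show ?thesis by simp
    qed
    define \<theta> where "\<theta> i = arccos (x i)" for i
    have x_cos: "x i = cos (\<theta> i)" "0 \<le> \<theta> i" "\<theta> i \<le> pi" if "i \<in> {1..n}" for i
      using funcset_mem[OF x that] by (auto simp: \<theta>_def arccos_lbound arccos_ubound)
    have shat_cong: "shattered N h (\<lambda>i. cos (\<theta> i)) A \<longleftrightarrow> shattered N h x A" if "A \<subseteq> {1..n}" for A
    proof -
      have "\<forall>i\<in>A. x i = cos (\<theta> i)" using that x_cos(1) by blast
      then show ?thesis by (simp add: shattered_def cong: ball_cong)
    qed
    obtain S where S: "S \<subseteq> {1..n}" "real n - \<epsilon> * real n * real B \<le> real (card S)"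
      and shat: "\<And>A. A \<subseteq> S \<Longrightarrow> card A \<le> B \<Longrightarrow> shattered N h x A"
    proof (rule exists_hereditary_subset[of "{1..n}" "shattered N h x" "\<epsilon> * real n" B])
      show "real (card F) \<le> \<epsilon> * real n"
        if "F \<subseteq> Pow {1..n}" "disjoint F" "\<And>A. A \<in> F \<Longrightarrow> \<not> shattered N h x A \<and> card A \<le> B" for F
      proof (rule card_unshattered_family_le[OF \<rho> _ N_def _ fit that(1,2) _ x])
        show "C / (1 - \<rho>) \<le> h" by (simp add: h)
        show "\<not> shattered N h x A" if "A \<in> F" for A
          using \<open>\<And>A. A \<in> F \<Longrightarrow> \<not> shattered N h x A \<and> card A \<le> B\<close> that by blast
      qed (use \<epsilon> in auto)
      show "shattered N h x {}" using h1 by (intro shattered_empty) simp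
    qed (use \<epsilon> in auto)
    have finS: "finite S" using S(1) finite_subset by blast
    have B2: "2 \<le> B" using B(1) hJ by linarith
    have pairs: "shattered N h (\<lambda>i. cos (\<theta> i)) {i, j}" if "i \<in> S" "j \<in> S" for i j
    proof -
      have "card {i, j} \<le> B" using B2 card_insert_le_m1[of 2 "{j}" i] by simp
      moreover have "{i, j} \<subseteq> S" "{i, j} \<subseteq> {1..n}" using that S(1) by blast+
      ultimately show ?thesis using shat shat_cong by blast
    qed
    have window_card: "card A \<le> B"
      if "A \<subseteq> S" "\<And>i. i \<in> A \<Longrightarrow> cos (\<theta> i - s) \<ge> cos w \<or> cos (\<theta> i + s) \<ge> cos w" for A s
    proof -
      have "real (card A) \<le> 3 * real N * h * w + 1"
      proof (rule window_card_le[of A N h \<theta> w s])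
        show "0 \<le> \<theta> i \<and> \<theta> i \<le> pi" if "i \<in> A" for i
          using that \<open>A \<subseteq> S\<close> S(1) x_cos(2,3)[of i] by auto
        show "shattered N h (\<lambda>i. cos (\<theta> i)) {i, j}" if "i \<in> A" "j \<in> A" for i j
          using that \<open>A \<subseteq> S\<close> by (intro pairs) auto
        show "finite A" using \<open>A \<subseteq> S\<close> finS by (rule finite_subset)
      qed (use that w0 w1 N1 h1 in auto)
      then show ?thesis using window by linarith
    qed
    \<comment> \<open>Without the nodes near the endpoints no window contains both
      \<open>\<theta> i\<close> and \<open>- \<theta> i\<close>. Each end is itself a window,
      centred at \<open>0\<close> or \<open>pi\<close>, so at most \<open>2 * B\<close> nodes are
      lost.\<close>
    define S' where "S' = {i \<in> S. w < \<theta> i \<and> \<theta> i < pi - w}"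
    have S': "S' \<subseteq> S" "finite S'" using finS by (auto simp: S'_def)
    have cardS': "real (card S) - 2 * real B \<le> real (card S')"
    proof -
      define A1 where "A1 = {i \<in> S. \<theta> i \<le> w}"
      define A2 where "A2 = {i \<in> S. pi - w \<le> \<theta> i}"
      have "card A1 \<le> B"
      proof (rule window_card[of _ 0])
        fix i assume "i \<in> A1"
        then have "0 \<le> \<theta> i" "\<theta> i \<le> w" using S(1) x_cos(2)[of i] by (auto simp: A1_def)
        then show "cos w \<le> cos (\<theta> i - 0) \<or> cos w \<le> cos (\<theta> i + 0)"
          using w0 w1 by (simp add: cos_monotone_0_pi_le)
      qed (auto simp: A1_def)
      moreover have "card A2 \<le> B"
      proof (rule window_card[of _ pi])
        fix i assume "i \<in> A2"
        then have "0 \<le> pi - \<theta> i" "pi - \<theta> i \<le> w" using S(1) x_cos(3)[of i] by (auto simp: A2_def)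
        then have "cos w \<le> cos (pi - \<theta> i)" using w0 w1 by (intro cos_monotone_0_pi_le) auto
        then show "cos w \<le> cos (\<theta> i - pi) \<or> cos w \<le> cos (\<theta> i + pi)" by simp
      qed (auto simp: A2_def)
      moreover have "card S \<le> card (S' \<union> A1 \<union> A2)"
        using finS by (intro card_mono) (auto simp: S'_def A1_def A2_def)
      ultimately show ?thesis
        using card_Un_le[of "S' \<union> A1" A2] card_Un_le[of S' A1] by linarith
    qed
    define X where "X = \<theta> ` S' \<union> (\<lambda>i. - \<theta> i) ` S'"
    have finX: "finite X" using S' by (simp add: X_def)
    have inj\<theta>: "inj_on \<theta> S'"
    proof (rule inj_onI, rule ccontr)
      fix i j assume "i \<in> S'" "j \<in> S'" "\<theta> i = \<theta> j" "i \<noteq> j"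
      then show False using shattered_pair_separated[OF pairs[of i j]] S'(1) by auto
    qed
    have cardZ: "card (cis ` X) = 2 * card S'"
    proof -
      have "inj_on cis X"
      proof (rule inj_on_inverseI)
        fix t assume "t \<in> X"
        then have "- pi < t" "t \<le> pi" using w0 by (auto simp: X_def S'_def)
        then show "Arg (cis t) = t" by (intro Arg_cis) auto
      qed
      then have "card (cis ` X) = card X" by (rule card_image)
      also have "\<dots> = card (\<theta> ` S') + card ((\<lambda>i. - \<theta> i) ` S')"
        unfolding X_def using S'(2) w0 by (intro card_Un_disjoint) (auto simp: S'_def)
      also have "card (\<theta> ` S') = card S'" using inj\<theta> by (rule card_image)
      also have "card ((\<lambda>i. - \<theta> i) ` S') = card S'"
        using inj\<theta> by (intro card_image) (auto simp: inj_on_def)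
      finally show ?thesis by simp
    qed
    define d where "d = 4 * a"
    \<comment> \<open>\<open>m - d\<close> is the degree of the glued polynomials on the circle.
      With \<open>2 * card S'\<close> nodes there, \<open>m\<close> exceeds their number by
      \<open>2 * (N - card S') + 8 * a\<close>, at most \<open>16 * a = 4 * d\<close> once
      \<open>N - card S' \<le> 4 * a\<close>.\<close>
    define m where "m = 2 * (N + 2 * a) + d"
    have signs: "\<exists>f. trig (N + 2 * a) (\<lambda>t. of_real (f t)) \<and> (\<forall>t. \<bar>f t\<bar> \<le> h) \<and> (\<forall>t\<in>X. y t * f t \<ge> 1/2)"
      if y: "\<And>t. y t \<in> {-1, 1}" for y
      unfolding X_def
    proof (rule glue_signs[OF a1 _ _ w0 w1 tail _ y])
      fix s :: real and y' :: "nat \<Rightarrow> real" assume y': "\<And>i. y' i \<in> {-1, 1}"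
      define A where "A = {i \<in> S'. cos (\<theta> i - s) \<ge> cos w \<or> cos (\<theta> i + s) \<ge> cos w}"
      have A: "A \<subseteq> S" using S'(1) by (auto simp: A_def)
      moreover have "card A \<le> B" by (rule window_card[OF A, of s]) (simp add: A_def)
      ultimately have "shattered N h (\<lambda>i. cos (\<theta> i)) A"
        using shat shat_cong[OF subset_trans[OF A S(1)]] by blast
      then show "\<exists>Q. degree Q \<le> N \<and>
          (\<forall>t\<in>{-1..1}. poly Q (complex_of_real t) \<in> \<real> \<and> cmod (poly Q (complex_of_real t)) \<le> h) \<and>
          (\<forall>i\<in>S'. cos (\<theta> i - s) \<ge> cos w \<or> cos (\<theta> i + s) \<ge> cos w \<longrightarrow>
            y' i * Re (poly Q (complex_of_real (cos (\<theta> i)))) \<ge> 1)"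
        using y' unfolding shattered_def A_def by blast
    qed (use h1 in \<open>auto simp: S'_def\<close>)
    obtain b :: "nat \<Rightarrow> real" where b: "\<And>j. 0 \<le> b j" "\<And>j. b j \<le> 1 / real j"
      "ln (real J) - 1 \<le> (\<Sum>j=1..J. b j)" "\<And>t. \<bar>\<Sum>j=1..J. b j * sin (real j * t)\<bar> \<le> 3"
      using sin_series_bounded[OF J2] by blast
    have "(\<Sum>j=1..J. b j) \<le> 30 * (4 * h) + 4"
    proof (rule trace_bound[of "cis ` X" d J m])
      show "J * d \<le> m" using a_upper nN by (simp add: m_def d_def)
      have "\<epsilon> * real n * (1 + real B) \<le> real n / real J"
        using mult_right_mono[OF \<epsilon>BJ, of "real n"] J2 by (simp add: field_simps)
      moreover have "2 * real n / real J - 4 \<le> 4 * real a"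
      proof -
        have "2 * real n / real J - 4 = 4 * (real n / (2 * real J) - 1)"
          by (simp add: right_diff_distrib)
        then show ?thesis using a_lower by linarith
      qed
      moreover have "real N - real n \<le> \<epsilon> * real n" using N_le by (simp add: distrib_right)
      \<comment> \<open>Three losses add up: \<open>\<epsilon> * n\<close> from the degree,
        \<open>\<epsilon> * n * B\<close> from the discarded sets and \<open>2 * B\<close> from the
        endpoints.\<close>
      ultimately have "real N - real (card S') \<le> 4 * real a"
        using S(2) cardS' nJ' by (simp add: distrib_left)
      then have "N \<le> card S' + 4 * a" by linarith
      then show "m \<le> card (cis ` X) + 4 * d"
        by (simp add: m_def d_def cardZ)
      show "\<exists>q. degree q \<le> m - d \<and> (\<forall>u. cmod u = 1 \<longrightarrow> cmod (poly q u) \<le> 4 * h) \<and> (\<forall>z\<in>cis ` X. poly q z = e z)"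
        if "\<And>z. z \<in> cis ` X \<Longrightarrow> cmod (e z) \<le> 1" for e
        using circle_interpolation[OF finX signs, of e] that by (simp add: m_def)
    qed (use finX a1 h1 b in \<open>auto simp: d_def\<close>)
    then show False using b(3) lnJ h1 by linarith
  qed
  moreover have "1 \<le> n0" using J2 by (simp add: n0_def)
  ultimately show ?thesis
    unfolding admissible_def \<epsilon>_def[symmetric] using \<epsilon> by blast
qed

theorem theorem2p3:
  "(\<exists>A>0::real. \<forall>C \<rho>::real. C > 0 \<longrightarrow> 0 \<le> \<rho> \<longrightarrow> \<rho> < 1 \<longrightarrow>
      exp (- A * (1 + C / (1 - \<rho>))) \<le> eps_star C \<rho>) \<and>
   (\<forall>C \<rho>::real. C > 0 \<longrightarrow> 0 \<le> \<rho> \<longrightarrow> \<rho> < 1 \<longrightarrow> C / (1 - \<rho>) > 3 \<longrightarrow>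
      eps_star C \<rho> \<le> exp (pi / 2 * (3 - C / (1 - \<rho>))) \<and>
      eps_star_on {-1..1} C \<rho> \<le> exp (pi / 2 * (3 - C / (1 - \<rho>))))"
proof (intro conjI exI[of _ "320::real"] allI impI)
  fix C \<rho> :: real assume *: "C > 0" "0 \<le> \<rho>" "\<rho> < 1"
  let ?e = "exp (- 320 * (1 + C / (1 - \<rho>)))"
  have adm: "admissible {-1, 1} C \<rho> ?e" using lower_admissible[OF * refl] .
  moreover have "bdd_above {\<epsilon>. admissible {-1, 1} C \<rho> \<epsilon>}"
    by (auto simp: admissible_def intro!: bdd_aboveI[of _ 1])
  ultimately have "?e \<le> Sup {\<epsilon>. admissible {-1, 1} C \<rho> \<epsilon>}" by (intro cSup_upper) auto
  then show "?e \<le> eps_star C \<rho>" using adm by (auto simp: eps_star_on_def)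
next
  fix C \<rho> :: real assume *: "C > 0" "0 \<le> \<rho>" "\<rho> < 1" "C / (1 - \<rho>) > 3"
  show "eps_star C \<rho> \<le> exp (pi / 2 * (3 - C / (1 - \<rho>)))"
    by (rule eps_star_on_upper[OF *]) simp
  show "eps_star_on {-1..1} C \<rho> \<le> exp (pi / 2 * (3 - C / (1 - \<rho>)))"
    by (rule eps_star_on_upper[OF *]) simp
qed simp

end
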